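(* Up to sign of the $f$-structure and up to homothety of the metric (so that the metric is normalized as $g=(1,t,s)$, $t,s>0$), the flag manifold $M=SU(3)/T_{max}$ admits the following (non-zero) invariant Kähler $f$-structures with respect to the corresponding invariant Riemannian metrics, and no others: $$ \begin{array}{lll} J_2=(1,-1,1), & g_t=(1,t,t-1), & t>1;\\ J_3=(1,1,-1), & g_t=(1,t,t+1), & t>0;\\ J_4=(1,-1,-1), & g_t=(1,t,1-t), & 0<t<1. \end{array} $$ In particular, there are no invariant Kähler $f$-structures of rank $2$ or $4$ on $M$.
   Context: Setting. $T_{max}\subset SU(3)$ is the subgroup of diagonal matrices. Let $\mathfrak g=\mathfrak{su}(3)=\mathfrak h\oplus\mathfrak m$, where $\mathfrak h$ consists of the diagonal matrices in $\mathfrak{su}(3)$ and $\mathfrak m$ consists of the matrices $$D(a,b,c)=\begin{pmatrix}0&a&\overline c\\-\overline a&0&b\\-c&-\overline b&0\end{pmatrix},\quad a,b,c\in\mathbb C.$$ Identify $\mathfrak m$ with the tangent space $T_o M$ of $M=SU(3)/T_{max}$ at $o=T_{max}$. Put $\mathfrak m_1=\{D(a,0,0)\}$, $\mathfrak m_2=\{D(0,b,0)\}$, $\mathfrak m_3=\{D(0,0,c)\}$, so $\mathfrak m=\mathfrak m_1\oplus\mathfrak m_2\oplus\mathfrak m_3$. Invariant metrics. Let $\langle X,Y\rangle_o=-\frac12\operatorname{Re}\operatorname{tr}(XY)$. For $\lambda_1,\lambda_2,\lambda_3>0$, $g=(\lambda_1,\lambda_2,\lambda_3)$ denotes the $SU(3)$-invariant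 Riemannian metric on $M$ whose value at $o$ makes the $\mathfrak m_j$ mutually orthogonal and equals $\lambda_j\langle\cdot,\cdot\rangle_o$ on $\mathfrak m_j$, $j=1,2,3$. Every $SU(3)$-invariant Riemannian metric on $M$ is of this form. Invariant $f$-structures. An $f$-structure is a $(1,1)$-tensor field $f$ with $f^3+f=0$; its rank is $\dim \operatorname{Im} f$. For $\zeta_1,\zeta_2,\zeta_3\in\{-1,0,1\}$, $f=(\zeta_1,\zeta_2,\zeta_3)$ denotes the $SU(3)$-invariant $f$-structure on $M$ given at $o$ by $D(a,b,c)\mapsto D(\zeta_1 ia,\zeta_2 ib,\zeta_3 ic)$. Every $SU(3)$-invariant $f$-structure on $M$ is of this form, and each is a metric $f$-structure (i.e. $g(fX,Y)+g(X,fY)=0$) for every invariant Riemannian metric $g$. Kähler $f$-structures. Let $\nabla$ be the Levi-Civita connection of $g$ and $\nabla_X(f)Y=\nabla_X(fY)-f\nabla_XY$. A metric $f$-structure $f$ on $(M,g)$ is a Kähler $f$-structure if $\nabla_X(f)Y=0$ for all vector fields $X,Y$ (i.e. $\nabla f=0$). *)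

theory Defs
  imports "HOL-Analysis.Analysis" "HOL-Library.Function_Algebras"
begin

text \<open>Sums of tangent vectors are taken pointwise, through the library's
  \<open>Function_Algebras\<close>.\<close>

section \<open>Smooth functions on Euclidean spaces\<close>

primrec Ck :: "nat \<Rightarrow> ('a::euclidean_space \<Rightarrow> 'b::real_normed_vector) \<Rightarrow> bool" where
  "Ck 0 f \<longleftrightarrow> continuous_on UNIV f"
| "Ck (Suc k) f \<longleftrightarrow>
     (\<forall>x. f differentiable (at x)) \<and> (\<forall>v. Ck k (\<lambda>x. frechet_derivative f (at x) v))"

definition smooth :: "('a::euclidean_space \<Rightarrow> 'b::real_normed_vector) \<Rightarrow> bool" where
  "smooth f \<longleftrightarrow> (\<forall>k. Ck k f)"

section \<open>The flag manifold\<close>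

type_synonym mat3 = "complex^3^3"

text \<open>A point of the flag manifold is a left coset of the diagonal torus.\<close>

type_synonym point = "mat3 set"

definition ctranspose :: "mat3 \<Rightarrow> mat3" where
  "ctranspose A = (\<chi> i j. cnj (A $ j $ i))"

definition SU3 :: "mat3 set" where
  "SU3 = {A. A ** ctranspose A = mat 1 \<and> det A = 1}"

definition Tmax :: "mat3 set" where
  "Tmax = {A \<in> SU3. \<forall>i j. i \<noteq> j \<longrightarrow> A $ i $ j = 0}"

definition coset :: "mat3 \<Rightarrow> point" where
  "coset a = (\<lambda>h. a ** h) ` Tmax"

definition flagM :: "point set" where
  "flagM = coset ` SU3"

definition origin :: point where
  "origin = coset (mat 1)"

definition act :: "mat3 \<Rightarrow> point \<Rightarrow> point" where
  "act a p = (\<lambda>b. a ** b) ` p"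

text \<open>The quotient smooth structure: a function on the flag manifold is smooth iff its pullback
  to \<open>SU3\<close> is smooth. As \<open>SU3\<close> is a closed submanifold of the space of all matrices, its smooth
  functions are the restrictions of smooth functions of matrices. Values outside \<open>flagM\<close> are
  irrelevant.\<close>

definition smooth_fun :: "(point \<Rightarrow> real) set" where
  "smooth_fun = {F. \<exists>\<Phi> :: mat3 \<Rightarrow> real. smooth \<Phi> \<and> (\<forall>a\<in>SU3. F (coset a) = \<Phi> a)}"

definition smooth_curve :: "(real \<Rightarrow> point) \<Rightarrow> bool" where
  "smooth_curve \<gamma> \<longleftrightarrow> (\<forall>t. \<gamma> t \<in> flagM) \<and> (\<forall>F\<in>smooth_fun. smooth (F \<circ> \<gamma>))"

section \<open>Tangent vectors and vector fields\<close>

text \<open>A tangent vector is a directional derivative operator on smooth functions, namely the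
  velocity of a smooth curve. It is set to zero on non-smooth functions, so that equality of
  tangent vectors is equality of functionals.\<close>

type_synonym tvec = "(point \<Rightarrow> real) \<Rightarrow> real"

definition velocity :: "(real \<Rightarrow> point) \<Rightarrow> tvec" where
  "velocity \<gamma> = (\<lambda>F. if F \<in> smooth_fun then deriv (F \<circ> \<gamma>) 0 else 0)"

definition tangent :: "point \<Rightarrow> tvec set" where
  "tangent p = {velocity \<gamma> | \<gamma>. smooth_curve \<gamma> \<and> \<gamma> 0 = p}"

definition scal :: "real \<Rightarrow> tvec \<Rightarrow> tvec" where
  "scal c v = (\<lambda>F. c * v F)"

lemma vector_space_scal: "vector_space scal"
  by unfold_locales (auto simp: scal_def fun_eq_iff algebra_simps)

text \<open>The differential of the left translation \<open>act a\<close>.\<close>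

definition dact :: "mat3 \<Rightarrow> tvec \<Rightarrow> tvec" where
  "dact a v = (\<lambda>F. v (F \<circ> act a))"

text \<open>Vector fields vanish outside \<open>flagM\<close>, so that equality of vector fields is equality of
  functions.\<close>

type_synonym vfield = "point \<Rightarrow> tvec"

definition vfields :: "vfield set" where
  "vfields = {X. (\<forall>p\<in>flagM. X p \<in> tangent p) \<and> (\<forall>p. p \<notin> flagM \<longrightarrow> X p = 0) \<and>
                 (\<forall>F\<in>smooth_fun. (\<lambda>p. X p F) \<in> smooth_fun)}"

definition smul :: "(point \<Rightarrow> real) \<Rightarrow> vfield \<Rightarrow> vfield" where
  "smul F X = (\<lambda>p. scal (F p) (X p))"

definition lie_bracket :: "vfield \<Rightarrow> vfield \<Rightarrow> vfield" where
  "lie_bracket X Y = (\<lambda>p F. X p (\<lambda>q. Y q F) - Y p (\<lambda>q. X q F))"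

section \<open>Riemannian metrics and the Levi-Civita connection\<close>

type_synonym metric = "point \<Rightarrow> tvec \<Rightarrow> tvec \<Rightarrow> real"

definition riemannian_metric :: "metric \<Rightarrow> bool" where
  "riemannian_metric g \<longleftrightarrow>
     (\<forall>p\<in>flagM. \<forall>u\<in>tangent p. \<forall>v\<in>tangent p. \<forall>w\<in>tangent p. \<forall>c.
        g p (u + v) w = g p u w + g p v w \<and> g p (scal c v) w = c * g p v w \<and>
        g p v w = g p w v \<and> (v \<noteq> 0 \<longrightarrow> 0 < g p v v)) \<and>
     (\<forall>X\<in>vfields. \<forall>Y\<in>vfields. (\<lambda>p. g p (X p) (Y p)) \<in> smooth_fun)"

definition invariant_metric :: "metric \<Rightarrow> bool" where
  "invariant_metric g \<longleftrightarrow> riemannian_metric g \<and>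
     (\<forall>a\<in>SU3. \<forall>p\<in>flagM. \<forall>v\<in>tangent p. \<forall>w\<in>tangent p.
        g (act a p) (dact a v) (dact a w) = g p v w)"

definition levi_civita :: "metric \<Rightarrow> (vfield \<Rightarrow> vfield \<Rightarrow> vfield) \<Rightarrow> bool" where
  "levi_civita g D \<longleftrightarrow>
     (\<forall>X\<in>vfields. \<forall>Y\<in>vfields. D X Y \<in> vfields) \<and>
     (\<forall>X\<in>vfields. \<forall>Y\<in>vfields. \<forall>Z\<in>vfields.
        D (X + Y) Z = D X Z + D Y Z \<and> D X (Y + Z) = D X Y + D X Z) \<and>
     (\<forall>F\<in>smooth_fun. \<forall>X\<in>vfields. \<forall>Y\<in>vfields.
        D (smul F X) Y = smul F (D X Y) \<and>
        D X (smul F Y) = smul (\<lambda>p. X p F) Y + smul F (D X Y)) \<and>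
     (\<forall>X\<in>vfields. \<forall>Y\<in>vfields. D X Y - D Y X = lie_bracket X Y) \<and>
     (\<forall>X\<in>vfields. \<forall>Y\<in>vfields. \<forall>Z\<in>vfields. \<forall>p\<in>flagM.
        X p (\<lambda>q. g q (Y q) (Z q)) = g p (D X Y p) (Z p) + g p (Y p) (D X Z p))"

section \<open>f-structures\<close>

type_synonym tensor11 = "point \<Rightarrow> tvec \<Rightarrow> tvec"

definition tapply :: "tensor11 \<Rightarrow> vfield \<Rightarrow> vfield" where
  "tapply f X = (\<lambda>p. if p \<in> flagM then f p (X p) else 0)"

definition tensor_field :: "tensor11 \<Rightarrow> bool" where
  "tensor_field f \<longleftrightarrow>
     (\<forall>p\<in>flagM. \<forall>v\<in>tangent p. \<forall>w\<in>tangent p. \<forall>c.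
        f p v \<in> tangent p \<and> f p (v + w) = f p v + f p w \<and> f p (scal c v) = scal c (f p v)) \<and>
     (\<forall>X\<in>vfields. tapply f X \<in> vfields)"

definition f_structure :: "tensor11 \<Rightarrow> bool" where
  "f_structure f \<longleftrightarrow> tensor_field f \<and>
     (\<forall>p\<in>flagM. \<forall>v\<in>tangent p. f p (f p (f p v)) + f p v = 0)"

definition invariant_f_structure :: "tensor11 \<Rightarrow> bool" where
  "invariant_f_structure f \<longleftrightarrow> f_structure f \<and>
     (\<forall>a\<in>SU3. \<forall>p\<in>flagM. \<forall>v\<in>tangent p. f (act a p) (dact a v) = dact a (f p v))"

definition nonzero_f :: "tensor11 \<Rightarrow> bool" where
  "nonzero_f f \<longleftrightarrow> (\<exists>p\<in>flagM. \<exists>v\<in>tangent p. f p v \<noteq> 0)"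

definition f_rank :: "tensor11 \<Rightarrow> point \<Rightarrow> nat" where
  "f_rank f p = vector_space.dim scal (f p ` tangent p)"

definition metric_f_structure :: "metric \<Rightarrow> tensor11 \<Rightarrow> bool" where
  "metric_f_structure g f \<longleftrightarrow> f_structure f \<and>
     (\<forall>p\<in>flagM. \<forall>v\<in>tangent p. \<forall>w\<in>tangent p. g p (f p v) w + g p v (f p w) = 0)"

text \<open>The Levi-Civita connection of \<open>g\<close> exists and is unique on \<open>vfields\<close>; the existential
  quantifier below merely names it.\<close>

definition kaehler_f_structure :: "metric \<Rightarrow> tensor11 \<Rightarrow> bool" where
  "kaehler_f_structure g f \<longleftrightarrow> riemannian_metric g \<and> metric_f_structure g f \<and>
     (\<exists>D. levi_civita g D \<and>
        (\<forall>X\<in>vfields. \<forall>Y\<in>vfields. D X (tapply f Y) - tapply f (D X Y) = 0))"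

definition invariant_kaehler :: "metric \<Rightarrow> tensor11 \<Rightarrow> bool" where
  "invariant_kaehler g f \<longleftrightarrow>
     invariant_metric g \<and> invariant_f_structure f \<and> kaehler_f_structure g f"

section \<open>The standard invariant metrics and f-structures\<close>

definition Dmat :: "complex \<Rightarrow> complex \<Rightarrow> complex \<Rightarrow> mat3" where
  "Dmat a b c = vector [vector [0, a, cnj c],
                        vector [- cnj a, 0, b],
                        vector [- c, - cnj b, 0]]"

definition ip :: "mat3 \<Rightarrow> mat3 \<Rightarrow> real" where
  "ip X Y = - (1/2) * Re (trace (X ** Y))"

text \<open>The differential at the identity of the projection \<open>coset\<close>, computed along any smooth curve
  in \<open>SU3\<close>. Restricted to the matrices \<open>Dmat a b c\<close>, it identifies them with the tangent space at
  the origin.\<close>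

definition dcoset :: "mat3 \<Rightarrow> tvec" where
  "dcoset X = (THE v. \<exists>c :: real \<Rightarrow> mat3. smooth c \<and> (\<forall>t. c t \<in> SU3) \<and> c 0 = mat 1 \<and>
      (c has_vector_derivative X) (at 0) \<and> v = velocity (coset \<circ> c))"

text \<open>The metric and the f-structure with given parameters are prescribed at the origin and
  transported by the group action. The values do not depend on the choice of \<open>h\<close>.\<close>

definition flag_metric :: "real \<Rightarrow> real \<Rightarrow> real \<Rightarrow> metric" where
  "flag_metric l1 l2 l3 p v w = (THE r. \<exists>h\<in>SU3. \<exists>a b c a' b' c'.
      p = act h origin \<and>
      v = dact h (dcoset (Dmat a b c)) \<and> w = dact h (dcoset (Dmat a' b' c')) \<and>
      r = l1 * ip (Dmat a 0 0) (Dmat a' 0 0)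
        + l2 * ip (Dmat 0 b 0) (Dmat 0 b' 0)
        + l3 * ip (Dmat 0 0 c) (Dmat 0 0 c'))"

definition flag_f :: "int \<Rightarrow> int \<Rightarrow> int \<Rightarrow> tensor11" where
  "flag_f z1 z2 z3 p v = (THE w. \<exists>h\<in>SU3. \<exists>a b c.
      p = act h origin \<and> v = dact h (dcoset (Dmat a b c)) \<and>
      w = dact h (dcoset (Dmat (of_int z1 * \<i> * a) (of_int z2 * \<i> * b) (of_int z3 * \<i> * c))))"

definition homothetic :: "metric \<Rightarrow> metric \<Rightarrow> bool" where
  "homothetic g g' \<longleftrightarrow> (\<exists>r>0. \<forall>p\<in>flagM. \<forall>v\<in>tangent p. \<forall>w\<in>tangent p. g p v w = r * g' p v w)"

definition eq_up_to_sign :: "tensor11 \<Rightarrow> tensor11 \<Rightarrow> bool" where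
  "eq_up_to_sign f f' \<longleftrightarrow>
     (\<exists>e\<in>{1, -1}. \<forall>p\<in>flagM. \<forall>v\<in>tangent p. f p v = scal e (f' p v))"

end

theory Submission
  imports Defs
begin

text \<open>A vector field on the flag manifold is the same as a \<open>Tmax\<close>-equivariant map \<open>\<xi>\<close> from \<open>SU3\<close> to
  the complement \<open>\<mm>\<close>, and \<open>\<mm>\<close> is coordinatised by \<open>complex^3\<close>. In these terms the Levi-Civita
  connection of the metric \<open>(\<lambda>\<^sub>1, \<lambda>\<^sub>2, \<lambda>\<^sub>3)\<close> is \<open>d\<eta>(\<xi>) + \<Lambda>(\<xi>)\<eta>\<close>, with Nomizu's bilinear map \<open>\<Lambda>\<close>, so
  an invariant f-structure is parallel iff it commutes with \<open>\<Lambda>(x)\<close> for all \<open>x\<close>. Since the bracket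
  \<open>\<mm>\<^sub>j \<times> \<mm>\<^sub>k \<rightarrow> \<mm>\<^sub>l\<close> is conjugate-bilinear, this says that \<open>\<lambda>\<^sub>j = \<lambda>\<^sub>k + \<lambda>\<^sub>l\<close> or \<open>\<zeta>\<^sub>k + \<zeta>\<^sub>l = 0\<close> for each
  \<open>{j, k, l} = {1, 2, 3}\<close>. By positivity at most one of the three equations between the \<open>\<lambda>\<close>'s can
  hold; if none does, all \<open>\<zeta>\<close>'s vanish.\<close>

text \<open>The difficulty is to reach the algebra. Tangent vectors are velocities of curves in a
  set of cosets, and such a curve is only known to be smooth when tested against smooth functions.
  The projections onto the three lines of a flag overcome this: as smooth functions they give a lift
  of the curve to \<open>SU3\<close> near its start, hence coordinates in \<open>complex^3\<close>,
  and their derivatives recover these coordinates, which are therefore unique. Derivatives on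
  \<open>SU3\<close> are taken along explicit curves in the group and computed with any ambient
  extension. The commutator of two fields has a diagonal part, which annihilates functions of
  cosets, and a part in the complement, which is \<open>bracket_m\<close>. The map
  \<open>nomizu\<close> is chosen to be skew for the metric with antisymmetrisation
  \<open>bracket_m\<close>. An invariant f-structure has the same matrix in all frames, so it
  commutes with the derivative term and only the term with \<open>nomizu\<close> is left. The
  conjugation in the bracket turns i \<zeta> into - i \<zeta>, hence sums of two \<zeta>'s rather
  than differences.\<close>

section \<open>Calculus of smooth functions\<close>

lemma Ck_SucI:
  assumes "\<And>x. (f has_derivative f' x) (at x)" "\<And>v. Ck k (\<lambda>x. f' x v)"
  shows "Ck (Suc k) f"
proof -
  have "frechet_derivative f (at x) = f' x" for x
    using frechet_derivative_at[OF assms(1)] by simp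
  with assms show ?thesis
    by (auto simp: differentiable_def)
qed

lemma Ck_Suc_has_derivative:
  "Ck (Suc k) f \<Longrightarrow> (f has_derivative frechet_derivative f (at x)) (at x)"
  using frechet_derivative_works[of f "at x"] by simp

lemma Ck_SucD: "Ck (Suc k) f \<Longrightarrow> Ck k f"
proof (induction k arbitrary: f)
  case 0
  then show ?case
    by (simp add: continuous_at_imp_continuous_on differentiable_imp_continuous_within)
next
  case (Suc k)
  then show ?case by (metis Ck.simps(2))
qed

lemma Ck_const: "Ck k (\<lambda>x. c)"
proof (induction k arbitrary: c)
  case (Suc k)
  show ?case by (rule Ck_SucI[where f' = "\<lambda>x v. 0"]) (auto intro: Suc)
qed auto

lemma Ck_linear_compose:
  assumes "bounded_linear L"
  shows "Ck k f \<Longrightarrow> Ck k (\<lambda>x. L (f x))"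
proof (induction k arbitrary: f)
  case 0
  then show ?case
    using linear_continuous_on_compose assms bounded_linear.continuous_on by auto
next
  case (Suc k)
  show ?case
    by (rule Ck_SucI[OF bounded_linear.has_derivative[OF assms Ck_Suc_has_derivative[OF Suc.prems]]])
       (use Suc in auto)
qed

lemma Ck_linear:
  assumes "bounded_linear L"
  shows "Ck k L"
proof (cases k)
  case 0
  then show ?thesis using assms by (simp add: linear_continuous_on)
next
  case (Suc k')
  show ?thesis unfolding Suc
    by (rule Ck_SucI[OF bounded_linear_imp_has_derivative[OF assms]]) (rule Ck_const)
qed

lemma Ck_add: "Ck k f \<Longrightarrow> Ck k g \<Longrightarrow> Ck k (\<lambda>x. f x + g x)"
proof (induction k arbitrary: f g)
  case 0
  then show ?case by (auto intro: continuous_on_add)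
next
  case (Suc k)
  show ?case
    by (rule Ck_SucI[OF has_derivative_add[OF Ck_Suc_has_derivative[OF Suc.prems(1)]
          Ck_Suc_has_derivative[OF Suc.prems(2)]]])
       (use Suc in auto)
qed

text \<open>The product rule gives two terms that each contain one factor undifferentiated;
  \<open>Ck_SucD\<close> lowers that factor to order k for the induction.\<close>

lemma Ck_bilinear:
  assumes "bounded_bilinear B"
  shows "Ck k f \<Longrightarrow> Ck k g \<Longrightarrow> Ck k (\<lambda>x. B (f x) (g x))"
proof (induction k arbitrary: f g)
  case 0
  then show ?case using bounded_bilinear.continuous_on[OF assms] by auto
next
  case (Suc k)
  show ?case
    by (rule Ck_SucI[OF bounded_bilinear.FDERIV[OF assms Ck_Suc_has_derivative[OF Suc.prems(1)]
          Ck_Suc_has_derivative[OF Suc.prems(2)]]])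
       (use Suc Ck_SucD[OF Suc.prems(1)] Ck_SucD[OF Suc.prems(2)] in \<open>auto intro!: Ck_add\<close>)
qed

lemma Ck_sum: "(\<And>i. i \<in> A \<Longrightarrow> Ck k (f i)) \<Longrightarrow> Ck k (\<lambda>x. \<Sum>i\<in>A. f i x)"
  by (induction A rule: infinite_finite_induct) (auto intro: Ck_const Ck_add)

text \<open>\<open>Ck\<close> controls derivatives in fixed directions only. This expansion reduces
  a direction that varies with the point to finitely many basis directions.\<close>

lemma linear_euclidean_expand:
  fixes L :: "'a::euclidean_space \<Rightarrow> 'b::real_vector"
  assumes "linear L"
  shows "L v = (\<Sum>i\<in>Basis. (v \<bullet> i) *\<^sub>R L i)"
proof -
  have "L v = L (\<Sum>i\<in>Basis. (v \<bullet> i) *\<^sub>R i)" by (simp add: euclidean_representation)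
  also have "\<dots> = (\<Sum>i\<in>Basis. (v \<bullet> i) *\<^sub>R L i)"
    using assms by (simp add: linear_sum linear_scale)
  finally show ?thesis .
qed

text \<open>In the chain rule the outer derivative is taken in the direction \<open>?g' x v\<close>,
  which moves with x. Expanded over \<open>Basis\<close> it becomes a sum of products of maps of
  order k, to which the induction hypothesis applies.\<close>

lemma Ck_compose:
  fixes f :: "'b::euclidean_space \<Rightarrow> 'c::real_normed_vector" and g :: "'a::euclidean_space \<Rightarrow> 'b"
  shows "Ck k f \<Longrightarrow> Ck k g \<Longrightarrow> Ck k (\<lambda>x. f (g x))"
proof (induction k arbitrary: f g)
  case 0
  then show ?case
    using continuous_on_compose2[of UNIV f UNIV g] by auto
next
  case (Suc k)
  let ?f' = "\<lambda>y. frechet_derivative f (at y)" and ?g' = "\<lambda>x. frechet_derivative g (at x)"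
  have f: "(f has_derivative ?f' y) (at y)" for y using Suc.prems(1) by (rule Ck_Suc_has_derivative)
  have g: "(g has_derivative ?g' x) (at x)" for x using Suc.prems(2) by (rule Ck_Suc_has_derivative)
  have "((\<lambda>x. f (g x)) has_derivative (\<lambda>v. ?f' (g x) (?g' x v))) (at x)" for x
    using diff_chain_at[OF g f] by (simp add: o_def)
  moreover have "?f' (g x) (?g' x v) = (\<Sum>i\<in>Basis. (?g' x v \<bullet> i) *\<^sub>R ?f' (g x) i)" for x v
    using f[of "g x"] has_derivative_linear linear_euclidean_expand by blast
  moreover have "Ck k (\<lambda>x. (\<Sum>i\<in>Basis. (?g' x v \<bullet> i) *\<^sub>R ?f' (g x) i))" for v
    by (intro Ck_sum Ck_bilinear[OF bounded_bilinear_scaleR]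
          Ck_linear_compose[OF bounded_linear_inner_left] Suc.IH Ck_SucD[OF Suc.prems(2)])
       (use Suc.prems in auto)
  ultimately show ?case
    by (intro Ck_SucI[where f' = "\<lambda>x v. ?f' (g x) (?g' x v)"]) auto
qed

text \<open>Each function is up to sign the derivative of the other, so the induction treats both at
  once.\<close>

lemma Ck_cos_sin: "Ck k (cos :: real \<Rightarrow> real) \<and> Ck k (sin :: real \<Rightarrow> real)"
proof (induction k)
  case 0
  then show ?case by (auto intro: continuous_intros)
next
  case (Suc k)
  have m: "bounded_linear (\<lambda>t::real. - t * v)" "bounded_linear (\<lambda>t::real. t * v)" for v
    using bounded_linear_minus[OF bounded_linear_mult_left[of v]] by (simp_all add: bounded_linear_mult_left)
  have "Ck (Suc k) (cos :: real \<Rightarrow> real)"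
    by (rule Ck_SucI[where f' = "\<lambda>t v. - sin t * v"])
       (use Suc Ck_linear_compose[OF m(1)] in \<open>auto intro!: derivative_eq_intros\<close>)
  moreover have "Ck (Suc k) (sin :: real \<Rightarrow> real)"
    by (rule Ck_SucI[where f' = "\<lambda>t v. cos t * v"])
       (use Suc Ck_linear_compose[OF m(2)] in \<open>auto intro!: derivative_eq_intros\<close>)
  ultimately show ?case by blast
qed

section \<open>Passage from finite orders to smooth maps\<close>

lemma smooth_has_derivative:
  "smooth f \<Longrightarrow> (f has_derivative frechet_derivative f (at x)) (at x)"
  unfolding smooth_def using Ck_Suc_has_derivative by blast

lemma smooth_linear_derivative: "smooth f \<Longrightarrow> linear (frechet_derivative f (at x))"
  using smooth_has_derivative has_derivative_linear by blast

lemma smooth_const: "smooth (\<lambda>x. c)"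
  by (simp add: smooth_def Ck_const)

lemma smooth_linear: "bounded_linear L \<Longrightarrow> smooth L"
  by (simp add: smooth_def Ck_linear)

lemma smooth_linear_compose: "bounded_linear L \<Longrightarrow> smooth f \<Longrightarrow> smooth (\<lambda>x. L (f x))"
  by (simp add: smooth_def Ck_linear_compose)

lemma smooth_add: "smooth f \<Longrightarrow> smooth g \<Longrightarrow> smooth (\<lambda>x. f x + g x)"
  by (simp add: smooth_def Ck_add)

lemma smooth_bilinear:
  "bounded_bilinear B \<Longrightarrow> smooth f \<Longrightarrow> smooth g \<Longrightarrow> smooth (\<lambda>x. B (f x) (g x))"
  by (simp add: smooth_def Ck_bilinear)

lemma smooth_sum: "(\<And>i. i \<in> A \<Longrightarrow> smooth (f i)) \<Longrightarrow> smooth (\<lambda>x. \<Sum>i\<in>A. f i x)"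
  by (simp add: smooth_def Ck_sum)

lemma smooth_compose:
  fixes f :: "'b::euclidean_space \<Rightarrow> 'c::real_normed_vector" and g :: "'a::euclidean_space \<Rightarrow> 'b"
  shows "smooth f \<Longrightarrow> smooth g \<Longrightarrow> smooth (\<lambda>x. f (g x))"
  by (simp add: smooth_def Ck_compose)

lemma smooth_directional: "smooth f \<Longrightarrow> smooth (\<lambda>x. frechet_derivative f (at x) v)"
  unfolding smooth_def using Ck.simps(2) by blast

lemma smooth_derivative_along:
  fixes V :: "'a::euclidean_space \<Rightarrow> 'a"
  assumes "smooth f" "smooth V"
  shows "smooth (\<lambda>x. frechet_derivative f (at x) (V x))"
proof -
  have "frechet_derivative f (at x) (V x) =
      (\<Sum>i\<in>Basis. (V x \<bullet> i) *\<^sub>R frechet_derivative f (at x) i)" for x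
    using smooth_linear_derivative[OF assms(1)] linear_euclidean_expand by blast
  then show ?thesis
    by (simp add: smooth_sum smooth_bilinear[OF bounded_bilinear_scaleR]
        smooth_linear_compose[OF bounded_linear_inner_left] smooth_directional assms)
qed

lemma smooth_cos: "smooth (cos :: real \<Rightarrow> real)" and smooth_sin: "smooth (sin :: real \<Rightarrow> real)"
  by (simp_all add: smooth_def Ck_cos_sin)

text \<open>The mean value theorem is applied twice, first in the direction v and then in the
  direction w. The second difference is visibly symmetric in v and w, the mixed derivative is not;
  the bound on z makes it converge to x with s.\<close>

lemma second_difference_mean_value:
  fixes f :: "'a::euclidean_space \<Rightarrow> real"
  assumes f: "smooth f" and s: "0 < s"
  shows "\<exists>z. dist z x \<le> s * (norm v + norm w) \<and>
    f (x + s *\<^sub>R v + s *\<^sub>R w) - f (x + s *\<^sub>R v) - f (x + s *\<^sub>R w) + f x =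
      s * s * frechet_derivative (\<lambda>y. frechet_derivative f (at y) v) (at z) w"
proof -
  let ?g = "\<lambda>y. frechet_derivative f (at y) v"
  let ?h = "\<lambda>y. frechet_derivative ?g (at y)"
  have d: "((\<lambda>r. F (b + r *\<^sub>R u)) has_real_derivative frechet_derivative F (at (b + r *\<^sub>R u)) u) (at r)"
    if "smooth F" for F :: "'a \<Rightarrow> real" and b u r
  proof -
    have i: "((\<lambda>r. b + r *\<^sub>R u) has_derivative (\<lambda>r. r *\<^sub>R u)) (at r)"
      by (auto intro!: derivative_eq_intros)
    have "((\<lambda>r. F (b + r *\<^sub>R u)) has_derivative (\<lambda>t. frechet_derivative F (at (b + r *\<^sub>R u)) (t *\<^sub>R u))) (at r)"
      using diff_chain_at[OF i smooth_has_derivative[OF that]] by (simp add: o_def)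
    then show ?thesis
      using smooth_linear_derivative[OF that]
      by (simp add: has_field_derivative_def linear_scale mult_commute_abs)
  qed
  have g: "smooth ?g" using f by (rule smooth_directional)
  \<comment> \<open>The second difference is the increment of \<phi> over the interval from 0 to
    s.\<close>
  define \<phi> where "\<phi> r = f ((x + s *\<^sub>R w) + r *\<^sub>R v) - f (x + r *\<^sub>R v)" for r
  have "(\<phi> has_real_derivative ?g ((x + s *\<^sub>R w) + r *\<^sub>R v) - ?g (x + r *\<^sub>R v)) (at r)" for r
    unfolding \<phi>_def by (intro DERIV_diff d f)
  from MVT2[OF s this] obtain r where r: "0 < r" "r < s"
    "\<phi> s - \<phi> 0 = s * (?g ((x + s *\<^sub>R w) + r *\<^sub>R v) - ?g (x + r *\<^sub>R v))" by auto
  define \<psi> where "\<psi> q = ?g ((x + r *\<^sub>R v) + q *\<^sub>R w)" for q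
  have "(\<psi> has_real_derivative ?h ((x + r *\<^sub>R v) + q *\<^sub>R w) w) (at q)" for q
    unfolding \<psi>_def by (rule d[OF g])
  from MVT2[OF s this] obtain q where q: "0 < q" "q < s"
    "\<psi> s - \<psi> 0 = s * ?h ((x + r *\<^sub>R v) + q *\<^sub>R w) w" by auto
  have "norm (r *\<^sub>R v + q *\<^sub>R w) \<le> r * norm v + q * norm w"
    using norm_triangle_ineq[of "r *\<^sub>R v" "q *\<^sub>R w"] r q by simp
  also have "\<dots> \<le> s * (norm v + norm w)"
    using r q by (simp add: distrib_left add_mono mult_right_mono)
  finally have "dist ((x + r *\<^sub>R v) + q *\<^sub>R w) x \<le> s * (norm v + norm w)"
    by (simp add: dist_norm add.assoc)
  moreover have "\<phi> s - \<phi> 0 = s * (\<psi> s - \<psi> 0)"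
    using r(3) by (simp add: \<psi>_def add_ac)
  then have "f (x + s *\<^sub>R v + s *\<^sub>R w) - f (x + s *\<^sub>R v) - f (x + s *\<^sub>R w) + f x =
      s * s * ?h ((x + r *\<^sub>R v) + q *\<^sub>R w) w"
    unfolding q(3) by (simp add: \<phi>_def algebra_simps)
  ultimately show ?thesis by blast
qed

text \<open>For each step size s the same second difference equals s * s times either mixed
  derivative, taken at points z and z' close to x. Continuity of the mixed derivatives gives the
  claim as s tends to 0.\<close>

lemma second_derivative_commute:
  fixes f :: "'a::euclidean_space \<Rightarrow> real"
  assumes f: "smooth f"
  shows "frechet_derivative (\<lambda>y. frechet_derivative f (at y) v) (at x) w =
    frechet_derivative (\<lambda>y. frechet_derivative f (at y) w) (at x) v"
proof -
  define h where "h v w z = frechet_derivative (\<lambda>y. frechet_derivative f (at y) v) (at z) w" for v w z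
  have h: "isCont (h v w) z" for v w z
    using smooth_has_derivative[OF smooth_directional[OF smooth_directional[OF f]]]
      has_derivative_continuous unfolding h_def by blast
  let ?s = "\<lambda>n. inverse (real (Suc n))"
  have "\<exists>z z'. dist z x \<le> ?s n * (norm v + norm w) \<and> dist z' x \<le> ?s n * (norm v + norm w) \<and>
      h v w z = h w v z'" for n
  proof -
    have s: "0 < ?s n" by simp
    obtain z where z: "dist z x \<le> ?s n * (norm v + norm w)"
      "f (x + ?s n *\<^sub>R v + ?s n *\<^sub>R w) - f (x + ?s n *\<^sub>R v) - f (x + ?s n *\<^sub>R w) + f x =
       ?s n * ?s n * h v w z"
      using second_difference_mean_value[OF f s, of x v w] unfolding h_def by blast
    obtain z' where z': "dist z' x \<le> ?s n * (norm w + norm v)"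
      "f (x + ?s n *\<^sub>R w + ?s n *\<^sub>R v) - f (x + ?s n *\<^sub>R w) - f (x + ?s n *\<^sub>R v) + f x =
       ?s n * ?s n * h w v z'"
      using second_difference_mean_value[OF f s, of x w v] unfolding h_def by blast
    have "?s n * ?s n * h v w z = ?s n * ?s n * h w v z'"
      using z(2) z'(2) by (simp only: add_ac diff_diff_eq)
    then have "h v w z = h w v z'" using s by simp
    with z z' show ?thesis by (auto simp: add.commute)
  qed
  then obtain z z' where z: "\<And>n. dist (z n) x \<le> ?s n * (norm v + norm w)"
    "\<And>n. dist (z' n) x \<le> ?s n * (norm v + norm w)" "\<And>n. h v w (z n) = h w v (z' n)"
    by metis
  have 0: "(\<lambda>n. ?s n * (norm v + norm w)) \<longlonglongrightarrow> 0"
    using tendsto_mult_right[OF LIMSEQ_inverse_real_of_nat, of "norm v + norm w"] by simp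
  have "z \<longlonglongrightarrow> x" "z' \<longlonglongrightarrow> x"
    by (rule metric_tendsto_imp_tendsto[OF 0]; use z in \<open>auto simp: dist_norm intro: order_trans\<close>)+
  then have "(\<lambda>n. h v w (z n)) \<longlonglongrightarrow> h v w x" "(\<lambda>n. h w v (z' n)) \<longlonglongrightarrow> h w v x"
    using isCont_tendsto_compose[OF h] by blast+
  then show ?thesis
    using z(3) LIMSEQ_unique unfolding h_def by simp
qed

section \<open>The special unitary group and its torus\<close>

lemma matrix_mult_bounded_bilinear: "bounded_bilinear ((**) :: mat3 \<Rightarrow> mat3 \<Rightarrow> mat3)"
  unfolding bilinear_conv_bounded_bilinear[symmetric] bilinear_def
  by (auto intro!: linearI simp: vec_eq_iff matrix_matrix_mult_def sum.distrib
      distrib_left distrib_right scaleR_sum_right)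

lemmas matrix_mult_linear_left =
  bounded_bilinear.bounded_linear_right[OF matrix_mult_bounded_bilinear]
lemmas matrix_mult_linear_right =
  bounded_bilinear.bounded_linear_left[OF matrix_mult_bounded_bilinear]

lemma mat3_eqI:
  fixes A B :: "'a^3^3"
  assumes "A$1$1 = B$1$1" "A$1$2 = B$1$2" "A$1$3 = B$1$3"
    "A$2$1 = B$2$1" "A$2$2 = B$2$2" "A$2$3 = B$2$3"
    "A$3$1 = B$3$1" "A$3$2 = B$3$2" "A$3$3 = B$3$3"
  shows "A = B"
  using assms by (simp add: vec_eq_iff forall_3)

lemma mat3_mult_nth: "(A ** B) $ i $ j = A$i$1 * B$1$j + A$i$2 * B$2$j + A$i$3 * B$3$j"
  for A B :: mat3
  by (simp add: matrix_matrix_mult_def sum_3)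

lemma ctranspose_nth [simp]: "ctranspose A $ i $ j = cnj (A $ j $ i)"
  by (simp add: ctranspose_def)

lemma ctranspose_mult: "ctranspose (A ** B) = ctranspose B ** ctranspose A"
  by (simp add: vec_eq_iff mat3_mult_nth mult.commute)

lemma ctranspose_ctranspose [simp]: "ctranspose (ctranspose A) = A"
  by (simp add: vec_eq_iff)

lemma ctranspose_mat_1 [simp]: "ctranspose (mat 1) = mat 1"
  by (auto simp: vec_eq_iff mat_def)

lemma ctranspose_bounded_linear: "bounded_linear ctranspose"
  unfolding linear_conv_bounded_linear[symmetric]
  by (rule linearI) (auto simp: vec_eq_iff)

lemma det_ctranspose: "det (ctranspose A) = cnj (det A)"
  by (simp add: det_3)

lemma SU3_right_inverse: "a \<in> SU3 \<Longrightarrow> a ** ctranspose a = mat 1"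
  and SU3_det: "a \<in> SU3 \<Longrightarrow> det a = 1"
  by (simp_all add: SU3_def)

lemma SU3_left_inverse: "a \<in> SU3 \<Longrightarrow> ctranspose a ** a = mat 1"
  using matrix_left_right_inverse SU3_right_inverse by blast

lemma mat_1_SU3: "mat 1 \<in> SU3"
  by (simp add: SU3_def)

lemma ctranspose_SU3: "a \<in> SU3 \<Longrightarrow> ctranspose a \<in> SU3"
  by (simp add: SU3_def SU3_left_inverse[unfolded SU3_def] det_ctranspose)

lemma SU3_mult:
  assumes "a \<in> SU3" "b \<in> SU3"
  shows "a ** b \<in> SU3"
proof -
  have "(a ** b) ** ctranspose (a ** b) = a ** (b ** ctranspose b) ** ctranspose a"
    by (simp only: ctranspose_mult matrix_mul_assoc)
  then show ?thesis
    using assms by (simp add: SU3_def det_mul)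
qed

lemma SU3_cancel_left: "a \<in> SU3 \<Longrightarrow> ctranspose a ** (a ** b) = b"
  and SU3_cancel_right: "a \<in> SU3 \<Longrightarrow> a ** (ctranspose a ** b) = b"
  by (simp_all add: matrix_mul_assoc SU3_left_inverse SU3_right_inverse)

section \<open>Elements of the diagonal torus\<close>

definition diag3 :: "complex \<Rightarrow> complex \<Rightarrow> complex \<Rightarrow> mat3" where
  "diag3 u v w = vector [vector [u, 0, 0], vector [0, v, 0], vector [0, 0, w]]"

lemma diag3_nth [simp]:
  "diag3 u v w $ 1 $ 1 = u" "diag3 u v w $ 1 $ 2 = 0" "diag3 u v w $ 1 $ 3 = 0"
  "diag3 u v w $ 2 $ 1 = 0" "diag3 u v w $ 2 $ 2 = v" "diag3 u v w $ 2 $ 3 = 0"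
  "diag3 u v w $ 3 $ 1 = 0" "diag3 u v w $ 3 $ 2 = 0" "diag3 u v w $ 3 $ 3 = w"
  by (simp_all add: diag3_def)

lemma mat_1_nth3:
  "(mat 1 :: mat3) $ 1 $ 1 = 1" "(mat 1 :: mat3) $ 1 $ 2 = 0" "(mat 1 :: mat3) $ 1 $ 3 = 0"
  "(mat 1 :: mat3) $ 2 $ 1 = 0" "(mat 1 :: mat3) $ 2 $ 2 = 1" "(mat 1 :: mat3) $ 2 $ 3 = 0"
  "(mat 1 :: mat3) $ 3 $ 1 = 0" "(mat 1 :: mat3) $ 3 $ 2 = 0" "(mat 1 :: mat3) $ 3 $ 3 = 1"
  by (simp_all add: mat_def)

lemma diag3_Tmax:
  assumes "u * cnj u = 1" "v * cnj v = 1" "w * cnj w = 1" "u * v * w = 1"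
  shows "diag3 u v w \<in> Tmax"
proof -
  have "diag3 u v w ** ctranspose (diag3 u v w) = mat 1"
    by (rule mat3_eqI) (simp_all add: mat3_mult_nth mat_1_nth3 assms)
  moreover have "det (diag3 u v w) = 1" by (simp add: det_3 assms)
  moreover have "\<forall>i j. i \<noteq> j \<longrightarrow> diag3 u v w $ i $ j = 0" by (simp add: forall_3)
  ultimately show ?thesis by (simp add: Tmax_def SU3_def)
qed

lemma TmaxE:
  assumes "h \<in> Tmax"
  obtains u v w where "h = diag3 u v w" "u * cnj u = 1" "v * cnj v = 1" "w * cnj w = 1" "u * v * w = 1"
proof -
  have od: "\<forall>i j. i \<noteq> j \<longrightarrow> h $ i $ j = 0" and h: "h \<in> SU3" using assms by (auto simp: Tmax_def)
  have eq: "h = diag3 (h$1$1) (h$2$2) (h$3$3)"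
    by (rule mat3_eqI) (simp_all add: od)
  have "(h ** ctranspose h) $ i $ i = 1" for i
    using SU3_right_inverse[OF h] by (simp add: mat_def)
  from this[of 1] this[of 2] this[of 3] have "h$1$1 * cnj (h$1$1) = 1" "h$2$2 * cnj (h$2$2) = 1"
    "h$3$3 * cnj (h$3$3) = 1"
    by (simp_all add: mat3_mult_nth od)
  moreover have "h$1$1 * h$2$2 * h$3$3 = 1"
    using SU3_det[OF h] by (simp add: det_3 od)
  ultimately show ?thesis using that eq by blast
qed

lemma Tmax_SU3: "h \<in> Tmax \<Longrightarrow> h \<in> SU3"
  by (simp add: Tmax_def)

lemma mat_1_Tmax: "mat 1 \<in> Tmax"
  using mat_1_SU3 by (auto simp: Tmax_def mat_def)

lemma diag3_mult: "diag3 u v w ** diag3 u' v' w' = diag3 (u * u') (v * v') (w * w')"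
  by (rule mat3_eqI) (simp_all add: mat3_mult_nth)

lemma ctranspose_diag3: "ctranspose (diag3 u v w) = diag3 (cnj u) (cnj v) (cnj w)"
  by (rule mat3_eqI) simp_all

lemma Tmax_mult:
  assumes "h \<in> Tmax" "k \<in> Tmax"
  shows "h ** k \<in> Tmax"
proof -
  obtain u v w where h: "h = diag3 u v w" using assms(1) by (rule TmaxE)
  obtain u' v' w' where k: "k = diag3 u' v' w'" using assms(2) by (rule TmaxE)
  have "\<forall>i j. i \<noteq> j \<longrightarrow> (h ** k) $ i $ j = 0" by (simp add: h k diag3_mult forall_3)
  then show ?thesis using assms by (simp add: Tmax_def SU3_mult)
qed

lemma ctranspose_Tmax: "h \<in> Tmax \<Longrightarrow> ctranspose h \<in> Tmax"
  by (simp add: Tmax_def ctranspose_SU3)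

section \<open>Cosets and the group action\<close>

lemma coset_mult_Tmax:
  assumes "k \<in> Tmax"
  shows "coset (a ** k) = coset a"
proof
  show "coset (a ** k) \<subseteq> coset a"
    using assms by (auto simp: coset_def matrix_mul_assoc[symmetric] intro!: Tmax_mult imageI)
  show "coset a \<subseteq> coset (a ** k)"
  proof
    fix b assume "b \<in> coset a"
    then obtain h where h: "h \<in> Tmax" "b = a ** h" by (auto simp: coset_def)
    have "b = (a ** k) ** (ctranspose k ** h)"
      using SU3_cancel_right[OF Tmax_SU3[OF assms], of h] h by (simp add: matrix_mul_assoc[symmetric])
    then show "b \<in> coset (a ** k)"
      using h Tmax_mult[OF ctranspose_Tmax[OF assms]] by (auto simp: coset_def)
  qed
qed

lemma coset_eqD: "coset a = coset b \<Longrightarrow> \<exists>k\<in>Tmax. b = a ** k"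
proof -
  assume "coset a = coset b"
  moreover have "b \<in> coset b"
    using mat_1_Tmax by (force simp: coset_def)
  ultimately show ?thesis by (auto simp: coset_def)
qed

lemma act_coset: "act h (coset a) = coset (h ** a)"
  by (simp add: act_def coset_def image_image matrix_mul_assoc)

lemma act_origin: "act h origin = coset h"
  by (simp add: origin_def act_coset)

lemma coset_flagM: "a \<in> SU3 \<Longrightarrow> coset a \<in> flagM"
  by (simp add: flagM_def)

lemma act_act_ctranspose:
  "a \<in> SU3 \<Longrightarrow> act a (act (ctranspose a) p) = p"
  "a \<in> SU3 \<Longrightarrow> act (ctranspose a) (act a p) = p"
  by (force simp: act_def image_image SU3_cancel_right SU3_cancel_left)+

text \<open>Laplace expansion: the row r of cofactors of the third column satisfies
  \<open>r v* a = vector [0, 0, det a]\<close>. Multiplying by the inverse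
  \<open>ctranspose a\<close> identifies r with the conjugate of that column.\<close>

lemma SU3_third_column:
  assumes "a \<in> SU3"
  shows "a$1$3 = cnj (a$2$1 * a$3$2 - a$3$1 * a$2$2)"
    "a$2$3 = cnj (a$3$1 * a$1$2 - a$1$1 * a$3$2)"
    "a$3$3 = cnj (a$1$1 * a$2$2 - a$2$1 * a$1$2)"
proof -
  define r :: "complex^3" where "r = vector [a$2$1 * a$3$2 - a$3$1 * a$2$2,
    a$3$1 * a$1$2 - a$1$1 * a$3$2, a$1$1 * a$2$2 - a$2$1 * a$1$2]"
  have "r v* a = vector [0, 0, det a]"
    by (simp add: vec_eq_iff forall_3 vector_matrix_mult_def sum_3 r_def det_3) (simp add: algebra_simps)
  then have "(r v* a) v* ctranspose a = vector [0, 0, 1] v* ctranspose a"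
    by (simp add: SU3_det[OF assms])
  moreover have "(r v* a) v* ctranspose a = r"
    by (simp add: vector_matrix_mul_assoc SU3_right_inverse[OF assms])
  ultimately have "r = vector [0, 0, 1] v* ctranspose a" by simp
  then have "r $ i = cnj (a $ i $ 3)" for i
    by (simp add: vector_matrix_mult_def sum_3)
  then have "a $ i $ 3 = cnj (r $ i)" for i by simp
  from this[of 1] this[of 2] this[of 3]
  show "a$1$3 = cnj (a$2$1 * a$3$2 - a$3$1 * a$2$2)"
    "a$2$3 = cnj (a$3$1 * a$1$2 - a$1$1 * a$3$2)"
    "a$3$3 = cnj (a$1$1 * a$2$2 - a$2$1 * a$1$2)"
    by (simp_all add: r_def)
qed

section \<open>Curves in the group\<close>

definition Dvec :: "complex^3 \<Rightarrow> mat3" where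
  "Dvec x = Dmat (x$1) (x$2) (x$3)"

text \<open>The sign at entry (3, 1) undoes the one in \<open>Dmat\<close>. Defined for all
  matrices, this is a linear left inverse of \<open>Dvec\<close>.\<close>

definition off_diagonal :: "mat3 \<Rightarrow> complex^3" where
  "off_diagonal A = vector [A$1$2, A$2$3, - (A$3$1)]"

lemma Dvec_nth [simp]:
  "Dvec x $ 1 $ 1 = 0" "Dvec x $ 1 $ 2 = x$1" "Dvec x $ 1 $ 3 = cnj (x$3)"
  "Dvec x $ 2 $ 1 = - cnj (x$1)" "Dvec x $ 2 $ 2 = 0" "Dvec x $ 2 $ 3 = x$2"
  "Dvec x $ 3 $ 1 = - (x$3)" "Dvec x $ 3 $ 2 = - cnj (x$2)" "Dvec x $ 3 $ 3 = 0"
  by (simp_all add: Dvec_def Dmat_def)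

lemma off_diagonal_nth [simp]:
  "off_diagonal A $ 1 = A$1$2" "off_diagonal A $ 2 = A$2$3" "off_diagonal A $ 3 = - (A$3$1)"
  by (simp_all add: off_diagonal_def)

lemma Dvec_bounded_linear: "bounded_linear Dvec"
  unfolding linear_conv_bounded_linear[symmetric]
  by (rule linearI; rule mat3_eqI) simp_all

lemma off_diagonal_bounded_linear: "bounded_linear off_diagonal"
  unfolding linear_conv_bounded_linear[symmetric]
  by (rule linearI) (simp_all add: vec_eq_iff forall_3)

lemma off_diagonal_Dvec [simp]: "off_diagonal (Dvec x) = x"
  by (simp add: vec_eq_iff forall_3)

lemma Dvec_off_diagonal:
  assumes "ctranspose A = - A" "A$1$1 = 0" "A$2$2 = 0" "A$3$3 = 0"
  shows "Dvec (off_diagonal A) = A"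
proof -
  have "ctranspose A $ i $ j = - (A $ i $ j)" for i j using assms(1) by simp
  then have *: "cnj (A $ j $ i) = - (A $ i $ j)" for i j by simp
  show ?thesis
    by (rule mat3_eqI) (simp_all add: assms *)
qed

text \<open>With complementary projections A and K, and B a complex structure on the range of A that
  vanishes on the range of K, this is the exponential of r t B in closed form. The torus curves
  reuse it with K = 0, one diagonal entry at a time.\<close>

definition trigc :: "mat3 \<Rightarrow> mat3 \<Rightarrow> mat3 \<Rightarrow> real \<Rightarrow> real \<Rightarrow> mat3" where
  "trigc K A B r t = K + (cos (r * t) *\<^sub>R A + sin (r * t) *\<^sub>R B)"

lemma smooth_trigc: "smooth (trigc K A B r)"
proof -
  have l: "bounded_linear (\<lambda>t::real. r * t)" by (simp add: bounded_linear_mult_right)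
  have "smooth (\<lambda>t. K + (cos (r * t) *\<^sub>R A + sin (r * t) *\<^sub>R B))"
    by (intro smooth_add smooth_const smooth_bilinear[OF bounded_bilinear_scaleR]
        smooth_compose[OF smooth_cos smooth_linear[OF l]]
        smooth_compose[OF smooth_sin smooth_linear[OF l]])
  then show ?thesis by (simp add: trigc_def[abs_def])
qed

lemma trigc_vector_derivative: "(trigc K A B r has_vector_derivative r *\<^sub>R B) (at 0)"
  unfolding trigc_def has_vector_derivative_def
  by (auto intro!: derivative_eq_intros simp: mult.commute)

lemma sgn_mult_norm: "sgn z * of_real (cmod z) = z"
  by (cases "z = 0") (simp_all add: sgn_div_norm scaleR_conv_of_real[where 'a=complex] field_simps)

lemma sgn_mult_cnj: "z \<noteq> 0 \<Longrightarrow> sgn z * cnj (sgn z) = 1"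
  by (simp add: complex_norm_square[symmetric] norm_sgn)

lemma cos_sin_complex: "complex_of_real (cos x) * of_real (cos x) + of_real (sin x) * of_real (sin x) = 1"
  by (metis of_real_1 of_real_add of_real_mult power2_eq_square sin_cos_squared_add3)

text \<open>The modulus of z is the angular speed and its phase selects the rotation. For z = 0 the
  conventions \<open>sgn 0 = 0\<close> and \<open>cmod 0 = 0\<close> give the constant curve at the
  identity.\<close>

definition rot12 :: "complex \<Rightarrow> real \<Rightarrow> mat3" where
  "rot12 z = trigc (diag3 0 0 1) (diag3 1 1 0) (Dmat (sgn z) 0 0) (cmod z)"
definition rot23 :: "complex \<Rightarrow> real \<Rightarrow> mat3" where
  "rot23 z = trigc (diag3 1 0 0) (diag3 0 1 1) (Dmat 0 (sgn z) 0) (cmod z)"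
definition rot31 :: "complex \<Rightarrow> real \<Rightarrow> mat3" where
  "rot31 z = trigc (diag3 0 1 0) (diag3 1 0 1) (Dmat 0 0 (sgn z)) (cmod z)"

lemmas rot_defs = rot12_def rot23_def rot31_def

lemma Dmat_nth [simp]:
  "Dmat a b c $ 1 $ 1 = 0" "Dmat a b c $ 1 $ 2 = a" "Dmat a b c $ 1 $ 3 = cnj c"
  "Dmat a b c $ 2 $ 1 = - cnj a" "Dmat a b c $ 2 $ 2 = 0" "Dmat a b c $ 2 $ 3 = b"
  "Dmat a b c $ 3 $ 1 = - c" "Dmat a b c $ 3 $ 2 = - cnj b" "Dmat a b c $ 3 $ 3 = 0"
  by (simp_all add: Dmat_def)

text \<open>The variants are the orders of factors in which the products of rotations with their
  adjoints, and the determinants, produce the same identity.\<close>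

lemma unitary_plane:
  fixes c s g :: complex
  assumes "c * c + s * s = 1" "g * cnj g = 1"
  shows "c * c + (s * g) * (s * cnj g) = 1" "(s * cnj g) * (s * g) + c * c = 1"
    "c * c + (s * cnj g) * (s * g) = 1" "(s * g) * (s * cnj g) + c * c = 1"
proof -
  have "(s * g) * (s * cnj g) = s * s * (g * cnj g)" by (simp only: mult_ac)
  then show "c * c + (s * g) * (s * cnj g) = 1" using assms by (metis mult.right_neutral)
  then show "(s * cnj g) * (s * g) + c * c = 1" "c * c + (s * cnj g) * (s * g) = 1"
    "(s * g) * (s * cnj g) + c * c = 1" by (simp_all add: add.commute mult.commute)
qed

lemma rot_SU3: "rot12 z t \<in> SU3" "rot23 z t \<in> SU3" "rot31 z t \<in> SU3"
proof -
  have "rot12 z t \<in> SU3 \<and> rot23 z t \<in> SU3 \<and> rot31 z t \<in> SU3"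
  proof (cases "z = 0")
    case True
    have "rot12 z t = mat 1" "rot23 z t = mat 1" "rot31 z t = mat 1"
      by (rule mat3_eqI; simp add: rot_defs trigc_def True mat_1_nth3)+
    then show ?thesis by (simp add: mat_1_SU3)
  next
    case False
    note u = unitary_plane[OF cos_sin_complex[of "cmod z * t"] sgn_mult_cnj[OF False]]
    have "rot12 z t ** ctranspose (rot12 z t) = mat 1" "rot23 z t ** ctranspose (rot23 z t) = mat 1"
      "rot31 z t ** ctranspose (rot31 z t) = mat 1"
      by (rule mat3_eqI;
          simp add: mat3_mult_nth mat_1_nth3 rot_defs trigc_def scaleR_conv_of_real[where 'a=complex]
          ; (insert u; simp add: mult_ac del: of_real_mult)?)+
    moreover have "det (rot12 z t) = 1" "det (rot23 z t) = 1" "det (rot31 z t) = 1"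
      by (simp_all add: det_3 rot_defs trigc_def scaleR_conv_of_real[where 'a=complex] u)
    ultimately show ?thesis by (simp add: SU3_def)
  qed
  then show "rot12 z t \<in> SU3" "rot23 z t \<in> SU3" "rot31 z t \<in> SU3" by auto
qed

text \<open>Only the value and the velocity at 0 matter, so a product of three plane rotations
  serves as well as a one-parameter group and stays elementary.\<close>

definition curve :: "complex^3 \<Rightarrow> real \<Rightarrow> mat3" where
  "curve x t = rot12 (x$1) t ** rot23 (x$2) t ** rot31 (x$3) t"

lemma curve_SU3: "curve x t \<in> SU3"
  by (simp add: curve_def SU3_mult rot_SU3)

lemma rot_0: "rot12 z 0 = mat 1" "rot23 z 0 = mat 1" "rot31 z 0 = mat 1"
  by (rule mat3_eqI; simp add: rot_defs trigc_def mat_1_nth3)+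

lemma curve_0 [simp]: "curve x 0 = mat 1"
  by (simp add: curve_def rot_0)

lemma smooth_rot: "smooth (rot12 z)" "smooth (rot23 z)" "smooth (rot31 z)"
  by (simp_all add: rot_defs smooth_trigc)

lemma curve_smooth: "smooth (curve x)"
  unfolding curve_def[abs_def]
  by (intro smooth_bilinear[OF matrix_mult_bounded_bilinear] smooth_rot)

lemma rot_vector_derivative:
  "(rot12 z has_vector_derivative Dmat z 0 0) (at 0)"
  "(rot23 z has_vector_derivative Dmat 0 z 0) (at 0)"
  "(rot31 z has_vector_derivative Dmat 0 0 z) (at 0)"
proof -
  have s: "cmod z *\<^sub>R sgn z = z" "cmod z *\<^sub>R cnj (sgn z) = cnj z"
    using sgn_mult_norm[of z] by (simp_all add: scaleR_conv_of_real[where 'a=complex] mult.commute flip: complex_cnj_mult)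
      (metis complex_cnj_complex_of_real complex_cnj_mult)
  have "Dmat z 0 0 = cmod z *\<^sub>R Dmat (sgn z) 0 0" "Dmat 0 z 0 = cmod z *\<^sub>R Dmat 0 (sgn z) 0"
    "Dmat 0 0 z = cmod z *\<^sub>R Dmat 0 0 (sgn z)"
    by (rule mat3_eqI; simp add: s)+
  then show "(rot12 z has_vector_derivative Dmat z 0 0) (at 0)"
    "(rot23 z has_vector_derivative Dmat 0 z 0) (at 0)"
    "(rot31 z has_vector_derivative Dmat 0 0 z) (at 0)"
    by (simp_all add: rot_defs trigc_vector_derivative)
qed

lemma curve_vector_derivative: "(curve x has_vector_derivative Dvec x) (at 0)"
proof -
  note b = bounded_bilinear.has_vector_derivative[OF matrix_mult_bounded_bilinear]
  have "(curve x has_vector_derivative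
      (rot12 (x$1) 0 ** rot23 (x$2) 0) ** Dmat 0 0 (x$3) +
      (rot12 (x$1) 0 ** Dmat 0 (x$2) 0 + Dmat (x$1) 0 0 ** rot23 (x$2) 0) ** rot31 (x$3) 0) (at 0)"
    unfolding curve_def[abs_def] by (intro b rot_vector_derivative)
  moreover have "(rot12 (x$1) 0 ** rot23 (x$2) 0) ** Dmat 0 0 (x$3) +
      (rot12 (x$1) 0 ** Dmat 0 (x$2) 0 + Dmat (x$1) 0 0 ** rot23 (x$2) 0) ** rot31 (x$3) 0 = Dvec x"
    by (rule mat3_eqI) (simp_all add: rot_0)
  ultimately show ?thesis by simp
qed

text \<open>A function of cosets is constant along left translates of these curves when they lie in
  \<open>Tmax\<close>; this removes the diagonal part of commutators.\<close>

definition torus_curve :: "real \<Rightarrow> real \<Rightarrow> real \<Rightarrow> real \<Rightarrow> mat3" where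
  "torus_curve \<alpha> \<beta> \<gamma> t = diag3 (cis (\<alpha> * t)) (cis (\<beta> * t)) (cis (\<gamma> * t))"

lemma torus_curve_Tmax:
  assumes "\<alpha> + \<beta> + \<gamma> = 0"
  shows "torus_curve \<alpha> \<beta> \<gamma> t \<in> Tmax"
proof -
  have "\<alpha> * t + \<beta> * t + \<gamma> * t = 0" using assms by (simp flip: distrib_right)
  then show ?thesis
    unfolding torus_curve_def by (intro diag3_Tmax) (simp_all add: cis_cnj cis_mult)
qed

lemma torus_curve_0 [simp]: "torus_curve \<alpha> \<beta> \<gamma> 0 = mat 1"
  by (rule mat3_eqI) (simp_all add: torus_curve_def mat_1_nth3)

lemma torus_curve_vector_derivative:
  "(torus_curve \<alpha> \<beta> \<gamma> has_vector_derivative diag3 (\<i> * \<alpha>) (\<i> * \<beta>) (\<i> * \<gamma>)) (at 0)"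
proof -
  have eq: "torus_curve \<alpha> \<beta> \<gamma> = (\<lambda>t. trigc 0 (diag3 1 0 0) (diag3 \<i> 0 0) \<alpha> t +
      (trigc 0 (diag3 0 1 0) (diag3 0 \<i> 0) \<beta> t + trigc 0 (diag3 0 0 1) (diag3 0 0 \<i>) \<gamma> t))"
    by (rule ext; rule mat3_eqI)
      (simp_all add: torus_curve_def trigc_def scaleR_conv_of_real[where 'a=complex] cis_conv_exp exp_of_real exp_Euler
        cos_of_real sin_of_real mult.commute del: of_real_mult)
  have "(torus_curve \<alpha> \<beta> \<gamma> has_vector_derivative
      \<alpha> *\<^sub>R diag3 \<i> 0 0 + (\<beta> *\<^sub>R diag3 0 \<i> 0 + \<gamma> *\<^sub>R diag3 0 0 \<i>)) (at 0)"
    unfolding eq by (intro has_vector_derivative_add trigc_vector_derivative)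
  moreover have "\<alpha> *\<^sub>R diag3 \<i> 0 0 + (\<beta> *\<^sub>R diag3 0 \<i> 0 + \<gamma> *\<^sub>R diag3 0 0 \<i>) =
      diag3 (\<i> * \<alpha>) (\<i> * \<beta>) (\<i> * \<gamma>)"
    by (rule mat3_eqI) (simp_all add: scaleR_conv_of_real[where 'a=complex] mult.commute)
  ultimately show ?thesis by simp
qed

section \<open>Differentiation along the group\<close>

text \<open>The notion behind \<open>smooth_fun\<close>, for any codomain and also for maps that
  vary within a coset.\<close>

definition smooth_SU3 :: "(mat3 \<Rightarrow> 'b::real_normed_vector) \<Rightarrow> bool" where
  "smooth_SU3 \<phi> \<longleftrightarrow> (\<exists>\<Phi>. smooth \<Phi> \<and> (\<forall>a\<in>SU3. \<phi> a = \<Phi> a))"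

text \<open>The left-invariant derivative, taken along curves inside \<open>SU3\<close> so that it depends only on
  the values of \<open>\<phi>\<close> there.\<close>

definition lderiv :: "(mat3 \<Rightarrow> 'b::real_normed_vector) \<Rightarrow> mat3 \<Rightarrow> complex^3 \<Rightarrow> 'b" where
  "lderiv \<phi> a x = vector_derivative (\<lambda>t. \<phi> (a ** curve x t)) (at 0)"

lemma smooth_fun_iff: "F \<in> smooth_fun \<longleftrightarrow> smooth_SU3 (\<lambda>a. F (coset a))"
  by (auto simp: smooth_fun_def smooth_SU3_def)

lemma smooth_SU3_smooth: "smooth \<Phi> \<Longrightarrow> smooth_SU3 \<Phi>"
  by (auto simp: smooth_SU3_def)

lemma smooth_SU3_cong: "(\<And>a. a \<in> SU3 \<Longrightarrow> \<phi> a = \<psi> a) \<Longrightarrow> smooth_SU3 \<phi> \<longleftrightarrow> smooth_SU3 \<psi>"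
  by (auto simp: smooth_SU3_def)

lemma smooth_SU3_const: "smooth_SU3 (\<lambda>a. c)"
  by (simp add: smooth_SU3_smooth smooth_const)

lemma smooth_SU3_add: "smooth_SU3 \<phi> \<Longrightarrow> smooth_SU3 \<psi> \<Longrightarrow> smooth_SU3 (\<lambda>a. \<phi> a + \<psi> a)"
  unfolding smooth_SU3_def by (metis (no_types, lifting) smooth_add)

lemma smooth_SU3_linear_compose: "bounded_linear L \<Longrightarrow> smooth_SU3 \<phi> \<Longrightarrow> smooth_SU3 (\<lambda>a. L (\<phi> a))"
  unfolding smooth_SU3_def by (metis (no_types, lifting) smooth_linear_compose)

lemma smooth_SU3_bilinear: "bounded_bilinear B \<Longrightarrow> smooth_SU3 \<phi> \<Longrightarrow> smooth_SU3 \<psi> \<Longrightarrow> smooth_SU3 (\<lambda>a. B (\<phi> a) (\<psi> a))"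
  unfolding smooth_SU3_def by (metis (no_types, lifting) smooth_bilinear)

lemma smooth_SU3_sum: "(\<And>i. i \<in> A \<Longrightarrow> smooth_SU3 (f i)) \<Longrightarrow> smooth_SU3 (\<lambda>a. \<Sum>i\<in>A. f i a)"
  by (induction A rule: infinite_finite_induct) (auto intro: smooth_SU3_const smooth_SU3_add)

lemma smooth_SU3_minus: "smooth_SU3 \<phi> \<Longrightarrow> smooth_SU3 (\<lambda>a. - \<phi> a)"
  using smooth_SU3_linear_compose[OF bounded_linear_minus[OF bounded_linear_ident]] .

lemma smooth_SU3_diff: "smooth_SU3 \<phi> \<Longrightarrow> smooth_SU3 \<psi> \<Longrightarrow> smooth_SU3 (\<lambda>a. \<phi> a - \<psi> a)"
  using smooth_SU3_add[OF _ smooth_SU3_minus, of \<phi> \<psi>] by simp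

lemma smooth_SU3_translate_left: "h \<in> SU3 \<Longrightarrow> smooth_SU3 \<phi> \<Longrightarrow> smooth_SU3 (\<lambda>a. \<phi> (h ** a))"
  unfolding smooth_SU3_def
  by (metis (no_types, lifting) SU3_mult matrix_mult_linear_left smooth_compose smooth_linear)

section \<open>Smoothness and derivatives by components\<close>

lemma axis_bounded_linear: "bounded_linear (axis i :: 'b::real_normed_vector \<Rightarrow> 'b^'n)"
proof (rule bounded_linear_intro[where K = 1])
  fix x :: 'b
  have "norm (axis i x :: 'b^'n) \<le> (\<Sum>j\<in>UNIV. norm ((axis i x :: 'b^'n) $ j))"
    unfolding norm_vec_def by (rule L2_set_le_sum) simp
  also have "\<dots> = norm x"
    by (simp add: axis_def if_distrib[of norm] cong: if_cong)
  finally show "norm (axis i x :: 'b^'n) \<le> norm x * 1" by simp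
qed (auto simp: vec_eq_iff axis_def)

lemma vec_eq_sum_axis: "(v :: 'b::real_normed_vector^'n) = (\<Sum>i\<in>UNIV. axis i (v $ i))"
  by (simp add: vec_eq_iff axis_def)

lemma smooth_SU3_vec:
  fixes M :: "mat3 \<Rightarrow> 'b::real_normed_vector^'n"
  assumes "\<And>i. smooth_SU3 (\<lambda>a. M a $ i)"
  shows "smooth_SU3 M"
proof -
  have "smooth_SU3 (\<lambda>a. \<Sum>i\<in>UNIV. axis i (M a $ i))"
    by (intro smooth_SU3_sum smooth_SU3_linear_compose[OF axis_bounded_linear] assms)
  then show ?thesis by (simp add: vec_eq_sum_axis[symmetric])
qed

lemma has_vector_derivative_vec:
  fixes M :: "real \<Rightarrow> 'b::real_normed_vector^'n"
  assumes "\<And>i. ((\<lambda>t. M t $ i) has_vector_derivative D $ i) F"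
  shows "(M has_vector_derivative D) F"
proof -
  have "((\<lambda>t. \<Sum>i\<in>UNIV. axis i (M t $ i)) has_vector_derivative (\<Sum>i\<in>UNIV. axis i (D $ i))) F"
    by (intro has_vector_derivative_sum bounded_linear.has_vector_derivative[OF axis_bounded_linear] assms)
  then show ?thesis by (simp add: vec_eq_sum_axis[symmetric])
qed

lemma smooth_SU3_complex:
  assumes "smooth_SU3 (\<lambda>a. Re (f a))" "smooth_SU3 (\<lambda>a. Im (f a))"
  shows "smooth_SU3 f"
proof -
  have "smooth_SU3 (\<lambda>a. complex_of_real (Re (f a)) + \<i> * of_real (Im (f a)))"
    by (intro smooth_SU3_add smooth_SU3_linear_compose[OF bounded_linear_of_real]
        smooth_SU3_linear_compose[OF bounded_linear_mult_right] assms)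
  then show ?thesis by (simp add: complex_eq[symmetric])
qed

section \<open>Left-invariant derivatives and ambient extensions\<close>

lemma smooth_along_curve:
  assumes "smooth \<Phi>" "(c has_vector_derivative v) (at 0)"
  shows "((\<lambda>t. \<Phi> (c t)) has_vector_derivative frechet_derivative \<Phi> (at (c 0)) v) (at 0)"
proof -
  have "(\<Phi> has_derivative frechet_derivative \<Phi> (at (c 0))) (at (c 0) within range c)"
    using smooth_has_derivative[OF assms(1)] has_derivative_at_withinI by blast
  then show ?thesis
    using vector_derivative_diff_chain_within[of c v 0 UNIV \<Phi>] assms(2) by (simp add: o_def)
qed

lemma translated_curve:
  fixes a v :: mat3
  assumes "(c has_vector_derivative v) (at 0)"
  shows "((\<lambda>t. a ** c t) has_vector_derivative a ** v) (at 0)"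
  using bounded_linear.has_vector_derivative[OF matrix_mult_linear_left assms] .

lemma has_vector_derivative_extension:
  assumes "smooth \<Phi>" "\<And>b. b \<in> SU3 \<Longrightarrow> \<phi> b = \<Phi> b" "a \<in> SU3"
  shows "((\<lambda>t. \<phi> (a ** curve x t)) has_vector_derivative frechet_derivative \<Phi> (at a) (a ** Dvec x)) (at 0)"
proof -
  have "(\<lambda>t. \<phi> (a ** curve x t)) = (\<lambda>t. \<Phi> (a ** curve x t))"
    using assms by (simp add: SU3_mult curve_SU3)
  then show ?thesis
    using smooth_along_curve[OF assms(1) translated_curve[OF curve_vector_derivative, of a]]
    by simp
qed

text \<open>The left side sees \<phi> only on \<open>SU3\<close>, the right side is a derivative of
  an extension. So the latter does not depend on the extension in these directions, and the former
  inherits linearity in x and smoothness in a.\<close>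

lemma lderiv_extension:
  assumes "smooth \<Phi>" "\<And>b. b \<in> SU3 \<Longrightarrow> \<phi> b = \<Phi> b" "a \<in> SU3"
  shows "lderiv \<phi> a x = frechet_derivative \<Phi> (at a) (a ** Dvec x)"
  unfolding lderiv_def using has_vector_derivative_extension[OF assms] by (rule vector_derivative_at)

lemma lderiv_has_vector_derivative:
  assumes "smooth_SU3 \<phi>" "a \<in> SU3"
  shows "((\<lambda>t. \<phi> (a ** curve x t)) has_vector_derivative lderiv \<phi> a x) (at 0)"
proof -
  obtain \<Phi> where "smooth \<Phi>" "\<And>b. b \<in> SU3 \<Longrightarrow> \<phi> b = \<Phi> b" using assms by (auto simp: smooth_SU3_def)
  then show ?thesis
    using has_vector_derivative_extension lderiv_extension assms(2) by metis
qed

lemma lderiv_eqI: "((\<lambda>t. \<phi> (a ** curve x t)) has_vector_derivative d) (at 0) \<Longrightarrow> lderiv \<phi> a x = d"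
  unfolding lderiv_def by (rule vector_derivative_at)

lemma lderiv_cong: "(\<And>b. b \<in> SU3 \<Longrightarrow> \<phi> b = \<psi> b) \<Longrightarrow> a \<in> SU3 \<Longrightarrow> lderiv \<phi> a x = lderiv \<psi> a x"
  unfolding lderiv_def by (simp add: SU3_mult curve_SU3)

lemma lderiv_translate_left: "lderiv (\<lambda>b. \<phi> (h ** b)) a x = lderiv \<phi> (h ** a) x"
  by (simp add: lderiv_def matrix_mul_assoc)

lemma lderiv_const [simp]: "lderiv (\<lambda>a. c) a x = 0"
  by (rule lderiv_eqI) simp

lemma lderiv_add: "smooth_SU3 \<phi> \<Longrightarrow> smooth_SU3 \<psi> \<Longrightarrow> a \<in> SU3 \<Longrightarrow> lderiv (\<lambda>b. \<phi> b + \<psi> b) a x = lderiv \<phi> a x + lderiv \<psi> a x"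
  by (intro lderiv_eqI has_vector_derivative_add lderiv_has_vector_derivative)

lemma lderiv_linear_compose:
  assumes "bounded_linear L" "smooth_SU3 \<phi>" "a \<in> SU3"
  shows "lderiv (\<lambda>b. L (\<phi> b)) a x = L (lderiv \<phi> a x)"
  by (rule lderiv_eqI)
    (rule bounded_linear.has_vector_derivative[OF assms(1) lderiv_has_vector_derivative[OF assms(2,3)]])

lemma lderiv_bilinear:
  assumes "bounded_bilinear B" "smooth_SU3 \<phi>" "smooth_SU3 \<psi>" "a \<in> SU3"
  shows "lderiv (\<lambda>b. B (\<phi> b) (\<psi> b)) a x = B (\<phi> a) (lderiv \<psi> a x) + B (lderiv \<phi> a x) (\<psi> a)"
  using bounded_bilinear.has_vector_derivative[OF assms(1)
      lderiv_has_vector_derivative[OF assms(2,4)] lderiv_has_vector_derivative[OF assms(3,4)]]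
  by (intro lderiv_eqI) simp

lemma linear_lderiv:
  assumes "smooth_SU3 \<phi>" "a \<in> SU3"
  shows "linear (lderiv \<phi> a)"
proof -
  obtain \<Phi> where \<Phi>: "smooth \<Phi>" "\<And>b. b \<in> SU3 \<Longrightarrow> \<phi> b = \<Phi> b" using assms by (auto simp: smooth_SU3_def)
  have "linear (\<lambda>x. frechet_derivative \<Phi> (at a) (a ** Dvec x))"
    using linear_compose[OF linear_compose[OF bounded_linear.linear[OF Dvec_bounded_linear]
        bounded_linear.linear[OF matrix_mult_linear_left[of a]]] smooth_linear_derivative[OF \<Phi>(1)]]
    by (simp add: o_def)
  then show ?thesis
    using lderiv_extension[OF \<Phi> assms(2)] by presburger
qed

lemma smooth_SU3_lderiv:
  assumes "smooth_SU3 \<phi>" "smooth_SU3 \<xi>"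
  shows "smooth_SU3 (\<lambda>a. lderiv \<phi> a (\<xi> a))"
proof -
  obtain \<Phi> where \<Phi>: "smooth \<Phi>" "\<And>b. b \<in> SU3 \<Longrightarrow> \<phi> b = \<Phi> b" using assms by (auto simp: smooth_SU3_def)
  obtain \<Xi> where \<Xi>: "smooth \<Xi>" "\<And>b. b \<in> SU3 \<Longrightarrow> \<xi> b = \<Xi> b" using assms by (auto simp: smooth_SU3_def)
  have "smooth (\<lambda>a. frechet_derivative \<Phi> (at a) (a ** Dvec (\<Xi> a)))"
    by (intro smooth_derivative_along \<Phi> smooth_bilinear[OF matrix_mult_bounded_bilinear]
        smooth_linear_compose[OF Dvec_bounded_linear] \<Xi> smooth_linear bounded_linear_ident)
  then show ?thesis
    using lderiv_extension[OF \<Phi>] \<Xi>(2) by (auto simp: smooth_SU3_def)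
qed

text \<open>The product rule produces one term with second derivatives of f for each order of V and
  W; by symmetry of the second derivative these two cancel in the difference.\<close>

lemma derivative_along_commutator:
  fixes f :: "'a::euclidean_space \<Rightarrow> real"
  assumes f: "smooth f" and V: "smooth V" and W: "smooth W"
  shows "frechet_derivative (\<lambda>y. frechet_derivative f (at y) (W y)) (at x) (V x) -
    frechet_derivative (\<lambda>y. frechet_derivative f (at y) (V y)) (at x) (W x) =
    frechet_derivative f (at x) (frechet_derivative W (at x) (V x) - frechet_derivative V (at x) (W x))"
proof -
  let ?g = "\<lambda>i y. frechet_derivative f (at y) i"
  let ?h = "\<lambda>i. frechet_derivative (?g i) (at x)"
  have lf: "linear (frechet_derivative f (at y))" for y using f by (rule smooth_linear_derivative)
  have lh: "linear (?h i)" for i using f by (intro smooth_linear_derivative smooth_directional)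
  have *: "frechet_derivative (\<lambda>y. frechet_derivative f (at y) (W y)) (at x) v =
      (\<Sum>i\<in>Basis. (W x \<bullet> i) *\<^sub>R ?h i v) + frechet_derivative f (at x) (frechet_derivative W (at x) v)"
    if W: "smooth W" for W :: "'a \<Rightarrow> 'a" and v
  proof -
    have "((\<lambda>y. \<Sum>i\<in>Basis. (W y \<bullet> i) *\<^sub>R ?g i y) has_derivative
        (\<lambda>v. \<Sum>i\<in>Basis. (W x \<bullet> i) *\<^sub>R ?h i v + (frechet_derivative W (at x) v \<bullet> i) *\<^sub>R ?g i x)) (at x)"
      by (intro has_derivative_sum has_derivative_scaleR has_derivative_inner_left
          smooth_has_derivative smooth_directional f W)
    moreover have "(\<lambda>y. \<Sum>i\<in>Basis. (W y \<bullet> i) *\<^sub>R ?g i y) = (\<lambda>y. frechet_derivative f (at y) (W y))"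
      by (intro ext linear_euclidean_expand[OF lf, symmetric])
    ultimately have "((\<lambda>y. frechet_derivative f (at y) (W y)) has_derivative
        (\<lambda>v. \<Sum>i\<in>Basis. (W x \<bullet> i) *\<^sub>R ?h i v + (frechet_derivative W (at x) v \<bullet> i) *\<^sub>R ?g i x)) (at x)"
      by (simp only:)
    note frechet_derivative_at[OF this, symmetric]
    then show ?thesis
      by (simp only: sum.distrib linear_euclidean_expand[OF lf[of x], of "frechet_derivative W (at x) v"])
  qed
  have "(\<Sum>i\<in>Basis. (W x \<bullet> i) *\<^sub>R ?h i (V x)) =
      (\<Sum>i\<in>Basis. \<Sum>j\<in>Basis. (W x \<bullet> i) * (V x \<bullet> j) * ?h i j)"
    by (subst linear_euclidean_expand[OF lh]) (simp add: sum_distrib_left mult.assoc)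
  also have "\<dots> = (\<Sum>j\<in>Basis. \<Sum>i\<in>Basis. (V x \<bullet> j) * (W x \<bullet> i) * ?h j i)"
    by (subst sum.swap) (simp add: second_derivative_commute[OF f] mult.commute)
  also have "\<dots> = (\<Sum>i\<in>Basis. (V x \<bullet> i) *\<^sub>R ?h i (W x))"
    by (subst (2) linear_euclidean_expand[OF lh]) (simp add: sum_distrib_left mult.assoc)
  finally show ?thesis
    using lf[of x] by (simp add: *[OF V] *[OF W] linear_diff)
qed

text \<open>The component in the complement of the commutator of \<open>Dvec x\<close> and
  \<open>Dvec y\<close>: the entrywise conjugate of the cross product.\<close>

definition bracket_m :: "complex^3 \<Rightarrow> complex^3 \<Rightarrow> complex^3" where
  "bracket_m x y = vector [cnj (x$2 * y$3 - x$3 * y$2), cnj (x$3 * y$1 - x$1 * y$3), cnj (x$1 * y$2 - x$2 * y$1)]"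

lemma Dvec_commutator:
  "\<exists>\<alpha> \<beta> \<gamma>. \<alpha> + \<beta> + \<gamma> = 0 \<and>
    Dvec x ** Dvec y - Dvec y ** Dvec x = Dvec (bracket_m x y) + diag3 (\<i> * complex_of_real \<alpha>) (\<i> * of_real \<beta>) (\<i> * of_real \<gamma>)"
proof -
  \<comment> \<open>Here \<open>\<i> * ?c j\<close> equals
    \<open>x$j * cnj (y$j) - y$j * cnj (x$j)\<close>; the diagonal entries of the commutator are
    differences of these numbers.\<close>
  let ?c = "\<lambda>i. 2 * Im (x$i * cnj (y$i))"
  have "Dvec x ** Dvec y - Dvec y ** Dvec x = Dvec (bracket_m x y) +
      diag3 (\<i> * complex_of_real (?c 3 - ?c 1)) (\<i> * of_real (?c 1 - ?c 2)) (\<i> * of_real (?c 2 - ?c 3))"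
    by (rule mat3_eqI)
      (simp_all add: mat3_mult_nth bracket_m_def complex_eq_iff algebra_simps)
  then show ?thesis by (intro exI[of _ "?c 3 - ?c 1"] exI[of _ "?c 1 - ?c 2"] exI[of _ "?c 2 - ?c 3"]) simp
qed

text \<open>The curve \<open>a ** torus_curve\<close> stays in one coset, so \<Phi> is constant
  along it.\<close>

lemma frechet_derivative_torus:
  assumes \<Phi>: "smooth \<Phi>" and inv: "\<And>b k. b \<in> SU3 \<Longrightarrow> k \<in> Tmax \<Longrightarrow> \<Phi> (b ** k) = \<Phi> b"
    and a: "a \<in> SU3" and s: "\<alpha> + \<beta> + \<gamma> = 0"
  shows "frechet_derivative \<Phi> (at a) (a ** diag3 (\<i> * complex_of_real \<alpha>) (\<i> * of_real \<beta>) (\<i> * of_real \<gamma>)) = 0"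
proof -
  have "((\<lambda>t. \<Phi> (a ** torus_curve \<alpha> \<beta> \<gamma> t)) has_vector_derivative
      frechet_derivative \<Phi> (at a) (a ** diag3 (\<i> * complex_of_real \<alpha>) (\<i> * of_real \<beta>) (\<i> * of_real \<gamma>))) (at 0)"
    using smooth_along_curve[OF \<Phi> translated_curve[OF torus_curve_vector_derivative]] by simp
  moreover have "(\<lambda>t. \<Phi> (a ** torus_curve \<alpha> \<beta> \<gamma> t)) = (\<lambda>t. \<Phi> a)"
    using inv[OF a torus_curve_Tmax[OF s]] by simp
  ultimately show ?thesis
    using has_vector_derivative_const vector_derivative_unique_at by metis
qed

text \<open>The ambient fields \<open>V b = b ** Dvec (\<Xi> b)\<close> and W have a commutator that
  consists of the derivatives of N and \<Xi> and of the commutator of \<open>Dvec (\<Xi> a)\<close>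
  and \<open>Dvec (N a)\<close>. The diagonal part of the latter is tangent to the coset and kills
  \<phi>.\<close>

lemma lderiv_commutator:
  fixes \<phi> :: "mat3 \<Rightarrow> real"
  assumes \<phi>: "smooth_SU3 \<phi>" and inv: "\<And>b k. b \<in> SU3 \<Longrightarrow> k \<in> Tmax \<Longrightarrow> \<phi> (b ** k) = \<phi> b"
    and \<xi>: "smooth_SU3 \<xi>" and \<eta>: "smooth_SU3 \<eta>" and a: "a \<in> SU3"
  shows "lderiv (\<lambda>b. lderiv \<phi> b (\<eta> b)) a (\<xi> a) - lderiv (\<lambda>b. lderiv \<phi> b (\<xi> b)) a (\<eta> a) =
    lderiv \<phi> a (lderiv \<eta> a (\<xi> a) - lderiv \<xi> a (\<eta> a) + bracket_m (\<xi> a) (\<eta> a))"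
proof -
  obtain \<Phi> where \<Phi>: "smooth \<Phi>" "\<And>b. b \<in> SU3 \<Longrightarrow> \<phi> b = \<Phi> b" using \<phi> by (auto simp: smooth_SU3_def)
  obtain \<Xi> where \<Xi>: "smooth \<Xi>" "\<And>b. b \<in> SU3 \<Longrightarrow> \<xi> b = \<Xi> b" using \<xi> by (auto simp: smooth_SU3_def)
  obtain N where N: "smooth N" "\<And>b. b \<in> SU3 \<Longrightarrow> \<eta> b = N b" using \<eta> by (auto simp: smooth_SU3_def)
  let ?d = "frechet_derivative \<Phi> (at a)"
  have ld: "linear ?d" using \<Phi>(1) by (rule smooth_linear_derivative)
  define V where "V b = b ** Dvec (\<Xi> b)" for b
  define W where "W b = b ** Dvec (N b)" for b
  have s: "smooth (\<lambda>b. b ** Dvec (f b))" if "smooth f" for f :: "mat3 \<Rightarrow> complex^3"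
    by (intro smooth_bilinear[OF matrix_mult_bounded_bilinear]
        smooth_linear_compose[OF Dvec_bounded_linear] that smooth_linear bounded_linear_ident)
  have V: "smooth V" and W: "smooth W" unfolding V_def[abs_def] W_def[abs_def] by (intro s \<Xi> N)+
  have dp: "frechet_derivative (\<lambda>b. b ** Dvec (f b)) (at a) v = a ** Dvec (frechet_derivative f (at a) v) + v ** Dvec (f a)"
    if "smooth f" for f :: "mat3 \<Rightarrow> complex^3" and v
  proof -
    have "((\<lambda>b. b ** Dvec (f b)) has_derivative (\<lambda>v. a ** Dvec (frechet_derivative f (at a) v) + v ** Dvec (f a))) (at a)"
      by (intro bounded_bilinear.FDERIV[OF matrix_mult_bounded_bilinear]
          bounded_linear.has_derivative[OF Dvec_bounded_linear] smooth_has_derivative that has_derivative_ident)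
    then show ?thesis by (simp add: frechet_derivative_at[symmetric])
  qed
  have d1: "lderiv (\<lambda>b. lderiv \<phi> b (\<eta> b)) a x = frechet_derivative (\<lambda>b. frechet_derivative \<Phi> (at b) (W b)) (at a) (a ** Dvec x)" for x
    by (rule lderiv_extension[OF smooth_derivative_along[OF \<Phi>(1) W] _ a])
      (simp add: lderiv_extension[OF \<Phi>] W_def N(2))
  have d2: "lderiv (\<lambda>b. lderiv \<phi> b (\<xi> b)) a x = frechet_derivative (\<lambda>b. frechet_derivative \<Phi> (at b) (V b)) (at a) (a ** Dvec x)" for x
    by (rule lderiv_extension[OF smooth_derivative_along[OF \<Phi>(1) V] _ a])
      (simp add: lderiv_extension[OF \<Phi>] V_def \<Xi>(2))
  obtain \<alpha> \<beta> \<gamma> where abc: "\<alpha> + \<beta> + \<gamma> = 0" "Dvec (\<Xi> a) ** Dvec (N a) - Dvec (N a) ** Dvec (\<Xi> a) =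
      Dvec (bracket_m (\<Xi> a) (N a)) + diag3 (\<i> * complex_of_real \<alpha>) (\<i> * of_real \<beta>) (\<i> * of_real \<gamma>)"
    using Dvec_commutator by blast
  have invP: "\<Phi> (b ** k) = \<Phi> b" if "b \<in> SU3" "k \<in> Tmax" for b k
    using inv[OF that] \<Phi>(2) that by (simp add: SU3_mult Tmax_SU3)
  note lr = bounded_linear.linear[OF matrix_mult_linear_left]
  have "lderiv (\<lambda>b. lderiv \<phi> b (\<eta> b)) a (\<xi> a) - lderiv (\<lambda>b. lderiv \<phi> b (\<xi> b)) a (\<eta> a) =
      ?d (frechet_derivative W (at a) (V a) - frechet_derivative V (at a) (W a))"
    using derivative_along_commutator[OF \<Phi>(1) V W, of a]
    by (simp add: d1 d2 \<Xi>(2)[OF a] N(2)[OF a] V_def W_def)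
  also have "frechet_derivative W (at a) (V a) - frechet_derivative V (at a) (W a) =
      a ** (Dvec (frechet_derivative N (at a) (V a)) - Dvec (frechet_derivative \<Xi> (at a) (W a)) +
        (Dvec (\<Xi> a) ** Dvec (N a) - Dvec (N a) ** Dvec (\<Xi> a)))"
    unfolding V_def[abs_def] W_def[abs_def]
    by (simp add: dp \<Xi>(1) N(1) matrix_add_ldistrib linear_diff[OF lr] matrix_mul_assoc)
  also have "\<dots> = a ** Dvec (frechet_derivative N (at a) (V a) - frechet_derivative \<Xi> (at a) (W a) + bracket_m (\<Xi> a) (N a))
      + a ** diag3 (\<i> * complex_of_real \<alpha>) (\<i> * of_real \<beta>) (\<i> * of_real \<gamma>)"
    using Dvec_bounded_linear[THEN bounded_linear.linear]
    by (simp add: abc(2) linear_add linear_diff matrix_add_ldistrib linear_diff[OF lr])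
  finally show ?thesis
    using ld frechet_derivative_torus[OF \<Phi>(1) invP a abc(1)]
    by (simp add: linear_add lderiv_extension[OF \<Phi> a] lderiv_extension[OF \<Xi> a] lderiv_extension[OF N a]
        \<Xi>(2)[OF a] N(2)[OF a] V_def W_def)
qed

section \<open>Tangent vectors in coordinates\<close>

text \<open>For k in \<open>Tmax\<close>, conjugation preserves the complement and this is the
  isotropy representation. Reading off entries makes the map linear for every matrix k.\<close>

definition Ad :: "mat3 \<Rightarrow> complex^3 \<Rightarrow> complex^3" where
  "Ad k x = off_diagonal (k ** Dvec x ** ctranspose k)"

lemma Ad_diag3: "Ad (diag3 u v w) x = vector [u * x$1 * cnj v, v * x$2 * cnj w, w * x$3 * cnj u]"
  by (simp add: vec_eq_iff forall_3 Ad_def mat3_mult_nth)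

lemma Dvec_Ad:
  assumes "k \<in> Tmax"
  shows "Dvec (Ad k x) = k ** Dvec x ** ctranspose k"
proof -
  obtain u v w where k: "k = diag3 u v w" using assms by (rule TmaxE)
  show ?thesis
    unfolding k Ad_diag3 by (rule mat3_eqI) (simp_all add: mat3_mult_nth mult_ac)
qed

lemma Ad_ctranspose_Ad:
  assumes "k \<in> Tmax"
  shows "Ad (ctranspose k) (Ad k x) = x"
proof -
  have "Ad (ctranspose k) (Ad k x) = off_diagonal ((ctranspose k ** k) ** Dvec x ** (ctranspose k ** k))"
    by (simp only: Ad_def[of "ctranspose k"] Dvec_Ad[OF assms] ctranspose_ctranspose matrix_mul_assoc)
  then show ?thesis by (simp add: SU3_left_inverse Tmax_SU3 assms)
qed

text \<open>The velocity at \<open>coset a\<close> of the left translate of \<open>curve x\<close>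
  by a. The value 0 on non-smooth functions follows the convention of
  \<open>velocity\<close>.\<close>

definition tvec_of :: "mat3 \<Rightarrow> complex^3 \<Rightarrow> tvec" where
  "tvec_of a x = (\<lambda>F. if F \<in> smooth_fun then lderiv (\<lambda>b. F (coset b)) a x else 0)"

lemma tvec_of_add: "a \<in> SU3 \<Longrightarrow> tvec_of a (x + y) = tvec_of a x + tvec_of a y"
  and tvec_of_scaleR: "a \<in> SU3 \<Longrightarrow> tvec_of a (r *\<^sub>R x) = scal r (tvec_of a x)"
  and tvec_of_diff: "a \<in> SU3 \<Longrightarrow> tvec_of a (x - y) = tvec_of a x - tvec_of a y"
  and tvec_of_0: "a \<in> SU3 \<Longrightarrow> tvec_of a 0 = 0"
  by (auto simp: tvec_of_def fun_eq_iff scal_def smooth_fun_iff linear_add linear_diff linear_0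
      linear_scale[where 'b=real] dest: linear_lderiv)

text \<open>The torus element is moved past the direction:
  \<open>a ** Dvec (Ad k x) ** k = (a ** k) ** Dvec x\<close>.\<close>

lemma lderiv_translate_right:
  assumes \<phi>: "smooth_SU3 \<phi>" and a: "a \<in> SU3" and k: "k \<in> Tmax"
  shows "lderiv (\<lambda>b. \<phi> (b ** k)) a (Ad k x) = lderiv \<phi> (a ** k) x"
proof -
  obtain \<Phi> where \<Phi>: "smooth \<Phi>" "\<And>b. b \<in> SU3 \<Longrightarrow> \<phi> b = \<Phi> b" using \<phi> by (auto simp: smooth_SU3_def)
  have "smooth (\<lambda>b. \<Phi> (b ** k))"
    by (intro smooth_compose[OF \<Phi>(1)] smooth_linear matrix_mult_linear_right)
  moreover have "\<phi> (b ** k) = \<Phi> (b ** k)" if "b \<in> SU3" for b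
    using \<Phi>(2)[of "b ** k"] that by (simp add: SU3_mult Tmax_SU3 k)
  ultimately have "lderiv (\<lambda>b. \<phi> (b ** k)) a (Ad k x) =
      frechet_derivative (\<lambda>b. \<Phi> (b ** k)) (at a) (a ** Dvec (Ad k x))"
    using a by (rule lderiv_extension)
  also have "\<dots> = frechet_derivative \<Phi> (at (a ** k)) (a ** Dvec (Ad k x) ** k)"
    using diff_chain_at[OF bounded_linear_imp_has_derivative[OF matrix_mult_linear_right[of k]]
        smooth_has_derivative[OF \<Phi>(1), of "a ** k"]]
    by (simp add: o_def frechet_derivative_at[symmetric])
  also have "a ** Dvec (Ad k x) ** k = (a ** k) ** Dvec x"
    using SU3_left_inverse[OF Tmax_SU3[OF k]]
    by (simp add: Dvec_Ad[OF k] flip: matrix_mul_assoc)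
  also have "frechet_derivative \<Phi> (at (a ** k)) ((a ** k) ** Dvec x) = lderiv \<phi> (a ** k) x"
    using lderiv_extension[OF \<Phi>, of "a ** k"] a k by (simp add: SU3_mult Tmax_SU3)
  finally show ?thesis .
qed

text \<open>Changing the representative of a coset changes coordinates by \<open>Ad\<close>; the
  equivariance conditions below come from this rule.\<close>

lemma tvec_of_mult_Tmax:
  assumes "a \<in> SU3" "k \<in> Tmax"
  shows "tvec_of (a ** k) x = tvec_of a (Ad k x)"
  using lderiv_translate_right[OF _ assms, of "\<lambda>b. F (coset b)" for F :: "point \<Rightarrow> real"]
  by (auto simp: tvec_of_def fun_eq_iff smooth_fun_iff coset_mult_Tmax assms)

text \<open>\<open>dact\<close> evaluates a tangent vector on \<open>F \<circ> act h\<close>, so the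
  default value 0 is respected because smoothness of F and of its translate are equivalent.\<close>

lemma smooth_fun_act_iff:
  assumes "h \<in> SU3"
  shows "F \<circ> act h \<in> smooth_fun \<longleftrightarrow> F \<in> smooth_fun"
proof
  show "F \<in> smooth_fun \<Longrightarrow> F \<circ> act h \<in> smooth_fun"
    using smooth_SU3_translate_left[OF assms, of "\<lambda>a. F (coset a)"] by (simp add: smooth_fun_iff act_coset)
next
  assume "F \<circ> act h \<in> smooth_fun"
  then show "F \<in> smooth_fun"
    using smooth_SU3_translate_left[OF ctranspose_SU3[OF assms], of "\<lambda>a. F (coset (h ** a))"]
    by (simp add: smooth_fun_iff act_coset matrix_mul_assoc SU3_right_inverse assms)
qed

lemma dact_tvec_of: "h \<in> SU3 \<Longrightarrow> dact h (tvec_of a x) = tvec_of (h ** a) x"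
  using lderiv_translate_left[of "\<lambda>b. F (coset b)" h a x for F :: "point \<Rightarrow> real"] smooth_fun_act_iff[of h]
  by (simp add: dact_def tvec_of_def fun_eq_iff act_coset)

section \<open>Coordinates read off from the projections\<close>

definition representative :: "point \<Rightarrow> mat3" where
  "representative p = (SOME a. a \<in> SU3 \<and> coset a = p)"

lemma representative_flagM:
  assumes "p \<in> flagM"
  shows "representative p \<in> SU3" "coset (representative p) = p"
proof -
  have "\<exists>a. a \<in> SU3 \<and> coset a = p" using assms by (auto simp: flagM_def)
  from someI_ex[OF this] show "representative p \<in> SU3" "coset (representative p) = p" by (auto simp: representative_def)
qed

definition diag_unit :: "3 \<Rightarrow> mat3" where
  "diag_unit j = (\<chi> k l. if k = j \<and> l = j then 1 else 0)"

lemma diag_unit_eq: "diag_unit 1 = diag3 1 0 0" "diag_unit 2 = diag3 0 1 0" "diag_unit 3 = diag3 0 0 1"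
  by (rule mat3_eqI; simp add: diag_unit_def)+

text \<open>The orthogonal projections onto the three lines of a flag are smooth functions of the flag,
  and they separate both points and tangent vectors.\<close>

definition proj :: "3 \<Rightarrow> point \<Rightarrow> mat3" where
  "proj j p = representative p ** diag_unit j ** ctranspose (representative p)"

lemma Tmax_diag_unit:
  assumes "k \<in> Tmax"
  shows "k ** diag_unit j ** ctranspose k = diag_unit j"
proof -
  obtain u v w where k: "k = diag3 u v w" "u * cnj u = 1" "v * cnj v = 1" "w * cnj w = 1"
    using assms by (rule TmaxE)
  have "k ** diag_unit 1 ** ctranspose k = diag_unit 1 \<and> k ** diag_unit 2 ** ctranspose k = diag_unit 2 \<and> k ** diag_unit 3 ** ctranspose k = diag_unit 3"
    by (simp add: diag_unit_eq k diag3_mult ctranspose_diag3)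
  then show ?thesis using exhaust_3[of j] by auto
qed

lemma proj_coset:
  assumes "a \<in> SU3"
  shows "proj j (coset a) = a ** diag_unit j ** ctranspose a"
proof -
  obtain k where k: "k \<in> Tmax" "representative (coset a) = a ** k"
    using coset_eqD[of a "representative (coset a)"] representative_flagM(2)[OF coset_flagM[OF assms]] by auto
  have "proj j (coset a) = a ** (k ** diag_unit j ** ctranspose k) ** ctranspose a"
    by (simp add: proj_def k(2) ctranspose_mult matrix_mul_assoc)
  then show ?thesis by (simp add: Tmax_diag_unit k)
qed

lemma proj_nth:
  assumes "a \<in> SU3"
  shows "proj j (coset a) $ k $ l = a$k$j * cnj (a$l$j)"
proof -
  have "(a ** diag_unit 1 ** ctranspose a) $ k $ l = a$k$1 * cnj (a$l$1) \<and>
    (a ** diag_unit 2 ** ctranspose a) $ k $ l = a$k$2 * cnj (a$l$2) \<and>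
    (a ** diag_unit 3 ** ctranspose a) $ k $ l = a$k$3 * cnj (a$l$3)"
    by (simp add: mat3_mult_nth diag_unit_eq)
  then show ?thesis using exhaust_3[of j] by (auto simp: proj_coset[OF assms])
qed

lemma smooth_SU3_proj: "smooth_SU3 (\<lambda>a. proj j (coset a))"
proof -
  have "smooth_SU3 (\<lambda>a. a ** diag_unit j ** ctranspose a)"
    by (intro smooth_SU3_smooth smooth_bilinear[OF matrix_mult_bounded_bilinear] smooth_linear
        matrix_mult_linear_right ctranspose_bounded_linear)
  then show ?thesis by (subst smooth_SU3_cong[OF proj_coset]) auto
qed

lemma nth_nth_bounded_linear: "bounded_linear (\<lambda>A :: 'b::real_normed_vector^'n^'m. A $ k $ l)"
  by (rule bounded_linear_compose[OF bounded_linear_vec_nth bounded_linear_vec_nth])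

lemma Re_nth_bounded_linear: "bounded_linear (\<lambda>A :: mat3. Re (A $ k $ l))"
  and Im_nth_bounded_linear: "bounded_linear (\<lambda>A :: mat3. Im (A $ k $ l))"
  by (rule bounded_linear_compose[OF bounded_linear_Re nth_nth_bounded_linear]
      bounded_linear_compose[OF bounded_linear_Im nth_nth_bounded_linear])+

lemma proj_smooth_fun: "(\<lambda>p. Re (proj j p $ k $ l)) \<in> smooth_fun" "(\<lambda>p. Im (proj j p $ k $ l)) \<in> smooth_fun"
  unfolding smooth_fun_iff
  by (intro smooth_SU3_linear_compose[OF Re_nth_bounded_linear] smooth_SU3_linear_compose[OF Im_nth_bounded_linear] smooth_SU3_proj)+

definition vproj :: "tvec \<Rightarrow> 3 \<Rightarrow> mat3" where
  "vproj v j = (\<chi> k l. Complex (v (\<lambda>p. Re (proj j p $ k $ l))) (v (\<lambda>p. Im (proj j p $ k $ l))))"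

text \<open>Conjugated back by a, the derivative of the projection j is the commutator of
  \<open>Dvec x\<close> with \<open>diag_unit j\<close>. In column j and a row other than j it has
  the same entry as \<open>Dvec x\<close>; this dictates the indices for each coordinate and the
  sign of the third.\<close>

definition tvec_coords :: "mat3 \<Rightarrow> tvec \<Rightarrow> complex^3" where
  "tvec_coords a v = vector [(ctranspose a ** vproj v 2 ** a) $ 1 $ 2,
    (ctranspose a ** vproj v 3 ** a) $ 2 $ 3, - (ctranspose a ** vproj v 1 ** a) $ 3 $ 1]"

lemma vproj_tvec_of:
  assumes "a \<in> SU3"
  shows "vproj (tvec_of a x) j = a ** (Dvec x ** diag_unit j - diag_unit j ** Dvec x) ** ctranspose a"
proof -
  have id: "smooth_SU3 (\<lambda>a::mat3. a)" by (intro smooth_SU3_smooth smooth_linear bounded_linear_ident)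
  have lderiv_id: "lderiv (\<lambda>a. a) a x = a ** Dvec x"
    by (rule lderiv_eqI) (rule translated_curve[OF curve_vector_derivative])
  have ct: "ctranspose (Dvec x) = - Dvec x" by (rule mat3_eqI) simp_all
  note lr = bounded_linear.linear[OF matrix_mult_linear_left]
  note ll = bounded_linear.linear[OF matrix_mult_linear_right]
  have "vproj (tvec_of a x) j = lderiv (\<lambda>b. proj j (coset b)) a x"
    by (simp add: vproj_def vec_eq_iff tvec_of_def proj_smooth_fun complex_eq_iff
        lderiv_linear_compose[OF Re_nth_bounded_linear smooth_SU3_proj assms]
        lderiv_linear_compose[OF Im_nth_bounded_linear smooth_SU3_proj assms])
  also have "\<dots> = lderiv (\<lambda>b. (b ** diag_unit j) ** ctranspose b) a x"
    by (rule lderiv_cong[OF proj_coset assms])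
  also have "\<dots> = (a ** diag_unit j) ** ctranspose (a ** Dvec x) + (a ** Dvec x) ** diag_unit j ** ctranspose a"
    by (subst lderiv_bilinear[OF matrix_mult_bounded_bilinear _ _ assms])
      (simp_all add: smooth_SU3_linear_compose[OF matrix_mult_linear_right id]
        smooth_SU3_linear_compose[OF ctranspose_bounded_linear id] lderiv_id
        lderiv_linear_compose[OF matrix_mult_linear_right id assms]
        lderiv_linear_compose[OF ctranspose_bounded_linear id assms])
  also have "\<dots> = a ** (Dvec x ** diag_unit j - diag_unit j ** Dvec x) ** ctranspose a"
    by (simp add: ctranspose_mult ct linear_diff[OF lr] linear_diff[OF ll] linear_neg[OF lr]
        linear_neg[OF ll] matrix_mul_assoc)
  finally show ?thesis .
qed

lemma tvec_coords_tvec_of [simp]: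
  assumes "a \<in> SU3"
  shows "tvec_coords a (tvec_of a x) = x"
proof -
  have *: "ctranspose a ** vproj (tvec_of a x) j ** a = Dvec x ** diag_unit j - diag_unit j ** Dvec x" for j
  proof -
    have "ctranspose a ** vproj (tvec_of a x) j ** a =
        (ctranspose a ** a) ** (Dvec x ** diag_unit j - diag_unit j ** Dvec x) ** (ctranspose a ** a)"
      by (simp only: vproj_tvec_of[OF assms] matrix_mul_assoc)
    then show ?thesis by (simp add: SU3_left_inverse[OF assms])
  qed
  show ?thesis
    by (simp add: tvec_coords_def * diag_unit_eq vec_eq_iff forall_3 mat3_mult_nth)
qed

lemma tvec_of_eq_iff: "a \<in> SU3 \<Longrightarrow> tvec_of a x = tvec_of a y \<longleftrightarrow> x = y"
  by (metis tvec_coords_tvec_of)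

lemma tvec_of_eq_0_iff: "a \<in> SU3 \<Longrightarrow> tvec_of a x = 0 \<longleftrightarrow> x = 0"
  by (metis tvec_of_0 tvec_of_eq_iff)

section \<open>Tangent spaces\<close>

lemma velocity_coset_curve:
  assumes "smooth c" "\<And>t. c t \<in> SU3" "c 0 = a" "(c has_vector_derivative a ** Dvec x) (at 0)"
  shows "velocity (\<lambda>t. coset (c t)) = tvec_of a x"
proof -
  have a: "a \<in> SU3" using assms(2,3) by blast
  have "deriv (F \<circ> (\<lambda>t. coset (c t))) 0 = lderiv (\<lambda>b. F (coset b)) a x" if F: "F \<in> smooth_fun" for F
  proof -
    obtain \<Phi> where \<Phi>: "smooth \<Phi>" "\<And>b. b \<in> SU3 \<Longrightarrow> F (coset b) = \<Phi> b"
      using F by (auto simp: smooth_fun_def)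
    have "((F \<circ> (\<lambda>t. coset (c t))) has_real_derivative lderiv (\<lambda>b. F (coset b)) a x) (at 0)"
      using smooth_along_curve[OF \<Phi>(1) assms(4)] \<Phi>(2) assms(2,3)
      by (simp add: o_def lderiv_extension[OF \<Phi> a] has_real_derivative_iff_has_vector_derivative)
    then show ?thesis by (rule DERIV_imp_deriv)
  qed
  then show ?thesis by (auto simp: velocity_def tvec_of_def)
qed

lemma smooth_curve_coset:
  assumes "smooth c" "\<And>t. c t \<in> SU3"
  shows "smooth_curve (\<lambda>t. coset (c t))"
proof -
  have "smooth (F \<circ> (\<lambda>t. coset (c t)))" if F: "F \<in> smooth_fun" for F
  proof -
    obtain \<Phi> where \<Phi>: "smooth \<Phi>" "\<And>b. b \<in> SU3 \<Longrightarrow> F (coset b) = \<Phi> b"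
      using F by (auto simp: smooth_fun_def)
    then show ?thesis
      using smooth_compose[OF \<Phi>(1) assms(1)] assms(2) by (simp add: o_def)
  qed
  then show ?thesis using assms(2) by (auto simp: smooth_curve_def intro: coset_flagM)
qed

lemma tvec_of_tangent:
  assumes "a \<in> SU3"
  shows "tvec_of a x \<in> tangent (coset a)"
proof -
  let ?c = "\<lambda>t. a ** curve x t"
  have c: "smooth ?c" by (intro smooth_linear_compose[OF matrix_mult_linear_left] curve_smooth)
  have c': "?c t \<in> SU3" for t by (simp add: SU3_mult assms curve_SU3)
  have "velocity (\<lambda>t. coset (?c t)) = tvec_of a x"
    by (rule velocity_coset_curve[OF c c']) (simp_all add: translated_curve[OF curve_vector_derivative])
  then show ?thesis
    unfolding tangent_def using smooth_curve_coset[OF c c'] by force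
qed

text \<open>The description in \<open>dcoset\<close> is met by \<open>curve x\<close>, and the
  velocity of a projected curve depends only on its first derivative, so the described value is
  unique.\<close>

lemma dcoset_Dvec: "dcoset (Dvec x) = tvec_of (mat 1) x"
  unfolding dcoset_def
proof (rule the_equality)
  show "\<exists>c. smooth c \<and> (\<forall>t. c t \<in> SU3) \<and> c 0 = mat 1 \<and> (c has_vector_derivative Dvec x) (at 0) \<and>
      tvec_of (mat 1) x = velocity (coset \<circ> c)"
    using velocity_coset_curve[OF curve_smooth curve_SU3, of x "mat 1" x]
    by (intro exI[of _ "curve x"]) (simp add: curve_smooth curve_SU3 curve_vector_derivative o_def)
qed (use velocity_coset_curve[of _ "mat 1" x] in \<open>auto simp: o_def\<close>)

text \<open>A local section of \<open>coset\<close> near the origin. The third column is forced by the first two, since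
  matrices in \<open>SU3\<close> have determinant \<open>1\<close>.\<close>

definition local_section :: "point \<Rightarrow> mat3" where
  "local_section p = (let u = (\<lambda>k. proj 1 p $ k $ 1 / of_real (sqrt (Re (proj 1 p $ 1 $ 1))));
       v = (\<lambda>k. proj 2 p $ k $ 2 / of_real (sqrt (Re (proj 2 p $ 2 $ 2)))) in
    vector [vector [u 1, v 1, cnj (u 2 * v 3 - u 3 * v 2)],
            vector [u 2, v 2, cnj (u 3 * v 1 - u 1 * v 3)],
            vector [u 3, v 3, cnj (u 1 * v 2 - u 2 * v 1)]])"

text \<open>Column j of the projection j is column j of a times \<open>cnj (a$j$j)\<close>; division
  by the modulus leaves a phase. So the first two columns are those of \<open>a ** ?k\<close> with
  \<open>?k\<close> in the torus, and then the third agrees as well.\<close>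

lemma local_section_coset:
  assumes "a \<in> SU3" "a$1$1 \<noteq> 0" "a$2$2 \<noteq> 0"
  shows "local_section (coset a) \<in> SU3" "coset (local_section (coset a)) = coset a"
proof -
  let ?u = "cnj (sgn (a$1$1))" and ?v = "cnj (sgn (a$2$2))"
  \<comment> \<open>The third phase is forced by determinant 1.\<close>
  let ?w = "sgn (a$1$1) * sgn (a$2$2)"
  let ?k = "diag3 ?u ?v ?w"
  have n: "sgn (a$1$1) * cnj (sgn (a$1$1)) = 1" "sgn (a$2$2) * cnj (sgn (a$2$2)) = 1"
    using assms by (simp_all add: sgn_mult_cnj)
  then have n': "cnj (sgn (a$1$1)) * sgn (a$1$1) = 1" "cnj (sgn (a$2$2)) * sgn (a$2$2) = 1"
    by (simp_all add: mult.commute)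
  have "?u * ?v * ?w = (sgn (a$1$1) * cnj (sgn (a$1$1))) * (sgn (a$2$2) * cnj (sgn (a$2$2)))"
    "?w * cnj ?w = (sgn (a$1$1) * cnj (sgn (a$1$1))) * (sgn (a$2$2) * cnj (sgn (a$2$2)))"
    by (simp_all add: mult_ac)
  then have k: "?k \<in> Tmax" by (intro diag3_Tmax) (simp_all add: n n')
  have c: "z * cnj w / of_real (sqrt (Re (w * cnj w))) = z * cnj (sgn w)" for z w
  proof -
    have "sqrt (Re (w * cnj w)) = cmod w"
      by (simp add: cmod_def power2_eq_square)
    then show ?thesis by (simp add: sgn_eq)
  qed
  have ak: "a ** ?k \<in> SU3" using assms k by (simp add: SU3_mult Tmax_SU3)
  have u: "proj 1 (coset a) $ i $ 1 / of_real (sqrt (Re (proj 1 (coset a) $ 1 $ 1))) = (a ** ?k) $ i $ 1"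
    and v: "proj 2 (coset a) $ i $ 2 / of_real (sqrt (Re (proj 2 (coset a) $ 2 $ 2))) = (a ** ?k) $ i $ 2" for i
    by (simp_all only: proj_nth[OF assms(1)] c mat3_mult_nth diag3_nth mult_zero_right add_0_left add_0_right)
  have "local_section (coset a) = a ** ?k"
    by (rule mat3_eqI; simp only: local_section_def Let_def vector_3 u v SU3_third_column[OF ak])
  then show "local_section (coset a) \<in> SU3" "coset (local_section (coset a)) = coset a"
    using ak coset_mult_Tmax[OF k] by simp_all
qed

text \<open>Near 0 the curve is lifted to \<open>SU3\<close> by \<open>local_section\<close>; the
  lift is differentiable at 0 because the projections are smooth functions. Unitarity makes its
  derivative skew-Hermitian, the normalisation of the section makes the diagonal vanish, and so the
  derivative has the form \<open>Dvec x\<close>.\<close>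

lemma velocity_origin:
  assumes \<gamma>: "smooth_curve \<gamma>" and 0: "\<gamma> 0 = origin"
  shows "\<exists>x. velocity \<gamma> = tvec_of (mat 1) x"
proof -
  have fl: "\<gamma> t \<in> flagM" for t using \<gamma> by (simp add: smooth_curve_def)
  have dF: "\<exists>d. ((\<lambda>t. F (\<gamma> t)) has_vector_derivative d) (at 0)" if "F \<in> smooth_fun" for F
  proof -
    have "smooth (\<lambda>t. F (\<gamma> t))" using \<gamma> that by (simp add: smooth_curve_def o_def)
    then have "(\<lambda>t. F (\<gamma> t)) differentiable (at 0)"
      using smooth_has_derivative differentiableI by blast
    then show ?thesis using vector_derivative_works by blast
  qed
  have dp: "\<exists>d. ((\<lambda>t. proj j (\<gamma> t) $ k $ l) has_vector_derivative d) (at 0)" for j k l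
  proof -
    obtain d where d: "((\<lambda>t. Re (proj j (\<gamma> t) $ k $ l)) has_vector_derivative d) (at 0)"
      using dF[OF proj_smooth_fun(1)] by blast
    obtain e where e: "((\<lambda>t. Im (proj j (\<gamma> t) $ k $ l)) has_vector_derivative e) (at 0)"
      using dF[OF proj_smooth_fun(2)] by blast
    have "((\<lambda>t. of_real (Re (proj j (\<gamma> t) $ k $ l)) + \<i> * of_real (Im (proj j (\<gamma> t) $ k $ l)))
        has_vector_derivative complex_of_real d + \<i> * of_real e) (at 0)"
      by (intro has_vector_derivative_add has_vector_derivative_mult_right
          bounded_linear.has_vector_derivative[OF bounded_linear_of_real] d e)
    then show ?thesis by (auto simp: complex_eq[symmetric])
  qed
  define \<sigma> where "\<sigma> t = local_section (\<gamma> t)" for t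
  have proj0: "proj j (\<gamma> 0) = diag_unit j" for j
    by (simp add: 0 origin_def proj_coset[OF mat_1_SU3])
  have \<sigma>0: "\<sigma> 0 = mat 1"
    by (rule mat3_eqI) (simp_all add: \<sigma>_def local_section_def Let_def proj0 diag_unit_eq mat_1_nth3)
  \<comment> \<open>At t = 0 these entries are 1, so by continuity the section is valid along the
    curve near 0.\<close>
  have pos: "\<forall>\<^sub>F t in nhds 0. 0 < Re (proj j (\<gamma> t) $ j $ j)" for j
  proof -
    obtain d where "((\<lambda>t. Re (proj j (\<gamma> t) $ j $ j)) has_vector_derivative d) (at 0)"
      using dF[OF proj_smooth_fun(1)] by blast
    then have "isCont (\<lambda>t. Re (proj j (\<gamma> t) $ j $ j)) 0"
      by (rule has_vector_derivative_continuous)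
    moreover have "Re (proj j (\<gamma> 0) $ j $ j) = 1"
      by (simp add: proj0 diag_unit_def)
    ultimately have "\<forall>\<^sub>F t in at 0. 0 < Re (proj j (\<gamma> t) $ j $ j)"
      using order_tendstoD(1)[of "\<lambda>t. Re (proj j (\<gamma> t) $ j $ j)" 1 "at 0" 0] by (simp add: isCont_def)
    then show ?thesis
      using \<open>Re (proj j (\<gamma> 0) $ j $ j) = 1\<close> by (simp add: eventually_nhds_conv_at)
  qed
  have "\<forall>\<^sub>F t in nhds 0. 0 < Re (proj 1 (\<gamma> t) $ 1 $ 1) \<and> 0 < Re (proj 2 (\<gamma> t) $ 2 $ 2)"
    using pos[of 1] pos[of 2] by eventually_elim simp
  then have \<sigma>: "\<forall>\<^sub>F t in nhds 0. \<sigma> t \<in> SU3 \<and> coset (\<sigma> t) = \<gamma> t"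
  proof eventually_elim
    case (elim t)
    obtain b where b: "b \<in> SU3" "\<gamma> t = coset b" using fl[of t] by (auto simp: flagM_def)
    then have "b$1$1 \<noteq> 0" "b$2$2 \<noteq> 0" using elim by (auto simp: proj_nth)
    then show ?case using local_section_coset[OF b(1)] by (simp add: \<sigma>_def b(2))
  qed
  have n: "\<exists>d. ((\<lambda>t. proj j (\<gamma> t) $ k $ j / of_real (sqrt (Re (proj j (\<gamma> t) $ j $ j)))) has_vector_derivative d) (at 0)"
    for j k
  proof -
    obtain d where d: "((\<lambda>t. proj j (\<gamma> t) $ k $ j) has_vector_derivative d) (at 0)"
      using dp by blast
    obtain e where "((\<lambda>t. Re (proj j (\<gamma> t) $ j $ j)) has_vector_derivative e) (at 0)"
      using dF[OF proj_smooth_fun(1)] by blast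
    then have e: "((\<lambda>t. Re (proj j (\<gamma> t) $ j $ j)) has_real_derivative e) (at 0)"
      by (simp add: has_real_derivative_iff_has_vector_derivative)
    \<comment> \<open>The quantity under the root is 1 at t = 0, so the derivative at 1 is the one
      that enters.\<close>
    have "((\<lambda>s. inverse (sqrt s)) has_real_derivative - (1/2)) (at 1)"
      by (auto intro!: derivative_eq_intros)
    then have "((\<lambda>t. inverse (sqrt (Re (proj j (\<gamma> t) $ j $ j)))) has_real_derivative - (1/2) * e) (at 0)"
      using DERIV_chain2[of "\<lambda>s. inverse (sqrt s)" "- (1/2)", OF _ e] by (simp add: proj0 diag_unit_def)
    then have "((\<lambda>t. inverse (sqrt (Re (proj j (\<gamma> t) $ j $ j)))) has_vector_derivative - (1/2) * e) (at 0)"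
      by (simp only: has_real_derivative_iff_has_vector_derivative)
    from bounded_bilinear.has_vector_derivative[OF bounded_bilinear_scaleR this d]
    have "\<exists>d. ((\<lambda>t. inverse (sqrt (Re (proj j (\<gamma> t) $ j $ j))) *\<^sub>R proj j (\<gamma> t) $ k $ j) has_vector_derivative d) (at 0)"
      by blast
    moreover have "inverse r *\<^sub>R z = z / of_real r" for r and z :: complex
      by (metis divide_inverse mult.commute of_real_inverse scaleR_conv_of_real)
    ultimately show ?thesis by (simp only:)
  qed
  have vd: "(h has_vector_derivative vector_derivative h (at 0)) (at 0)"
    if "\<exists>d. (h has_vector_derivative d) (at 0)" for h :: "real \<Rightarrow> complex"
    using that vector_derivative_at by blast
  define d where "d j k = vector_derivative
    (\<lambda>t. proj j (\<gamma> t) $ k $ j / of_real (sqrt (Re (proj j (\<gamma> t) $ j $ j)))) (at 0)" for j k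
  note d = vd[OF n, folded d_def]
  have \<sigma>12: "((\<lambda>t. \<sigma> t $ k $ 1) has_vector_derivative d 1 k) (at 0)"
     "((\<lambda>t. \<sigma> t $ k $ 2) has_vector_derivative d 2 k) (at 0)" for k
    using d[of 1 k] d[of 2 k] exhaust_3[of k] by (auto simp: \<sigma>_def local_section_def Let_def)
  note prod = has_vector_derivative_mult[OF \<sigma>12(1) \<sigma>12(2)]
  have c3: "\<exists>e. ((\<lambda>t. cnj (\<sigma> t $ k $ 1 * \<sigma> t $ l $ 2 - \<sigma> t $ l $ 1 * \<sigma> t $ k $ 2)) has_vector_derivative e) (at 0)" for k l
    using has_vector_derivative_cnj[OF has_vector_derivative_diff[OF prod[of k l] prod[of l k]]] by blast
  have s3: "\<sigma> t $ 1 $ 3 = cnj (\<sigma> t $ 2 $ 1 * \<sigma> t $ 3 $ 2 - \<sigma> t $ 3 $ 1 * \<sigma> t $ 2 $ 2)"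
    "\<sigma> t $ 2 $ 3 = cnj (\<sigma> t $ 3 $ 1 * \<sigma> t $ 1 $ 2 - \<sigma> t $ 1 $ 1 * \<sigma> t $ 3 $ 2)"
    "\<sigma> t $ 3 $ 3 = cnj (\<sigma> t $ 1 $ 1 * \<sigma> t $ 2 $ 2 - \<sigma> t $ 2 $ 1 * \<sigma> t $ 1 $ 2)" for t
    by (simp_all only: \<sigma>_def local_section_def Let_def vector_3)
  have e: "\<exists>e. ((\<lambda>t. \<sigma> t $ k $ l) has_vector_derivative e) (at 0)" for k l
    using exhaust_3[of l] exhaust_3[of k] \<sigma>12[of k] c3[of 2 3] c3[of 3 1] c3[of 1 2]
    by (elim disjE) (auto simp only: s3)
  define S :: mat3 where "S = (\<chi> k l. vector_derivative (\<lambda>t. \<sigma> t $ k $ l) (at 0))"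
  have S: "(\<sigma> has_vector_derivative S) (at 0)"
    by (intro has_vector_derivative_vec) (simp add: S_def vd[OF e])
  have eqS: "((\<lambda>t. \<sigma> t $ k $ l) has_vector_derivative S $ k $ l) (at 0)" for k l
    by (simp add: S_def vd[OF e])
  have "((\<lambda>t. \<sigma> t ** ctranspose (\<sigma> t)) has_vector_derivative \<sigma> 0 ** ctranspose S + S ** ctranspose (\<sigma> 0)) (at 0)"
    by (intro bounded_bilinear.has_vector_derivative[OF matrix_mult_bounded_bilinear]
        bounded_linear.has_vector_derivative[OF ctranspose_bounded_linear] S)
  \<comment> \<open>The product is known to be the identity only near 0, which determines its
    derivative there.\<close>
  moreover have "((\<lambda>t. \<sigma> t ** ctranspose (\<sigma> t)) has_vector_derivative 0) (at 0)"
  proof -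
    have "\<forall>\<^sub>F t in nhds 0. t \<in> UNIV \<longrightarrow> \<sigma> t ** ctranspose (\<sigma> t) = mat 1"
      using \<sigma> by eventually_elim (simp add: SU3_right_inverse)
    from has_vector_derivative_cong_ev[OF this] show ?thesis by (simp add: \<sigma>0)
  qed
  ultimately have "\<sigma> 0 ** ctranspose S + S ** ctranspose (\<sigma> 0) = 0"
    by (rule vector_derivative_unique_at)
  then have skew: "ctranspose S = - S"
    by (simp add: \<sigma>0 eq_neg_iff_add_eq_0)
  \<comment> \<open>The first two diagonal entries of the section are real, so the imaginary part
    has derivative 0; skewness removes the real part.\<close>
  have Sd: "S $ j $ j = 0" if j: "j = 1 \<or> j = 2" for j
  proof -
    have "Im (\<sigma> t $ j $ j) = 0" for t
    proof -
      obtain b where b: "b \<in> SU3" "\<gamma> t = coset b" using fl[of t] by (auto simp: flagM_def)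
      have "Im (proj j (\<gamma> t) $ j $ j) = 0" by (simp add: b proj_nth)
      then show ?thesis using j by (auto simp: \<sigma>_def local_section_def Let_def)
    qed
    then have "((\<lambda>t. Im (\<sigma> t $ j $ j)) has_vector_derivative 0) (at 0)" by simp
    moreover have "((\<lambda>t. Im (\<sigma> t $ j $ j)) has_vector_derivative Im (S $ j $ j)) (at 0)"
      by (intro bounded_linear.has_vector_derivative[OF bounded_linear_Im] eqS)
    ultimately have "Im (S $ j $ j) = 0" by (metis vector_derivative_unique_at)
    moreover have "ctranspose S $ j $ j = - S $ j $ j" using skew by simp
    then have "Re (S $ j $ j) = 0" by (simp add: complex_eq_iff)
    ultimately show ?thesis by (simp add: complex_eq_iff)
  qed
  \<comment> \<open>The third diagonal entry is the conjugate of a minor whose derivative at the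
    identity is the sum of the first two diagonal derivatives.\<close>
  have S3: "S $ 3 $ 3 = 0"
  proof -
    have "((\<lambda>t. \<sigma> t $ 3 $ 3) has_vector_derivative
        cnj (\<sigma> 0 $ 1 $ 1 * S $ 2 $ 2 + S $ 1 $ 1 * \<sigma> 0 $ 2 $ 2 - (\<sigma> 0 $ 2 $ 1 * S $ 1 $ 2 + S $ 2 $ 1 * \<sigma> 0 $ 1 $ 2))) (at 0)"
      unfolding s3(3)
      by (intro has_vector_derivative_cnj has_vector_derivative_diff has_vector_derivative_mult eqS)
    from vector_derivative_unique_at[OF eqS this] show ?thesis
      by (simp add: Sd \<sigma>0 mat_1_nth3)
  qed
  have SD: "Dvec (off_diagonal S) = S" using Dvec_off_diagonal[OF skew] Sd S3 by simp
  have "deriv (F \<circ> \<gamma>) 0 = lderiv (\<lambda>b. F (coset b)) (mat 1) (off_diagonal S)" if F: "F \<in> smooth_fun" for F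
  proof -
    obtain \<Phi> where \<Phi>: "smooth \<Phi>" "\<And>b. b \<in> SU3 \<Longrightarrow> F (coset b) = \<Phi> b"
      using F by (auto simp: smooth_fun_def)
    have ev: "\<forall>\<^sub>F t in nhds 0. t \<in> UNIV \<longrightarrow> F (\<gamma> t) = \<Phi> (\<sigma> t)"
      using \<sigma> by eventually_elim (metis \<Phi>(2))
    have "((\<lambda>t. \<Phi> (\<sigma> t)) has_vector_derivative frechet_derivative \<Phi> (at (mat 1)) S) (at 0)"
      using smooth_along_curve[OF \<Phi>(1) S] by (simp add: \<sigma>0)
    then have "((\<lambda>t. F (\<gamma> t)) has_vector_derivative frechet_derivative \<Phi> (at (mat 1)) S) (at 0)"
      by (subst has_vector_derivative_cong_ev[OF ev]) (use eventually_nhds_x_imp_x[OF ev] in auto)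
    then have "((F \<circ> \<gamma>) has_real_derivative lderiv (\<lambda>b. F (coset b)) (mat 1) (off_diagonal S)) (at 0)"
      by (simp add: o_def has_real_derivative_iff_has_vector_derivative lderiv_extension[OF \<Phi> mat_1_SU3] SD)
    then show ?thesis by (rule DERIV_imp_deriv)
  qed
  then have "velocity \<gamma> = tvec_of (mat 1) (off_diagonal S)"
    by (auto simp: velocity_def tvec_of_def)
  then show ?thesis by blast
qed

lemma act_smooth_curve:
  assumes "h \<in> SU3" "smooth_curve \<gamma>"
  shows "smooth_curve (\<lambda>t. act h (\<gamma> t))" "velocity (\<lambda>t. act h (\<gamma> t)) = dact h (velocity \<gamma>)"
proof -
  have "act h p \<in> flagM" if "p \<in> flagM" for p
    using that assms(1) by (auto simp: flagM_def act_coset SU3_mult)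
  moreover have "smooth (\<lambda>t. F (act h (\<gamma> t)))" if "F \<in> smooth_fun" for F
    using assms(2) smooth_fun_act_iff[OF assms(1), of F] that
    by (auto simp: smooth_curve_def o_def)
  ultimately show "smooth_curve (\<lambda>t. act h (\<gamma> t))"
    using assms(2) by (simp add: smooth_curve_def o_def)
  show "velocity (\<lambda>t. act h (\<gamma> t)) = dact h (velocity \<gamma>)"
    using smooth_fun_act_iff[OF assms(1)] by (simp add: velocity_def dact_def fun_eq_iff o_def)
qed

text \<open>Translation by \<open>ctranspose a\<close> moves the base point to the origin, where
  \<open>velocity_origin\<close> applies.\<close>

lemma tangent_coset:
  assumes a: "a \<in> SU3"
  shows "tangent (coset a) = range (tvec_of a)"
proof
  show "tangent (coset a) \<subseteq> range (tvec_of a)"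
  proof
    fix v assume "v \<in> tangent (coset a)"
    then obtain \<gamma> where \<gamma>: "smooth_curve \<gamma>" "\<gamma> 0 = coset a" "v = velocity \<gamma>"
      by (auto simp: tangent_def)
    let ?\<gamma> = "\<lambda>t. act (ctranspose a) (\<gamma> t)"
    have s: "smooth_curve ?\<gamma>" using \<gamma> a by (simp add: act_smooth_curve ctranspose_SU3)
    moreover have "?\<gamma> 0 = origin"
      by (simp add: \<gamma> act_coset origin_def SU3_left_inverse a)
    ultimately obtain x where x: "velocity ?\<gamma> = tvec_of (mat 1) x"
      using velocity_origin by blast
    have "v = velocity (\<lambda>t. act a (?\<gamma> t))"
      by (simp add: \<gamma> act_act_ctranspose a)
    also have "\<dots> = tvec_of a x"
      by (simp add: act_smooth_curve(2)[OF a s] x dact_tvec_of a)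
    finally show "v \<in> range (tvec_of a)" by simp
  qed
qed (use tvec_of_tangent[OF a] in auto)

section \<open>Vector fields in coordinates\<close>

lemma Ad_bounded_linear: "bounded_linear (Ad k)"
  unfolding Ad_def[abs_def]
  by (intro bounded_linear_compose[OF off_diagonal_bounded_linear]
      bounded_linear_compose[OF matrix_mult_linear_right]
      bounded_linear_compose[OF matrix_mult_linear_left] Dvec_bounded_linear)

definition coords :: "vfield \<Rightarrow> mat3 \<Rightarrow> complex^3" where
  "coords X a = tvec_coords a (X (coset a))"

lemma coords_eqI: "a \<in> SU3 \<Longrightarrow> X (coset a) = tvec_of a x \<Longrightarrow> coords X a = x"
  by (simp add: coords_def)

lemma vfield_tvec_of:
  assumes "X \<in> vfields" "a \<in> SU3"
  shows "X (coset a) = tvec_of a (coords X a)"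
proof -
  have "X (coset a) \<in> range (tvec_of a)"
    using assms coset_flagM[OF assms(2)] by (simp add: vfields_def flip: tangent_coset)
  then obtain x where "X (coset a) = tvec_of a x" by blast
  then show ?thesis using coords_eqI[OF assms(2)] by simp
qed

lemma vfield_outside: "X \<in> vfields \<Longrightarrow> p \<notin> flagM \<Longrightarrow> X p = 0"
  by (simp add: vfields_def)

lemma smooth_SU3_vproj:
  assumes "X \<in> vfields"
  shows "smooth_SU3 (\<lambda>a. vproj (X (coset a)) j)"
proof -
  have "smooth_SU3 (\<lambda>a. X (coset a) F)" if "F \<in> smooth_fun" for F
  proof -
    have "(\<lambda>p. X p F) \<in> smooth_fun" using assms that by (simp add: vfields_def)
    then show ?thesis by (simp add: smooth_fun_iff)
  qed
  then show ?thesis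
    by (intro smooth_SU3_vec smooth_SU3_complex) (simp_all add: vproj_def proj_smooth_fun)
qed

text \<open>Up to sign, each coordinate is an entry of a product of a, its adjoint and the
  derivative along X of one of the smooth functions \<open>proj\<close>.\<close>

lemma smooth_SU3_coords:
  assumes "X \<in> vfields"
  shows "smooth_SU3 (coords X)"
proof -
  have s: "smooth_SU3 (\<lambda>a. (ctranspose a ** vproj (X (coset a)) j ** a) $ k $ l)" for j k l
    by (intro smooth_SU3_linear_compose[OF nth_nth_bounded_linear]
        smooth_SU3_bilinear[OF matrix_mult_bounded_bilinear] smooth_SU3_vproj assms
        smooth_SU3_smooth[OF smooth_linear] ctranspose_bounded_linear bounded_linear_ident)
  have "smooth_SU3 (\<lambda>a. coords X a $ i)" for i
    using exhaust_3[of i] s smooth_SU3_minus[OF s] by (auto simp: coords_def tvec_coords_def)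
  then show ?thesis by (rule smooth_SU3_vec)
qed

lemma vfieldI:
  assumes "smooth_SU3 \<xi>" "\<And>a. a \<in> SU3 \<Longrightarrow> X (coset a) = tvec_of a (\<xi> a)" "\<And>p. p \<notin> flagM \<Longrightarrow> X p = 0"
  shows "X \<in> vfields"
proof -
  have "X p \<in> tangent p" if "p \<in> flagM" for p
    using that assms(2) by (auto simp: flagM_def tvec_of_tangent)
  moreover have "(\<lambda>p. X p F) \<in> smooth_fun" if F: "F \<in> smooth_fun" for F
  proof -
    have "smooth_SU3 (\<lambda>a. lderiv (\<lambda>b. F (coset b)) a (\<xi> a))"
      using F assms(1) by (simp add: smooth_fun_iff smooth_SU3_lderiv)
    then show ?thesis
      unfolding smooth_fun_iff
      by (subst smooth_SU3_cong[of _ "\<lambda>a. lderiv (\<lambda>b. F (coset b)) a (\<xi> a)"]) (simp_all add: assms(2) tvec_of_def F)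
  qed
  ultimately show ?thesis using assms(3) by (simp add: vfields_def)
qed

lemma vfield_eqI:
  assumes "X \<in> vfields" "Y \<in> vfields" "\<And>a. a \<in> SU3 \<Longrightarrow> coords X a = coords Y a"
  shows "X = Y"
proof
  fix p
  show "X p = Y p"
  proof (cases "p \<in> flagM")
    case True
    then obtain a where "a \<in> SU3" "p = coset a" by (auto simp: flagM_def)
    then show ?thesis using assms vfield_tvec_of by metis
  qed (simp add: assms vfield_outside)
qed

text \<open>By \<open>tvec_of_mult_Tmax\<close>, this says that the tangent vector
  \<open>tvec_of a (\<xi> a)\<close> depends only on the coset of a.\<close>

definition equivariant :: "(mat3 \<Rightarrow> complex^3) \<Rightarrow> bool" where
  "equivariant \<xi> \<longleftrightarrow> (\<forall>a\<in>SU3. \<forall>k\<in>Tmax. \<xi> (a ** k) = Ad (ctranspose k) (\<xi> a))"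

lemma coords_equivariant:
  assumes X: "X \<in> vfields"
  shows "equivariant (coords X)"
  unfolding equivariant_def
proof (intro ballI)
  fix a k assume a: "a \<in> SU3" and k: "k \<in> Tmax"
  have "tvec_of a (Ad k (coords X (a ** k))) = X (coset a)"
    using vfield_tvec_of[OF X SU3_mult[OF a Tmax_SU3[OF k]]]
    by (simp add: tvec_of_mult_Tmax a k coset_mult_Tmax)
  then have "Ad k (coords X (a ** k)) = coords X a"
    using coords_eqI[OF a] by metis
  then show "coords X (a ** k) = Ad (ctranspose k) (coords X a)"
    using Ad_ctranspose_Ad[OF k] by metis
qed

text \<open>The representatives are chosen arbitrarily; for equivariant \<xi> the result does not
  depend on them, so smoothness of \<xi> alone decides that of the field.\<close>

definition vfield_of :: "(mat3 \<Rightarrow> complex^3) \<Rightarrow> vfield" where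
  "vfield_of \<xi> p = (if p \<in> flagM then tvec_of (representative p) (\<xi> (representative p)) else 0)"

lemma vfield_of_coset:
  assumes "equivariant \<xi>" "a \<in> SU3"
  shows "vfield_of \<xi> (coset a) = tvec_of a (\<xi> a)"
proof -
  obtain k where k: "k \<in> Tmax" "representative (coset a) = a ** k"
    using coset_eqD[of a "representative (coset a)"] representative_flagM(2)[OF coset_flagM[OF assms(2)]] by auto
  have "vfield_of \<xi> (coset a) = tvec_of a (Ad k (Ad (ctranspose k) (\<xi> a)))"
    using assms k by (simp add: vfield_of_def coset_flagM tvec_of_mult_Tmax equivariant_def)
  then show ?thesis
    using Ad_ctranspose_Ad[OF ctranspose_Tmax[OF k(1)]] by simp
qed

lemma vfield_of_vfield:
  assumes "equivariant \<xi>" "smooth_SU3 \<xi>"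
  shows "vfield_of \<xi> \<in> vfields"
  by (rule vfieldI[OF assms(2) vfield_of_coset[OF assms(1)]]) (simp_all add: vfield_of_def zero_fun_def)

lemma coords_vfield_of: "equivariant \<xi> \<Longrightarrow> a \<in> SU3 \<Longrightarrow> coords (vfield_of \<xi>) a = \<xi> a"
  by (simp add: coords_eqI vfield_of_coset)

section \<open>Operations on vector fields in coordinates\<close>

lemma coords_plus:
  assumes "X \<in> vfields" "Y \<in> vfields" "a \<in> SU3"
  shows "coords (X + Y) a = coords X a + coords Y a"
  by (rule coords_eqI) (simp_all add: assms vfield_tvec_of tvec_of_add plus_fun_def)

lemma vfield_plus:
  assumes "X \<in> vfields" "Y \<in> vfields"
  shows "X + Y \<in> vfields"
  by (rule vfieldI[where \<xi> = "\<lambda>a. coords X a + coords Y a"])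
    (use assms in \<open>simp_all add: vfield_tvec_of tvec_of_add vfield_outside zero_fun_def plus_fun_def smooth_SU3_add smooth_SU3_coords\<close>)

lemma coords_minus:
  assumes "X \<in> vfields" "Y \<in> vfields" "a \<in> SU3"
  shows "coords (X - Y) a = coords X a - coords Y a"
  by (rule coords_eqI) (simp_all add: assms vfield_tvec_of tvec_of_diff)

lemma vfield_minus:
  assumes "X \<in> vfields" "Y \<in> vfields"
  shows "X - Y \<in> vfields"
  by (rule vfieldI[where \<xi> = "\<lambda>a. coords X a - coords Y a"])
    (use assms in \<open>simp_all add: vfield_tvec_of tvec_of_diff vfield_outside smooth_SU3_diff smooth_SU3_coords\<close>)

lemma coords_smul:
  assumes "X \<in> vfields" "a \<in> SU3"
  shows "coords (smul F X) a = F (coset a) *\<^sub>R coords X a"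
  by (rule coords_eqI) (simp_all add: assms vfield_tvec_of tvec_of_scaleR smul_def)

lemma vfield_smul:
  assumes "X \<in> vfields" "F \<in> smooth_fun"
  shows "smul F X \<in> vfields"
proof (rule vfieldI[where \<xi> = "\<lambda>a. F (coset a) *\<^sub>R coords X a"])
  show "smooth_SU3 (\<lambda>a. F (coset a) *\<^sub>R coords X a)"
    by (intro smooth_SU3_bilinear[OF bounded_bilinear_scaleR] smooth_SU3_coords assms) (use assms in \<open>simp add: smooth_fun_iff\<close>)
  show "smul F X p = 0" if "p \<notin> flagM" for p
    using that assms by (simp add: smul_def vfield_outside scal_def fun_eq_iff)
qed (simp add: assms vfield_tvec_of tvec_of_scaleR smul_def)

lemma vfield_apply:
  assumes "X \<in> vfields" "F \<in> smooth_fun" "a \<in> SU3"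
  shows "X (coset a) F = lderiv (\<lambda>b. F (coset b)) a (coords X a)"
  by (simp add: vfield_tvec_of assms tvec_of_def)

lemma vfield_apply_smooth: "X \<in> vfields \<Longrightarrow> F \<in> smooth_fun \<Longrightarrow> (\<lambda>p. X p F) \<in> smooth_fun"
  by (simp add: vfields_def)

lemma vfield_apply_nonsmooth:
  assumes "X \<in> vfields" "F \<notin> smooth_fun"
  shows "X p F = 0"
proof (cases "p \<in> flagM")
  case True
  then obtain a where "a \<in> SU3" "p = coset a" by (auto simp: flagM_def)
  then show ?thesis using assms by (simp add: vfield_tvec_of tvec_of_def)
qed (simp add: assms vfield_outside)

text \<open>For a non-smooth F the inner functions in \<open>lie_bracket\<close> are constantly 0.
  With this lemma the bracket vanishes on F, as tangent vectors do.\<close>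

lemma vfield_apply_zero:
  assumes "X \<in> vfields"
  shows "X p (\<lambda>q. 0) = 0"
proof (cases "p \<in> flagM")
  case True
  then obtain a where "a \<in> SU3" "p = coset a" by (auto simp: flagM_def)
  then show ?thesis using assms by (simp add: vfield_tvec_of tvec_of_def)
qed (simp add: assms vfield_outside)

lemma lie_bracket_coset:
  assumes X: "X \<in> vfields" and Y: "Y \<in> vfields" and a: "a \<in> SU3"
  shows "lie_bracket X Y (coset a) =
    tvec_of a (lderiv (coords Y) a (coords X a) - lderiv (coords X) a (coords Y a) + bracket_m (coords X a) (coords Y a))"
proof
  fix F
  show "lie_bracket X Y (coset a) F =
    tvec_of a (lderiv (coords Y) a (coords X a) - lderiv (coords X) a (coords Y a) + bracket_m (coords X a) (coords Y a)) F"
  proof (cases "F \<in> smooth_fun")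
    case True
    have *: "lderiv (\<lambda>b. Z (coset b) F) a x = lderiv (\<lambda>b. lderiv (\<lambda>b. F (coset b)) b (coords Z b)) a x"
      if "Z \<in> vfields" for Z x
      using that a True by (intro lderiv_cong vfield_apply)
    show ?thesis
      using lderiv_commutator[of "\<lambda>b. F (coset b)" "coords X" "coords Y" a] True X Y a
      by (simp add: lie_bracket_def vfield_apply vfield_apply_smooth * smooth_fun_iff
          smooth_SU3_coords coset_mult_Tmax tvec_of_def)
        (simp flip: smooth_fun_iff add: vfield_apply vfield_apply_smooth *)
  next
    case False
    then show ?thesis
      using X Y by (simp add: lie_bracket_def vfield_apply_nonsmooth vfield_apply_zero tvec_of_def)
  qed
qed

lemma coords_lie_bracket:
  assumes "X \<in> vfields" "Y \<in> vfields" "a \<in> SU3"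
  shows "coords (lie_bracket X Y) a = lderiv (coords Y) a (coords X a) - lderiv (coords X) a (coords Y a) + bracket_m (coords X a) (coords Y a)"
  using lie_bracket_coset[OF assms] by (rule coords_eqI[OF assms(3)])

lemma bracket_m_bounded_bilinear: "bounded_bilinear bracket_m"
  unfolding bilinear_conv_bounded_bilinear[symmetric] bilinear_def
  by (auto intro!: linearI simp: vec_eq_iff forall_3 bracket_m_def algebra_simps)

lemma vfield_lie_bracket:
  assumes "X \<in> vfields" "Y \<in> vfields"
  shows "lie_bracket X Y \<in> vfields"
proof (rule vfieldI[OF _ lie_bracket_coset[OF assms]])
  show "smooth_SU3 (\<lambda>a. lderiv (coords Y) a (coords X a) - lderiv (coords X) a (coords Y a) + bracket_m (coords X a) (coords Y a))"
    by (intro smooth_SU3_add smooth_SU3_diff smooth_SU3_lderiv smooth_SU3_bilinear[OF bracket_m_bounded_bilinear] smooth_SU3_coords assms)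
  show "lie_bracket X Y p = 0" if "p \<notin> flagM" for p
    using that assms by (simp add: lie_bracket_def vfield_outside fun_eq_iff)
qed

section \<open>The Levi-Civita connection of an invariant metric\<close>

definition metric_form :: "real \<Rightarrow> real \<Rightarrow> real \<Rightarrow> complex^3 \<Rightarrow> complex^3 \<Rightarrow> real" where
  "metric_form l1 l2 l3 x y = l1 * Re (x$1 * cnj (y$1)) + l2 * Re (x$2 * cnj (y$2)) + l3 * Re (x$3 * cnj (y$3))"

text \<open>Nomizu's bilinear map of the invariant metric: it sends a pair from the \<open>j\<close>-th and \<open>k\<close>-th
  summands to \<open>(\<lambda>\<^sub>l + \<lambda>\<^sub>k - \<lambda>\<^sub>j) / (2 \<lambda>\<^sub>l)\<close> times its bracket, \<open>l\<close> being the third index.\<close>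

definition nomizu :: "real \<Rightarrow> real \<Rightarrow> real \<Rightarrow> complex^3 \<Rightarrow> complex^3 \<Rightarrow> complex^3" where
  "nomizu l1 l2 l3 x y = vector
    [((l1 + l3 - l2) / (2 * l1)) *\<^sub>R cnj (x$2 * y$3) - ((l1 + l2 - l3) / (2 * l1)) *\<^sub>R cnj (x$3 * y$2),
     ((l2 + l1 - l3) / (2 * l2)) *\<^sub>R cnj (x$3 * y$1) - ((l2 + l3 - l1) / (2 * l2)) *\<^sub>R cnj (x$1 * y$3),
     ((l3 + l2 - l1) / (2 * l3)) *\<^sub>R cnj (x$1 * y$2) - ((l3 + l1 - l2) / (2 * l3)) *\<^sub>R cnj (x$2 * y$1)]"

lemma metric_form_bounded_bilinear: "bounded_bilinear (metric_form l1 l2 l3)"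
  unfolding bilinear_conv_bounded_bilinear[symmetric] bilinear_def
  by (auto intro!: linearI simp: metric_form_def algebra_simps)

lemma nomizu_bounded_bilinear: "bounded_bilinear (nomizu l1 l2 l3)"
  unfolding bilinear_conv_bounded_bilinear[symmetric] bilinear_def
  by (auto intro!: linearI simp: vec_eq_iff forall_3 nomizu_def algebra_simps)

text \<open>For each target index the two coefficients in \<open>nomizu\<close> add up to 1, and
  antisymmetrising collects them on each product.\<close>

lemma nomizu_torsion:
  assumes "l1 > 0" "l2 > 0" "l3 > 0"
  shows "nomizu l1 l2 l3 x y - nomizu l1 l2 l3 y x = bracket_m x y"
proof -
  have *: "((a + c - b) / (2 * a)) *\<^sub>R z - ((a + b - c) / (2 * a)) *\<^sub>R w -
      (((a + c - b) / (2 * a)) *\<^sub>R w - ((a + b - c) / (2 * a)) *\<^sub>R z) = z - w"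
    if "a > 0" for a b c :: real and z w :: complex
  proof -
    have "(a + c - b) / (2 * a) + (a + b - c) / (2 * a) = 1"
      using that by (simp add: field_simps)
    then have "((a + c - b) / (2 * a)) *\<^sub>R v + ((a + b - c) / (2 * a)) *\<^sub>R v = v" for v :: complex
      by (metis scaleR_left_distrib scaleR_one)
    from this[of z] this[of w] show ?thesis by (simp add: algebra_simps)
  qed
  show ?thesis
    using *[OF assms(1), of l3 l2 "cnj (x$2 * y$3)" "cnj (x$3 * y$2)"]
      *[OF assms(2), of l1 l3 "cnj (x$3 * y$1)" "cnj (x$1 * y$3)"]
      *[OF assms(3), of l2 l1 "cnj (x$1 * y$2)" "cnj (x$2 * y$1)"]
    by (simp add: vec_eq_iff forall_3 nomizu_def bracket_m_def mult.commute)
qed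

text \<open>Multiplication by the metric constant of the target l clears its denominator. The term
  in x_j, y_k, z_l then has the coefficient \<open>(\<lambda>\<^sub>l + \<lambda>\<^sub>k -
  \<lambda>\<^sub>j) / 2\<close>, symmetric in k and l, while the sign of the cross product
  alternates; so the terms cancel in pairs.\<close>

lemma nomizu_skew:
  assumes "l1 > 0" "l2 > 0" "l3 > 0"
  shows "metric_form l1 l2 l3 (nomizu l1 l2 l3 x y) z + metric_form l1 l2 l3 y (nomizu l1 l2 l3 x z) = 0"
proof -
  have *: "a * Re ((((a + c - b) / (2 * a)) *\<^sub>R w - ((a + b - c) / (2 * a)) *\<^sub>R w') * cnj u) =
      (a + c - b) / 2 * Re (w * cnj u) - (a + b - c) / 2 * Re (w' * cnj u)"
    "a * Re (u * cnj (((a + c - b) / (2 * a)) *\<^sub>R w - ((a + b - c) / (2 * a)) *\<^sub>R w')) =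
      (a + c - b) / 2 * Re (u * cnj w) - (a + b - c) / 2 * Re (u * cnj w')"
    if "a > 0" for a b c :: real and u w w' :: complex
    using that by (simp_all add: field_simps)
  show ?thesis
    by (simp only: metric_form_def nomizu_def vector_3 * assms) (simp add: algebra_simps)
qed

text \<open>The torus multiplies the three coordinates by phases with product 1, so the conjugate of
  the product of two of them is the third.\<close>

lemma nomizu_Ad:
  assumes "k \<in> Tmax"
  shows "nomizu l1 l2 l3 (Ad k x) (Ad k y) = Ad k (nomizu l1 l2 l3 x y)"
proof -
  obtain u v w where k: "k = diag3 u v w" "u * cnj u = 1" "v * cnj v = 1" "w * cnj w = 1"
    using assms by (rule TmaxE)
  have *: "cnj ((p * s * cnj q) * (q * t * cnj r)) = r * cnj (s * t) * cnj p"
    "cnj ((q * t * cnj r) * (p * s * cnj q)) = r * cnj (t * s) * cnj p"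
    if "q * cnj q = 1" for p q r s t :: complex
  proof -
    have "cnj ((p * s * cnj q) * (q * t * cnj r)) = r * cnj (s * t) * cnj p * (q * cnj q)"
      "cnj ((q * t * cnj r) * (p * s * cnj q)) = r * cnj (t * s) * cnj p * (q * cnj q)"
      by (simp_all add: mult_ac)
    then show "cnj ((p * s * cnj q) * (q * t * cnj r)) = r * cnj (s * t) * cnj p"
      "cnj ((q * t * cnj r) * (p * s * cnj q)) = r * cnj (t * s) * cnj p"
      by (simp_all only: that mult_1_right)
  qed
  show ?thesis
    by (simp only: k Ad_diag3 nomizu_def vector_3 *[OF k(2)] *[OF k(3)] *[OF k(4)])
      (simp add: algebra_simps)
qed

definition nabla :: "real \<Rightarrow> real \<Rightarrow> real \<Rightarrow> vfield \<Rightarrow> vfield \<Rightarrow> vfield" where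
  "nabla l1 l2 l3 X Y = vfield_of (\<lambda>a. lderiv (coords Y) a (coords X a) + nomizu l1 l2 l3 (coords X a) (coords Y a))"

text \<open>The equivariance relation can be differentiated since \<open>Ad\<close> of a fixed k is
  linear; the direction changes with the right translation.\<close>

lemma lderiv_equivariant:
  assumes \<eta>: "smooth_SU3 \<eta>" "equivariant \<eta>" and a: "a \<in> SU3" and k: "k \<in> Tmax"
  shows "lderiv \<eta> (a ** k) (Ad (ctranspose k) x) = Ad (ctranspose k) (lderiv \<eta> a x)"
proof -
  have "lderiv \<eta> (a ** k) (Ad (ctranspose k) x) = lderiv (\<lambda>b. \<eta> (b ** k)) a (Ad k (Ad (ctranspose k) x))"
    using lderiv_translate_right[OF \<eta>(1) a k] by simp
  also have "\<dots> = lderiv (\<lambda>b. \<eta> (b ** k)) a x"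
    using Ad_ctranspose_Ad[OF ctranspose_Tmax[OF k]] by simp
  also have "\<dots> = lderiv (\<lambda>b. Ad (ctranspose k) (\<eta> b)) a x"
    using \<eta>(2) k by (intro lderiv_cong[OF _ a]) (auto simp: equivariant_def)
  also have "\<dots> = Ad (ctranspose k) (lderiv \<eta> a x)"
    by (rule lderiv_linear_compose[OF Ad_bounded_linear \<eta>(1) a])
  finally show ?thesis .
qed

lemma nabla_equivariant:
  assumes "X \<in> vfields" "Y \<in> vfields"
  shows "equivariant (\<lambda>a. lderiv (coords Y) a (coords X a) + nomizu l1 l2 l3 (coords X a) (coords Y a))"
proof -
  note l = linear_add[OF bounded_linear.linear[OF Ad_bounded_linear]]
  show ?thesis
    using assms coords_equivariant[OF assms(1)] coords_equivariant[OF assms(2)]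
    by (simp add: equivariant_def lderiv_equivariant smooth_SU3_coords l nomizu_Ad ctranspose_Tmax)
qed

lemma vfield_nabla:
  assumes "X \<in> vfields" "Y \<in> vfields"
  shows "nabla l1 l2 l3 X Y \<in> vfields"
  unfolding nabla_def
  by (intro vfield_of_vfield nabla_equivariant smooth_SU3_add smooth_SU3_lderiv smooth_SU3_bilinear[OF nomizu_bounded_bilinear] smooth_SU3_coords assms)

lemma coords_nabla:
  assumes "X \<in> vfields" "Y \<in> vfields" "a \<in> SU3"
  shows "coords (nabla l1 l2 l3 X Y) a = lderiv (coords Y) a (coords X a) + nomizu l1 l2 l3 (coords X a) (coords Y a)"
  unfolding nabla_def by (rule coords_vfield_of[OF nabla_equivariant[OF assms(1,2)] assms(3)])

text \<open>The group permutes the frames a by left translation, so an invariant metric has one and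
  the same matrix in all of them.\<close>

definition represents :: "metric \<Rightarrow> real \<Rightarrow> real \<Rightarrow> real \<Rightarrow> bool" where
  "represents g l1 l2 l3 \<longleftrightarrow> 0 < l1 \<and> 0 < l2 \<and> 0 < l3 \<and>
    (\<forall>a\<in>SU3. \<forall>x y. g (coset a) (tvec_of a x) (tvec_of a y) = metric_form l1 l2 l3 x y)"

lemma represents_coords:
  "represents g l1 l2 l3 \<Longrightarrow> X \<in> vfields \<Longrightarrow> Y \<in> vfields \<Longrightarrow> a \<in> SU3 \<Longrightarrow>
    g (coset a) (X (coset a)) (Y (coset a)) = metric_form l1 l2 l3 (coords X a) (coords Y a)"
  by (simp add: represents_def vfield_tvec_of)

text \<open>Vanishing torsion comes from the formula for the bracket and
  \<open>nomizu_torsion\<close>, compatibility with the metric from the product rule and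
  \<open>nomizu_skew\<close>.\<close>

lemma levi_civita_nabla:
  assumes g: "represents g l1 l2 l3"
  shows "levi_civita g (nabla l1 l2 l3)"
proof -
  have l: "l1 > 0" "l2 > 0" "l3 > 0" using g by (simp_all add: represents_def)
  note bl = nomizu_bounded_bilinear[of l1 l2 l3]
  note LL = bounded_bilinear.add_left[OF bl] bounded_bilinear.add_right[OF bl]
    bounded_bilinear.scaleR_left[OF bl] bounded_bilinear.scaleR_right[OF bl]
  note V = vfield_nabla vfield_plus vfield_minus vfield_smul vfield_lie_bracket vfield_apply_smooth
  note dl = linear_add[OF linear_lderiv] linear_scale[OF linear_lderiv]
  have dp: "lderiv (coords (X + Y)) a x = lderiv (coords X) a x + lderiv (coords Y) a x"
    if "X \<in> vfields" "Y \<in> vfields" "a \<in> SU3" for X Y a x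
    using lderiv_cong[OF coords_plus[OF that(1,2)] that(3)] that by (simp add: lderiv_add smooth_SU3_coords)
  have ds: "lderiv (coords (smul F X)) a x = F (coset a) *\<^sub>R lderiv (coords X) a x + lderiv (\<lambda>b. F (coset b)) a x *\<^sub>R coords X a"
    if "X \<in> vfields" "F \<in> smooth_fun" "a \<in> SU3" for X F a x
    using lderiv_cong[OF coords_smul[OF that(1)] that(3)] that
    by (simp add: lderiv_bilinear[OF bounded_bilinear_scaleR] smooth_SU3_coords smooth_fun_iff)
  have add: "nabla l1 l2 l3 (X + Y) Z = nabla l1 l2 l3 X Z + nabla l1 l2 l3 Y Z"
    "nabla l1 l2 l3 X (Y + Z) = nabla l1 l2 l3 X Y + nabla l1 l2 l3 X Z"
    if "X \<in> vfields" "Y \<in> vfields" "Z \<in> vfields" for X Y Z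
    by (rule vfield_eqI; simp add: that V coords_nabla coords_plus LL dp dl smooth_SU3_coords)+
  have smul: "nabla l1 l2 l3 (smul F X) Y = smul F (nabla l1 l2 l3 X Y)"
    "nabla l1 l2 l3 X (smul F Y) = smul (\<lambda>p. X p F) Y + smul F (nabla l1 l2 l3 X Y)"
    if "F \<in> smooth_fun" "X \<in> vfields" "Y \<in> vfields" for F X Y
    by (rule vfield_eqI; simp add: that V coords_nabla coords_plus coords_smul vfield_apply LL ds dl smooth_SU3_coords algebra_simps)+
  have torsion: "nabla l1 l2 l3 X Y - nabla l1 l2 l3 Y X = lie_bracket X Y"
    if "X \<in> vfields" "Y \<in> vfields" for X Y
    by (rule vfield_eqI)
      (simp_all add: that V coords_nabla coords_minus coords_lie_bracket nomizu_torsion[OF l, symmetric] algebra_simps)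
  have metric: "X p (\<lambda>q. g q (Y q) (Z q)) =
      g p (nabla l1 l2 l3 X Y p) (Z p) + g p (Y p) (nabla l1 l2 l3 X Z p)"
    if "X \<in> vfields" "Y \<in> vfields" "Z \<in> vfields" and p: "p \<in> flagM" for X Y Z p
  proof -
    obtain a where a: "a \<in> SU3" "p = coset a" using p by (auto simp: flagM_def)
    note bq = metric_form_bounded_bilinear[of l1 l2 l3]
    have q: "g (coset b) (Y (coset b)) (Z (coset b)) = metric_form l1 l2 l3 (coords Y b) (coords Z b)" if "b \<in> SU3" for b
      using represents_coords[OF g] that \<open>Y \<in> vfields\<close> \<open>Z \<in> vfields\<close> by blast
    have s: "(\<lambda>q. g q (Y q) (Z q)) \<in> smooth_fun"
      unfolding smooth_fun_iff
      by (subst smooth_SU3_cong[OF q]) (auto intro!: smooth_SU3_bilinear[OF bq] smooth_SU3_coords that)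
    have "X p (\<lambda>q. g q (Y q) (Z q)) = lderiv (\<lambda>b. metric_form l1 l2 l3 (coords Y b) (coords Z b)) a (coords X a)"
      using vfield_apply[OF that(1) s a(1)] lderiv_cong[OF q a(1)] by (simp add: a(2))
    also have "\<dots> = metric_form l1 l2 l3 (coords Y a) (lderiv (coords Z) a (coords X a)) + metric_form l1 l2 l3 (lderiv (coords Y) a (coords X a)) (coords Z a)"
      by (intro lderiv_bilinear[OF bq] smooth_SU3_coords that a)
    also have "\<dots> = metric_form l1 l2 l3 (coords (nabla l1 l2 l3 X Y) a) (coords Z a) + metric_form l1 l2 l3 (coords Y a) (coords (nabla l1 l2 l3 X Z) a)"
      using nomizu_skew[OF l, of "coords X a" "coords Y a" "coords Z a"]
      by (simp add: coords_nabla that a bounded_bilinear.add_left[OF bq] bounded_bilinear.add_right[OF bq])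
    finally show ?thesis
      using represents_coords[OF g vfield_nabla[OF that(1,2)] that(3) a(1)]
        represents_coords[OF g that(2) vfield_nabla[OF that(1,3)] a(1)] by (simp add: a(2))
  qed
  show ?thesis
    unfolding levi_civita_def by (intro conjI ballI vfield_nabla add smul torsion metric)
qed

lemma metric_form_self:
  "metric_form l1 l2 l3 x x = l1 * (cmod (x $ 1))\<^sup>2 + l2 * (cmod (x $ 2))\<^sup>2 + l3 * (cmod (x $ 3))\<^sup>2"
  by (simp add: metric_form_def cmod_power2 flip: power2_eq_square)

lemma levi_civita_metric:
  assumes "levi_civita g D" "X \<in> vfields" "Y \<in> vfields" "Z \<in> vfields" "p \<in> flagM"
  shows "X p (\<lambda>q. g q (Y q) (Z q)) = g p (D X Y p) (Z p) + g p (Y p) (D X Z p)"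
  using assms unfolding levi_civita_def by blast

text \<open>The difference S of two such connections is symmetric in its arguments and skew for the
  metric, and a trilinear form symmetric in the first two and skew in the last two arguments
  vanishes. Testing it on the field \<open>S X Y\<close> itself gives a sum of squares.\<close>

lemma levi_civita_unique:
  assumes g: "represents g l1 l2 l3" and D: "levi_civita g D" "levi_civita g D'"
    and X: "X \<in> vfields" and Y: "Y \<in> vfields"
  shows "D X Y = D' X Y"
proof -
  define S where "S X Y = D X Y - D' X Y" for X Y
  have cl: "S X Y \<in> vfields" if "X \<in> vfields" "Y \<in> vfields" for X Y
    unfolding S_def using D that by (intro vfield_minus) (simp_all add: levi_civita_def)
  define s where "s X Y Z a = metric_form l1 l2 l3 (coords (S X Y) a) (coords Z a)" for X Y Z a
  note q = metric_form_bounded_bilinear[of l1 l2 l3]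
  have comm: "metric_form l1 l2 l3 x y = metric_form l1 l2 l3 y x" for x y by (simp add: metric_form_def algebra_simps)
  have sym: "S X Y = S Y X" if "X \<in> vfields" "Y \<in> vfields" for X Y
  proof -
    have "D X Y - D Y X = D' X Y - D' Y X" using D that by (simp add: levi_civita_def)
    then show ?thesis by (simp add: S_def fun_eq_iff algebra_simps)
  qed
  have skew: "s X Y Z a = - s X Z Y a"
    if V: "X \<in> vfields" "Y \<in> vfields" "Z \<in> vfields" and a: "a \<in> SU3" for X Y Z a
  proof -
    let ?L = "metric_form l1 l2 l3"
    have c: "D X Y \<in> vfields" "D X Z \<in> vfields" "D' X Y \<in> vfields" "D' X Z \<in> vfields"
      using D V by (simp_all add: levi_civita_def)
    have "?L (coords (D X Y) a) (coords Z a) + ?L (coords Y a) (coords (D X Z) a) =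
        X (coset a) (\<lambda>q. g q (Y q) (Z q))"
      unfolding represents_coords[OF g c(1) V(3) a, symmetric] represents_coords[OF g V(2) c(2) a, symmetric]
      by (rule levi_civita_metric[OF D(1) V coset_flagM[OF a], symmetric])
    moreover have "?L (coords (D' X Y) a) (coords Z a) + ?L (coords Y a) (coords (D' X Z) a) =
        X (coset a) (\<lambda>q. g q (Y q) (Z q))"
      unfolding represents_coords[OF g c(3) V(3) a, symmetric] represents_coords[OF g V(2) c(4) a, symmetric]
      by (rule levi_civita_metric[OF D(2) V coset_flagM[OF a], symmetric])
    ultimately show ?thesis
      by (simp add: s_def S_def coords_minus c a bounded_bilinear.diff_left[OF q] comm[of "coords Y a"])
  qed
  have "coords (S X Y) a = 0" if a: "a \<in> SU3" for a
  proof -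
    have "s X Y Z a = 0" if Z: "Z \<in> vfields" for Z
    proof -
      \<comment> \<open>Two skew exchanges with a symmetric one between them swap the outer
        arguments; starting with the symmetric one gives the opposite sign.\<close>
      have "s X Y Z a = s Z Y X a"
        using skew[OF X Y Z a] skew[OF Z X Y a] sym[OF X Z] unfolding s_def by simp
      also have "\<dots> = - s X Y Z a"
        using skew[OF Y Z X a] sym[OF Y Z] sym[OF X Y] unfolding s_def by simp
      finally show ?thesis by simp
    qed
    from this[OF cl[OF X Y]]
    have "l1 * (cmod (coords (S X Y) a $ 1))\<^sup>2 + l2 * (cmod (coords (S X Y) a $ 2))\<^sup>2 +
        l3 * (cmod (coords (S X Y) a $ 3))\<^sup>2 = 0"
      by (simp add: s_def metric_form_self)
    moreover have "0 < l1" "0 < l2" "0 < l3" using g by (simp_all add: represents_def)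
    ultimately show ?thesis
      by (simp add: vec_eq_iff forall_3 add_nonneg_eq_0_iff)
  qed
  then have "coords (D X Y) a = coords (D' X Y) a" if "a \<in> SU3" for a
    using D X Y that by (simp add: S_def coords_minus levi_civita_def)
  then show ?thesis
    using D X Y by (intro vfield_eqI) (simp_all add: levi_civita_def)
qed

section \<open>Invariant metrics and f-structures in coordinates\<close>

lemma represents_riemannian_metric:
  assumes "represents g l1 l2 l3"
  shows "riemannian_metric g"
proof -
  have l: "0 < l1" "0 < l2" "0 < l3" using assms by (simp_all add: represents_def)
  note q = metric_form_bounded_bilinear[of l1 l2 l3]
  have pos: "0 < metric_form l1 l2 l3 x x" if "x \<noteq> 0" for x
  proof -
    have eq: "metric_form l1 l2 l3 x x = l1 * (cmod (x $ 1))\<^sup>2 + l2 * (cmod (x $ 2))\<^sup>2 + l3 * (cmod (x $ 3))\<^sup>2"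
      by (rule metric_form_self)
    have "0 \<le> metric_form l1 l2 l3 x x" unfolding eq using l by (intro add_nonneg_nonneg) simp_all
    moreover have "metric_form l1 l2 l3 x x \<noteq> 0"
      unfolding eq using l that by (auto simp: add_nonneg_eq_0_iff vec_eq_iff forall_3)
    ultimately show ?thesis by simp
  qed
  have pointwise: "g p (u + v) w = g p u w + g p v w \<and> g p (scal c v) w = c * g p v w \<and>
        g p v w = g p w v \<and> (v \<noteq> 0 \<longrightarrow> 0 < g p v v)"
    if p: "p \<in> flagM" and t: "u \<in> tangent p" "v \<in> tangent p" "w \<in> tangent p" for p u v w c
  proof -
    obtain a where a: "a \<in> SU3" "p = coset a" using p by (auto simp: flagM_def)
    obtain x y z where xyz: "u = tvec_of a x" "v = tvec_of a y" "w = tvec_of a z"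
      using t by (auto simp: a tangent_coset)
    have gQ: "g p (tvec_of a x) (tvec_of a y) = metric_form l1 l2 l3 x y" for x y
      using assms a by (simp add: represents_def)
    have s: "u + v = tvec_of a (x + y)" "scal c v = tvec_of a (c *\<^sub>R y)"
      by (simp_all only: xyz tvec_of_add[OF a(1)] tvec_of_scaleR[OF a(1)])
    show ?thesis
    proof (intro conjI impI)
      show "g p (u + v) w = g p u w + g p v w"
        unfolding s unfolding xyz gQ by (rule bounded_bilinear.add_left[OF q])
      show "g p (scal c v) w = c * g p v w"
        unfolding s unfolding xyz gQ using bounded_bilinear.scaleR_left[OF q] by simp
      show "g p v w = g p w v"
        unfolding xyz gQ by (simp add: metric_form_def algebra_simps)
      show "0 < g p v v" if "v \<noteq> 0"
        using that pos unfolding xyz gQ tvec_of_eq_0_iff[OF a(1)] by blast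
    qed
  qed
  have smooth: "(\<lambda>p. g p (X p) (Y p)) \<in> smooth_fun" if "X \<in> vfields" "Y \<in> vfields" for X Y
    unfolding smooth_fun_iff
    using smooth_SU3_bilinear[OF q smooth_SU3_coords[OF that(1)] smooth_SU3_coords[OF that(2)]]
      smooth_SU3_cong[of "\<lambda>a. g (coset a) (X (coset a)) (Y (coset a))", OF represents_coords[OF assms that]] by blast
  show ?thesis
    unfolding riemannian_metric_def
    by (rule conjI; intro ballI allI; rule pointwise smooth; assumption)
qed

lemma represents_invariant_metric:
  assumes "represents g l1 l2 l3"
  shows "invariant_metric g"
proof -
  have "g (act a p) (dact a v) (dact a w) = g p v w"
    if a: "a \<in> SU3" and p: "p \<in> flagM" and t: "v \<in> tangent p" "w \<in> tangent p" for a p v w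
  proof -
    obtain b where b: "b \<in> SU3" "p = coset b" using p by (auto simp: flagM_def)
    obtain x y where "v = tvec_of b x" "w = tvec_of b y" using t by (auto simp: b tangent_coset)
    then show ?thesis
      using assms a b by (simp add: represents_def dact_tvec_of act_coset SU3_mult)
  qed
  then show ?thesis using represents_riemannian_metric[OF assms] by (simp add: invariant_metric_def)
qed

definition f_endo :: "int \<Rightarrow> int \<Rightarrow> int \<Rightarrow> complex^3 \<Rightarrow> complex^3" where
  "f_endo z1 z2 z3 x = vector [of_int z1 * \<i> * x$1, of_int z2 * \<i> * x$2, of_int z3 * \<i> * x$3]"

lemma f_endo_bounded_linear: "bounded_linear (f_endo z1 z2 z3)"
  unfolding linear_conv_bounded_linear[symmetric]
  by (rule linearI) (simp_all add: vec_eq_iff forall_3 f_endo_def algebra_simps)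

definition represents_f :: "tensor11 \<Rightarrow> int \<Rightarrow> int \<Rightarrow> int \<Rightarrow> bool" where
  "represents_f f z1 z2 z3 \<longleftrightarrow> {z1, z2, z3} \<subseteq> {-1, 0, 1} \<and>
    (\<forall>a\<in>SU3. \<forall>x. f (coset a) (tvec_of a x) = tvec_of a (f_endo z1 z2 z3 x))"

lemma represents_f_apply:
  "represents_f f z1 z2 z3 \<Longrightarrow> a \<in> SU3 \<Longrightarrow> f (coset a) (tvec_of a x) = tvec_of a (f_endo z1 z2 z3 x)"
  by (simp add: represents_f_def)

lemma tapply_coset:
  assumes "represents_f f z1 z2 z3" "X \<in> vfields" "a \<in> SU3"
  shows "tapply f X (coset a) = tvec_of a (f_endo z1 z2 z3 (coords X a))"
  using assms by (simp add: tapply_def coset_flagM vfield_tvec_of represents_f_apply)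

lemma coords_tapply:
  assumes "represents_f f z1 z2 z3" "X \<in> vfields" "a \<in> SU3"
  shows "coords (tapply f X) a = f_endo z1 z2 z3 (coords X a)"
  using tapply_coset[OF assms] by (rule coords_eqI[OF assms(3)])

lemma vfield_tapply:
  assumes "represents_f f z1 z2 z3" "X \<in> vfields"
  shows "tapply f X \<in> vfields"
  by (rule vfieldI[OF _ tapply_coset[OF assms]])
    (auto simp: tapply_def intro!: smooth_SU3_linear_compose[OF f_endo_bounded_linear] smooth_SU3_coords assms)

lemma f_endo_cubed:
  assumes "{z1, z2, z3} \<subseteq> {-1, 0, 1}"
  shows "f_endo z1 z2 z3 (f_endo z1 z2 z3 (f_endo z1 z2 z3 x)) + f_endo z1 z2 z3 x = 0"
  using assms by (auto simp: vec_eq_iff forall_3 f_endo_def)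

lemma represents_f_structure:
  assumes f: "represents_f f z1 z2 z3"
  shows "invariant_f_structure f"
proof -
  note l = bounded_linear.linear[OF f_endo_bounded_linear[of z1 z2 z3]]
  have "f p v \<in> tangent p \<and> f p (v + w) = f p v + f p w \<and> f p (scal c v) = scal c (f p v)"
    and "f p (f p (f p v)) + f p v = 0"
    if p: "p \<in> flagM" and t: "v \<in> tangent p" "w \<in> tangent p" for p v w c
  proof -
    obtain a where a: "a \<in> SU3" "p = coset a" using p by (auto simp: flagM_def)
    obtain x y where xy: "v = tvec_of a x" "w = tvec_of a y" using t by (auto simp: a tangent_coset)
    show "f p v \<in> tangent p \<and> f p (v + w) = f p v + f p w \<and> f p (scal c v) = scal c (f p v)"
      using represents_f_apply[OF f a(1)]
      by (simp add: xy a tangent_coset linear_add[OF l] linear_scale[OF l] flip: tvec_of_add tvec_of_scaleR)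
    show "f p (f p (f p v)) + f p v = 0"
      using represents_f_apply[OF f a(1)] f
      by (simp add: xy a f_endo_cubed represents_f_def tvec_of_0 flip: tvec_of_add)
  qed
  moreover have "f (act a p) (dact a v) = dact a (f p v)"
    if a: "a \<in> SU3" and p: "p \<in> flagM" and t: "v \<in> tangent p" for a p v
  proof -
    obtain b where b: "b \<in> SU3" "p = coset b" using p by (auto simp: flagM_def)
    obtain x where "v = tvec_of b x" using t by (auto simp: b tangent_coset)
    then show ?thesis
      using represents_f_apply[OF f] a b by (simp add: dact_tvec_of act_coset SU3_mult)
  qed
  ultimately show ?thesis
    unfolding invariant_f_structure_def f_structure_def tensor_field_def
    using vfield_tapply[OF f] by blast
qed

lemma represents_metric_f_structure:
  assumes g: "represents g l1 l2 l3" and f: "represents_f f z1 z2 z3"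
  shows "metric_f_structure g f"
proof -
  have "g p (f p v) w + g p v (f p w) = 0"
    if p: "p \<in> flagM" and t: "v \<in> tangent p" "w \<in> tangent p" for p v w
  proof -
    obtain a where a: "a \<in> SU3" "p = coset a" using p by (auto simp: flagM_def)
    obtain x y where xy: "v = tvec_of a x" "w = tvec_of a y" using t by (auto simp: a tangent_coset)
    have "metric_form l1 l2 l3 (f_endo z1 z2 z3 x) y + metric_form l1 l2 l3 x (f_endo z1 z2 z3 y) = 0"
      by (simp add: metric_form_def f_endo_def algebra_simps)
    then show ?thesis
      using g a by (simp add: xy represents_f_apply[OF f] represents_def)
  qed
  then show ?thesis
    using represents_f_structure[OF f] by (simp add: metric_f_structure_def invariant_f_structure_def)
qed

section \<open>The prescribed metrics and f-structures in coordinates\<close>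

lemma Dmat_Dvec: "Dmat a b c = Dvec (vector [a, b, c])"
  by (simp add: Dvec_def)

lemma dact_dcoset: "h \<in> SU3 \<Longrightarrow> dact h (dcoset (Dmat a b c)) = tvec_of h (vector [a, b, c])"
  by (simp add: Dmat_Dvec dcoset_Dvec dact_tvec_of)

lemma vector3_eta: "vector [x$1, x$2, x$3] = (x :: 'a::zero^3)"
  by (simp add: vec_eq_iff forall_3)

lemma metric_form_Ad:
  assumes "k \<in> Tmax"
  shows "metric_form l1 l2 l3 (Ad k x) (Ad k y) = metric_form l1 l2 l3 x y"
proof -
  obtain u v w where k: "k = diag3 u v w" "u * cnj u = 1" "v * cnj v = 1" "w * cnj w = 1"
    using assms by (rule TmaxE)
  have *: "(p * s * cnj q) * cnj (p * t * cnj q) = s * cnj t"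
    if "p * cnj p = 1" "q * cnj q = 1" for p q s t :: complex
  proof -
    have "(p * s * cnj q) * cnj (p * t * cnj q) = s * cnj t * (p * cnj p) * (q * cnj q)"
      by (simp add: mult_ac)
    then show ?thesis by (simp only: that mult_1_right)
  qed
  show ?thesis
    by (simp only: metric_form_def k Ad_diag3 vector_3 *[OF k(2,3)] *[OF k(3,4)] *[OF k(4,2)])
qed

lemma f_endo_Ad:
  assumes "k \<in> Tmax"
  shows "f_endo z1 z2 z3 (Ad k x) = Ad k (f_endo z1 z2 z3 x)"
proof -
  obtain u v w where k: "k = diag3 u v w" using assms by (rule TmaxE)
  show ?thesis by (simp add: k Ad_diag3 f_endo_def mult_ac)
qed

lemma ip_Dmat: "ip (Dmat a b c) (Dmat a' b' c') = Re (a * cnj a') + Re (b * cnj b') + Re (c * cnj c')"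
  by (simp add: ip_def trace_def sum_3 mat3_mult_nth field_simps)

text \<open>Two admissible choices of h differ by a torus element k. The coordinates then change by
  \<open>Ad k\<close>, which preserves the form, so the described number is unique.\<close>

lemma flag_metric_represents:
  assumes "0 < l1" "0 < l2" "0 < l3"
  shows "represents (flag_metric l1 l2 l3) l1 l2 l3"
proof -
  have "flag_metric l1 l2 l3 (coset a) (tvec_of a x) (tvec_of a y) = metric_form l1 l2 l3 x y" if a: "a \<in> SU3" for a x y
    unfolding flag_metric_def
  proof (rule the_equality)
    show "\<exists>h\<in>SU3. \<exists>b c d b' c' d'. coset a = act h origin \<and>
        tvec_of a x = dact h (dcoset (Dmat b c d)) \<and> tvec_of a y = dact h (dcoset (Dmat b' c' d')) \<and>
        metric_form l1 l2 l3 x y = l1 * ip (Dmat b 0 0) (Dmat b' 0 0) + l2 * ip (Dmat 0 c 0) (Dmat 0 c' 0) +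
          l3 * ip (Dmat 0 0 d) (Dmat 0 0 d')"
      by (rule bexI[OF _ a], rule exI[of _ "x$1"], rule exI[of _ "x$2"], rule exI[of _ "x$3"],
          rule exI[of _ "y$1"], rule exI[of _ "y$2"], rule exI[of _ "y$3"])
        (simp add: act_origin dact_dcoset a ip_Dmat metric_form_def vector3_eta)
  next
    fix r
    assume "\<exists>h\<in>SU3. \<exists>b c d b' c' d'. coset a = act h origin \<and>
        tvec_of a x = dact h (dcoset (Dmat b c d)) \<and> tvec_of a y = dact h (dcoset (Dmat b' c' d')) \<and>
        r = l1 * ip (Dmat b 0 0) (Dmat b' 0 0) + l2 * ip (Dmat 0 c 0) (Dmat 0 c' 0) +
          l3 * ip (Dmat 0 0 d) (Dmat 0 0 d')"
    then obtain h b c d b' c' d' where h: "h \<in> SU3" "coset a = coset h"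
      "tvec_of a x = tvec_of h (vector [b, c, d])" "tvec_of a y = tvec_of h (vector [b', c', d'])"
      and r: "r = metric_form l1 l2 l3 (vector [b, c, d]) (vector [b', c', d'])"
      by (auto simp: act_origin dact_dcoset ip_Dmat metric_form_def)
    obtain k where k: "k \<in> Tmax" "h = a ** k" using coset_eqD[OF h(2)] by blast
    then have "x = Ad k (vector [b, c, d])" "y = Ad k (vector [b', c', d'])"
      using h(3,4) by (simp_all add: tvec_of_mult_Tmax a tvec_of_eq_iff)
    then show "r = metric_form l1 l2 l3 x y" by (simp add: r metric_form_Ad k)
  qed
  then show ?thesis using assms by (simp add: represents_def)
qed

lemma flag_f_represents:
  assumes "{z1, z2, z3} \<subseteq> {-1, 0, 1}"
  shows "represents_f (flag_f z1 z2 z3) z1 z2 z3"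
proof -
  have "flag_f z1 z2 z3 (coset a) (tvec_of a x) = tvec_of a (f_endo z1 z2 z3 x)" if a: "a \<in> SU3" for a x
    unfolding flag_f_def
  proof (rule the_equality)
    show "\<exists>h\<in>SU3. \<exists>b c d. coset a = act h origin \<and> tvec_of a x = dact h (dcoset (Dmat b c d)) \<and>
        tvec_of a (f_endo z1 z2 z3 x) = dact h (dcoset (Dmat (of_int z1 * \<i> * b) (of_int z2 * \<i> * c) (of_int z3 * \<i> * d)))"
      by (rule bexI[OF _ a], rule exI[of _ "x$1"], rule exI[of _ "x$2"], rule exI[of _ "x$3"])
        (simp add: act_origin dact_dcoset a f_endo_def vector3_eta)
  next
    fix v
    assume "\<exists>h\<in>SU3. \<exists>b c d. coset a = act h origin \<and> tvec_of a x = dact h (dcoset (Dmat b c d)) \<and>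
        v = dact h (dcoset (Dmat (of_int z1 * \<i> * b) (of_int z2 * \<i> * c) (of_int z3 * \<i> * d)))"
    then obtain h b c d where h: "h \<in> SU3" "coset a = coset h" "tvec_of a x = tvec_of h (vector [b, c, d])"
      and v: "v = tvec_of h (f_endo z1 z2 z3 (vector [b, c, d]))"
      by (auto simp: act_origin dact_dcoset f_endo_def)
    obtain k where k: "k \<in> Tmax" "h = a ** k" using coset_eqD[OF h(2)] by blast
    then have "x = Ad k (vector [b, c, d])"
      using h(3) by (simp add: tvec_of_mult_Tmax a tvec_of_eq_iff)
    then show "v = tvec_of a (f_endo z1 z2 z3 x)" by (simp add: v k tvec_of_mult_Tmax a f_endo_Ad)
  qed
  then show ?thesis using assms by (simp add: represents_f_def)
qed

section \<open>Reduction of invariant tensors at the origin\<close>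

lemma vec3_decompose: "x = axis 1 (x$1) + axis 2 (x$2) + axis 3 (x$3)" for x :: "complex^3"
  by (simp add: vec_eq_iff forall_3 axis_def)

text \<open>Four elements of the torus suffice to reduce invariant tensors at the origin: the first two
  separate the summands, the last two induce multiplication by \<open>\<i>\<close>.\<close>

lemma Tmax_elements:
  "diag3 1 (-1) (-1) \<in> Tmax" "diag3 (-1) (-1) 1 \<in> Tmax"
  "diag3 \<i> 1 (- \<i>) \<in> Tmax" "diag3 1 (- \<i>) \<i> \<in> Tmax"
  by (rule diag3_Tmax; simp)+

lemma Ad_axis:
  "Ad (diag3 1 (-1) (-1)) (axis 1 z) = - axis 1 z" "Ad (diag3 1 (-1) (-1)) (axis 2 z) = axis 2 z"
  "Ad (diag3 1 (-1) (-1)) (axis 3 z) = - axis 3 z"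
  "Ad (diag3 (-1) (-1) 1) (axis 1 z) = axis 1 z" "Ad (diag3 (-1) (-1) 1) (axis 2 z) = - axis 2 z"
  "Ad (diag3 (-1) (-1) 1) (axis 3 z) = - axis 3 z"
  "Ad (diag3 \<i> 1 (- \<i>)) (axis 1 z) = axis 1 (\<i> * z)" "Ad (diag3 \<i> 1 (- \<i>)) (axis 2 z) = axis 2 (\<i> * z)"
  "Ad (diag3 1 (- \<i>) \<i>) (axis 3 z) = axis 3 (\<i> * z)"
  by (simp_all add: Ad_diag3 vec_eq_iff forall_3 axis_def)

text \<open>Invariance gives b 1 i = b i (-1) = - b i 1, so by symmetry the mixed values vanish; it
  also gives b i i = b 1 1.\<close>

lemma invariant_complex_form:
  fixes b :: "complex \<Rightarrow> complex \<Rightarrow> real"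
  assumes "\<And>z z' w. b (z + z') w = b z w + b z' w" "\<And>r z w. b (r *\<^sub>R z) w = r * b z w"
    and sym: "\<And>z w. b z w = b w z" and inv: "\<And>z w. b (\<i> * z) (\<i> * w) = b z w"
  shows "b z w = b 1 1 * Re (z * cnj w)"
proof -
  have r: "b z (w + w') = b z w + b z w'" "b z (r *\<^sub>R w) = r * b z w" for z w w' r
    using assms by metis+
  have "b 1 \<i> = b \<i> ((-1) *\<^sub>R 1)" using inv[of 1 \<i>] by simp
  then have 0: "b 1 \<i> = 0" "b \<i> 1 = 0" using sym[of 1 \<i>] by (simp_all only: r)
  have e: "z = Re z *\<^sub>R 1 + Im z *\<^sub>R \<i>" for z by (simp add: complex_eq_iff)
  have "b z w = b (Re z *\<^sub>R 1 + Im z *\<^sub>R \<i>) (Re w *\<^sub>R 1 + Im w *\<^sub>R \<i>)" using e by simp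
  also have "\<dots> = b 1 1 * (Re z * Re w) + b \<i> \<i> * (Im z * Im w)"
    by (simp only: assms(1,2) r 0) (simp add: algebra_simps)
  also have "b \<i> \<i> = b 1 1" using inv[of 1 1] by simp
  finally show ?thesis by (simp add: algebra_simps)
qed

text \<open>Any two different summands get opposite signs from one of the sign elements and are
  therefore orthogonal; an element acting as i on a summand leaves a single constant there.\<close>

lemma Tmax_invariant_form:
  fixes B :: "complex^3 \<Rightarrow> complex^3 \<Rightarrow> real"
  assumes add: "\<And>x x' y. B (x + x') y = B x y + B x' y" and scale: "\<And>r x y. B (r *\<^sub>R x) y = r * B x y"
    and sym: "\<And>x y. B x y = B y x" and inv: "\<And>k x y. k \<in> Tmax \<Longrightarrow> B (Ad k x) (Ad k y) = B x y"
  shows "B x y = metric_form (B (axis 1 1) (axis 1 1)) (B (axis 2 1) (axis 2 1)) (B (axis 3 1) (axis 3 1)) x y"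
proof -
  have add': "B x (y + y') = B x y + B x y'" for x y y' using add sym by metis
  have neg: "B (- x) y = - B x y" "B x (- y) = - B x y" for x y
    using scale[of "-1"] sym by (metis scaleR_minus1_left mult_minus1)+
  have z12: "B (axis 1 z) (axis 2 w) = 0" for z w
    using inv[OF Tmax_elements(1), of "axis 1 z" "axis 2 w"] by (simp add: Ad_axis neg)
  have z13: "B (axis 1 z) (axis 3 w) = 0" for z w
    using inv[OF Tmax_elements(2), of "axis 1 z" "axis 3 w"] by (simp add: Ad_axis neg)
  have z23: "B (axis 2 z) (axis 3 w) = 0" for z w
    using inv[OF Tmax_elements(1), of "axis 2 z" "axis 3 w"] by (simp add: Ad_axis neg)
  have z21: "B (axis 2 w) (axis 1 z) = 0" and z31: "B (axis 3 w) (axis 1 z) = 0"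
    and z32: "B (axis 3 w) (axis 2 z) = 0" for z w
    unfolding sym[of "axis 2 w" "axis 1 z"] sym[of "axis 3 w" "axis 1 z"] sym[of "axis 3 w" "axis 2 z"]
    by (rule z12 z13 z23)+
  have lin: "axis j (z + z') = axis j z + axis j z'" "axis j (r *\<^sub>R z) = r *\<^sub>R axis j z"
    for j :: 3 and z z' :: complex and r
    by (simp_all add: vec_eq_iff axis_def)
  have d: "B (axis j z) (axis j w) = B (axis j 1) (axis j 1) * Re (z * cnj w)"
    if "\<And>z w. B (axis j (\<i> * z)) (axis j (\<i> * w)) = B (axis j z) (axis j w)" for j z w
    by (rule invariant_complex_form[of "\<lambda>z w. B (axis j z) (axis j w)"])
      (simp_all only: lin add scale that, rule sym)
  have d1: "B (axis 1 z) (axis 1 w) = B (axis 1 1) (axis 1 1) * Re (z * cnj w)" for z w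
    using inv[OF Tmax_elements(3)] by (intro d) (metis Ad_axis(7))
  have d2: "B (axis 2 z) (axis 2 w) = B (axis 2 1) (axis 2 1) * Re (z * cnj w)" for z w
    using inv[OF Tmax_elements(3)] by (intro d) (metis Ad_axis(8))
  have d3: "B (axis 3 z) (axis 3 w) = B (axis 3 1) (axis 3 1) * Re (z * cnj w)" for z w
    using inv[OF Tmax_elements(4)] by (intro d) (metis Ad_axis(9))
  have "B x y = B (axis 1 (x$1) + axis 2 (x$2) + axis 3 (x$3)) (axis 1 (y$1) + axis 2 (y$2) + axis 3 (y$3))"
    using vec3_decompose by metis
  also have "\<dots> = B (axis 1 (x$1)) (axis 1 (y$1)) + B (axis 2 (x$2)) (axis 2 (y$2)) + B (axis 3 (x$3)) (axis 3 (y$3))"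
    unfolding add add' z12 z13 z23 z21 z31 z32 by simp
  finally show ?thesis by (simp only: d1[of "x$1"] d2[of "x$2"] d3[of "x$3"] metric_form_def)
qed

text \<open>Commuting with the sign elements forces diagonal blocks. Commuting with an element
  acting as i makes a block complex linear, hence multiplication by a number.\<close>

lemma Tmax_invariant_endomorphism:
  fixes \<phi> :: "complex^3 \<Rightarrow> complex^3"
  assumes lin: "linear \<phi>" and inv: "\<And>k x. k \<in> Tmax \<Longrightarrow> \<phi> (Ad k x) = Ad k (\<phi> x)"
  shows "\<phi> x = vector [\<phi> (axis 1 1) $ 1 * x$1, \<phi> (axis 2 1) $ 2 * x$2, \<phi> (axis 3 1) $ 3 * x$3]"
proof -
  note neg = linear_neg[OF lin]
  have inv1: "\<phi> (Ad (diag3 1 (-1) (-1)) x) = vector [- \<phi> x $ 1, \<phi> x $ 2, - \<phi> x $ 3]"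
    and inv2: "\<phi> (Ad (diag3 (-1) (-1) 1) x) = vector [\<phi> x $ 1, - \<phi> x $ 2, - \<phi> x $ 3]"
    and inv3: "\<phi> (Ad (diag3 \<i> 1 (- \<i>)) x) = vector [\<i> * \<phi> x $ 1, \<i> * \<phi> x $ 2, - \<phi> x $ 3]"
    and inv4: "\<phi> (Ad (diag3 1 (- \<i>) \<i>) x) = vector [\<i> * \<phi> x $ 1, - \<phi> x $ 2, \<i> * \<phi> x $ 3]" for x
    by (simp_all only: inv Tmax_elements) (simp_all add: Ad_diag3 mult_ac)
  have o1: "\<phi> (axis 1 z) $ 2 = 0" "\<phi> (axis 1 z) $ 3 = 0" for z
    using inv1[of "axis 1 z"] inv2[of "axis 1 z"] by (simp_all add: Ad_axis neg vec_eq_iff forall_3)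
  have o2: "\<phi> (axis 2 z) $ 1 = 0" "\<phi> (axis 2 z) $ 3 = 0" for z
    using inv1[of "axis 2 z"] inv2[of "axis 2 z"] by (simp_all add: Ad_axis neg vec_eq_iff forall_3)
  have o3: "\<phi> (axis 3 z) $ 1 = 0" "\<phi> (axis 3 z) $ 2 = 0" for z
    using inv1[of "axis 3 z"] inv2[of "axis 3 z"] by (simp_all add: Ad_axis neg vec_eq_iff forall_3)
  have i: "\<phi> (axis 1 (\<i> * z)) $ 1 = \<i> * \<phi> (axis 1 z) $ 1"
    "\<phi> (axis 2 (\<i> * z)) $ 2 = \<i> * \<phi> (axis 2 z) $ 2"
    "\<phi> (axis 3 (\<i> * z)) $ 3 = \<i> * \<phi> (axis 3 z) $ 3" for z
    using inv3[of "axis 1 z"] inv3[of "axis 2 z"] inv4[of "axis 3 z"]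
    by (simp_all add: Ad_axis)
  have m: "\<phi> (axis j z) $ j = \<phi> (axis j 1) $ j * z"
    if "\<phi> (axis j (\<i> * 1)) $ j = \<i> * \<phi> (axis j 1) $ j" for j z
  proof -
    have "axis j z = Re z *\<^sub>R axis j 1 + Im z *\<^sub>R (axis j \<i> :: complex^3)"
      by (simp add: vec_eq_iff axis_def complex_eq_iff)
    then have "\<phi> (axis j z) = Re z *\<^sub>R \<phi> (axis j 1) + Im z *\<^sub>R \<phi> (axis j \<i>)"
      by (simp add: linear_add[OF lin] linear_scale[OF lin])
    then have "\<phi> (axis j z) $ j = Re z *\<^sub>R \<phi> (axis j 1) $ j + Im z *\<^sub>R (\<i> * \<phi> (axis j 1) $ j)"
      using that by simp
    then show ?thesis by (simp add: complex_eq_iff algebra_simps)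
  qed
  have "\<phi> x = \<phi> (axis 1 (x$1)) + \<phi> (axis 2 (x$2)) + \<phi> (axis 3 (x$3))"
    using vec3_decompose[of x] linear_add[OF lin] by metis
  then show ?thesis
    by (simp add: vec_eq_iff forall_3 o1 o2 o3 m[OF i(1), of "x$1"] m[OF i(2), of "x$2"] m[OF i(3), of "x$3"])
qed

lemma coset_Tmax: "k \<in> Tmax \<Longrightarrow> coset k = coset (mat 1)"
  using coset_mult_Tmax[of k "mat 1"] by simp

lemma tvec_of_Tmax: "k \<in> Tmax \<Longrightarrow> tvec_of k x = tvec_of (mat 1) (Ad k x)"
  using tvec_of_mult_Tmax[OF mat_1_SU3, of k x] by simp

text \<open>Invariance carries the form at the origin to every frame. The torus fixes the origin, so
  the form is \<open>Ad\<close>-invariant, and its three constants are values on nonzero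
  vectors.\<close>

lemma invariant_metric_represents:
  assumes g: "invariant_metric g"
  shows "\<exists>l1 l2 l3. represents g l1 l2 l3"
proof -
  define B where "B x y = g origin (tvec_of (mat 1) x) (tvec_of (mat 1) y)" for x y
  have o: "origin \<in> flagM" "tangent origin = range (tvec_of (mat 1))"
    by (simp_all add: origin_def coset_flagM mat_1_SU3 tangent_coset)
  have gB: "g (coset a) (tvec_of a x) (tvec_of a y) = B x y" if a: "a \<in> SU3" for a x y
  proof -
    have "g (act a origin) (dact a (tvec_of (mat 1) x)) (dact a (tvec_of (mat 1) y)) = B x y"
      using g a o by (simp add: invariant_metric_def B_def)
    then show ?thesis by (simp add: act_origin dact_tvec_of a)
  qed
  have r: "g origin (u + v) w = g origin u w + g origin v w"
    "g origin (scal c v) w = c * g origin v w" "g origin v w = g origin w v"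
    "v \<noteq> 0 \<Longrightarrow> 0 < g origin v v"
    if "u \<in> tangent origin" "v \<in> tangent origin" "w \<in> tangent origin" for u v w c
    using g that o(1) unfolding invariant_metric_def riemannian_metric_def by blast+
  have add: "B (x + x') y = B x y + B x' y" for x x' y
    unfolding B_def tvec_of_add[OF mat_1_SU3] by (rule r(1)) (simp_all add: o(2))
  have scale: "B (c *\<^sub>R x) y = c * B x y" for c x y
    unfolding B_def tvec_of_scaleR[OF mat_1_SU3] by (rule r(2)[where u = "tvec_of (mat 1) x"]) (simp_all add: o(2))
  have sym: "B x y = B y x" for x y
    unfolding B_def by (rule r(3)[where u = "tvec_of (mat 1) x"]) (simp_all add: o(2))
  have pos: "0 < B x x" if "x \<noteq> 0" for x
    unfolding B_def by (rule r(4)[where u = "tvec_of (mat 1) x" and w = "tvec_of (mat 1) x"])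
      (simp_all add: o(2) that tvec_of_eq_0_iff mat_1_SU3)
  have inv: "B (Ad k x) (Ad k y) = B x y" if k: "k \<in> Tmax" for k x y
    using gB[OF Tmax_SU3[OF k], of x y] k by (simp add: coset_Tmax tvec_of_Tmax B_def origin_def)
  have "B x y = metric_form (B (axis 1 1) (axis 1 1)) (B (axis 2 1) (axis 2 1)) (B (axis 3 1) (axis 3 1)) x y" for x y
    by (rule Tmax_invariant_form[OF add scale sym inv])
  moreover have "0 < B (axis j 1) (axis j 1)" for j
    by (rule pos) (simp add: axis_eq_0_iff)
  ultimately show ?thesis using gB unfolding represents_def by metis
qed

lemma invariant_f_structure_represents:
  assumes f: "invariant_f_structure f"
  shows "\<exists>z1 z2 z3. represents_f f z1 z2 z3"
proof -
  define \<phi> where "\<phi> x = tvec_coords (mat 1) (f origin (tvec_of (mat 1) x))" for x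
  have o: "origin \<in> flagM" "tangent origin = range (tvec_of (mat 1))"
    by (simp_all add: origin_def coset_flagM mat_1_SU3 tangent_coset)
  have r: "f origin v \<in> tangent origin" "f origin (v + w) = f origin v + f origin w"
    "f origin (scal c v) = scal c (f origin v)" "f origin (f origin (f origin v)) + f origin v = 0"
    if "v \<in> tangent origin" "w \<in> tangent origin" for v w c
    using f that o(1) unfolding invariant_f_structure_def f_structure_def tensor_field_def by blast+
  have \<phi>: "f origin (tvec_of (mat 1) x) = tvec_of (mat 1) (\<phi> x)" for x
    using r(1)[of "tvec_of (mat 1) x" "tvec_of (mat 1) x"] by (auto simp: o(2) \<phi>_def mat_1_SU3)
  note inj = tvec_of_eq_iff[OF mat_1_SU3]
  have lin: "linear \<phi>"
  proof (rule linearI)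
    show "\<phi> (x + y) = \<phi> x + \<phi> y" for x y
      using r(2)[of "tvec_of (mat 1) x" "tvec_of (mat 1) y"] by (simp add: o(2) \<phi> inj mat_1_SU3 flip: tvec_of_add)
    show "\<phi> (c *\<^sub>R x) = c *\<^sub>R \<phi> x" for c x
      using r(3)[of "tvec_of (mat 1) x" "tvec_of (mat 1) x" c] by (simp add: o(2) \<phi> inj mat_1_SU3 flip: tvec_of_scaleR)
  qed
  have cube: "\<phi> (\<phi> (\<phi> x)) + \<phi> x = 0" for x
    using r(4)[of "tvec_of (mat 1) x" "tvec_of (mat 1) x"] by (simp add: o(2) \<phi> mat_1_SU3 tvec_of_eq_0_iff flip: tvec_of_add)
  have f\<phi>: "f (coset a) (tvec_of a x) = tvec_of a (\<phi> x)" if a: "a \<in> SU3" for a x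
  proof -
    have "f (act a origin) (dact a (tvec_of (mat 1) x)) = dact a (tvec_of (mat 1) (\<phi> x))"
      using f a o by (simp add: invariant_f_structure_def \<phi>)
    then show ?thesis by (simp add: act_origin dact_tvec_of a)
  qed
  have inv: "\<phi> (Ad k x) = Ad k (\<phi> x)" if k: "k \<in> Tmax" for k x
    using f\<phi>[OF Tmax_SU3[OF k], of x] k
    by (simp add: coset_Tmax tvec_of_Tmax \<phi>[unfolded origin_def] inj)
  note diag = Tmax_invariant_endomorphism[OF lin inv]
  have "\<exists>z\<in>{-1, 0, 1 :: int}. \<phi> (axis j 1) $ j = of_int z * \<i>" for j
  proof -
    let ?c = "\<phi> (axis j 1) $ j"
    have m: "\<phi> x $ j = ?c * x $ j" for x
      using exhaust_3[of j] diag[of x] by (auto simp: vec_eq_iff forall_3)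
    have "(\<phi> (\<phi> (\<phi> (axis j 1))) + \<phi> (axis j 1)) $ j = 0" by (simp add: cube)
    then have "?c * (?c * ?c) + ?c = 0" by (simp add: m[of "\<phi> _"])
    \<comment> \<open>The f-structure equation makes each eigenvalue a root of c^3 + c.\<close>
    then have "?c * (?c - \<i>) * (?c + \<i>) = 0" by (simp add: algebra_simps)
    then have "?c = 0 \<or> ?c = \<i> \<or> ?c = - \<i>" by (auto simp: eq_neg_iff_add_eq_0)
    then show ?thesis by auto
  qed
  then obtain z where z: "\<And>j. z j \<in> {-1, 0, 1 :: int}" "\<And>j. \<phi> (axis j 1) $ j = of_int (z j) * \<i>"
    by metis
  have "\<phi> x = f_endo (z 1) (z 2) (z 3) x" for x
    using diag[of x] by (simp add: z(2) f_endo_def)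
  then have "represents_f f (z 1) (z 2) (z 3)"
    using z(1)[of 1] z(1)[of 2] z(1)[of 3] by (simp add: represents_f_def f\<phi>)
  then show ?thesis by blast
qed

section \<open>The Kaehler condition\<close>

definition kaehler_cond :: "real \<Rightarrow> real \<Rightarrow> real \<Rightarrow> int \<Rightarrow> int \<Rightarrow> int \<Rightarrow> bool" where
  "kaehler_cond l1 l2 l3 z1 z2 z3 \<longleftrightarrow> (l1 = l2 + l3 \<or> z2 + z3 = 0) \<and>
    (l2 = l1 + l3 \<or> z1 + z3 = 0) \<and> (l3 = l1 + l2 \<or> z1 + z2 = 0)"

text \<open>The conjugation in \<open>nomizu\<close> turns the factor i \<zeta>_k on y_k into - i
  \<zeta>_k, while the target l carries i \<zeta>_l. So a term from y_k to l commutes iff its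
  coefficient or \<zeta>_k + \<zeta>_l vanishes. Exchanging k and l gives the same condition, so six
  terms carry three conditions.\<close>

lemma nomizu_f_endo_commute_iff:
  assumes l: "0 < l1" "0 < l2" "0 < l3"
  shows "(\<forall>x y. nomizu l1 l2 l3 x (f_endo z1 z2 z3 y) = f_endo z1 z2 z3 (nomizu l1 l2 l3 x y)) \<longleftrightarrow>
    kaehler_cond l1 l2 l3 z1 z2 z3"
proof
  assume "\<forall>x y. nomizu l1 l2 l3 x (f_endo z1 z2 z3 y) = f_endo z1 z2 z3 (nomizu l1 l2 l3 x y)"
  then have e: "nomizu l1 l2 l3 x (f_endo z1 z2 z3 y) $ j = f_endo z1 z2 z3 (nomizu l1 l2 l3 x y) $ j" for x y j
    by simp
  have s: "a = 0 \<or> p + q = 0"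
    if "a * real_of_int p / b = - (a * real_of_int q / b)" "0 < b" for a b :: real and p q :: int
  proof -
    have "a * (real_of_int p + real_of_int q) = 0" using that by (simp add: field_simps)
    then show ?thesis by (simp flip: of_int_add)
  qed
  \<comment> \<open>Basis vectors isolate a single term of \<open>nomizu\<close>; three of the six
    are tested, one for each pair of indices.\<close>
  have "(l1 + l3 - l2) * real_of_int z3 / (2 * l1) = - ((l1 + l3 - l2) * real_of_int z1 / (2 * l1))"
    using e[of "axis 2 1" "axis 3 1" 1] by (simp add: nomizu_def f_endo_def axis_def complex_eq_iff; simp add: field_simps)
  from s[OF this] have "l1 + l3 - l2 = 0 \<or> z3 + z1 = 0" using l by simp
  moreover have "(l1 + l2 - l3) * real_of_int z2 / (2 * l1) = - ((l1 + l2 - l3) * real_of_int z1 / (2 * l1))"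
    using e[of "axis 3 1" "axis 2 1" 1] by (simp add: nomizu_def f_endo_def axis_def complex_eq_iff; simp add: field_simps)
  from s[OF this] have "l1 + l2 - l3 = 0 \<or> z2 + z1 = 0" using l by simp
  moreover have "(l2 + l3 - l1) * real_of_int z3 / (2 * l2) = - ((l2 + l3 - l1) * real_of_int z2 / (2 * l2))"
    using e[of "axis 1 1" "axis 3 1" 2] by (simp add: nomizu_def f_endo_def axis_def complex_eq_iff; simp add: field_simps)
  from s[OF this] have "l2 + l3 - l1 = 0 \<or> z3 + z2 = 0" using l by simp
  ultimately show "kaehler_cond l1 l2 l3 z1 z2 z3"
    unfolding kaehler_cond_def by (smt (verit))
next
  assume c: "kaehler_cond l1 l2 l3 z1 z2 z3"
  have t: "a *\<^sub>R cnj (s * (of_int p * \<i> * w)) = of_int q * \<i> * (a *\<^sub>R cnj (s * w))"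
    if "a = 0 \<or> p + q = 0" for a :: real and p q and s w :: complex
  proof -
    have "p + q = 0 \<Longrightarrow> of_int p = - (of_int q :: complex)"
      by (metis add.commute add_eq_0_iff of_int_minus)
    then show ?thesis using that by auto
  qed
  have "(l1 + l3 - l2) / (2 * l1) = 0 \<or> z3 + z1 = 0" "(l1 + l2 - l3) / (2 * l1) = 0 \<or> z2 + z1 = 0"
    "(l2 + l1 - l3) / (2 * l2) = 0 \<or> z1 + z2 = 0" "(l2 + l3 - l1) / (2 * l2) = 0 \<or> z3 + z2 = 0"
    "(l3 + l2 - l1) / (2 * l3) = 0 \<or> z2 + z3 = 0" "(l3 + l1 - l2) / (2 * l3) = 0 \<or> z1 + z3 = 0"
    using c l by (auto simp: kaehler_cond_def)
  then show "\<forall>x y. nomizu l1 l2 l3 x (f_endo z1 z2 z3 y) = f_endo z1 z2 z3 (nomizu l1 l2 l3 x y)"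
    by (simp only: nomizu_def f_endo_def vector_3 t right_diff_distrib simp_thms)
qed

text \<open>The witness is the field generated by the left action of a one-parameter group with
  velocity \<open>Dvec x\<close>: in the frame a that velocity reads
  \<open>ctranspose a ** Dvec x ** a\<close>, and the projection to cosets drops the
  diagonal.\<close>

lemma exists_vfield:
  "\<exists>X\<in>vfields. coords X (mat 1) = x"
proof -
  let ?\<xi> = "\<lambda>a. off_diagonal (ctranspose a ** Dvec x ** a)"
  have "equivariant ?\<xi>"
    unfolding equivariant_def
  proof (intro ballI)
    fix a k assume a: "a \<in> SU3" and k: "k \<in> Tmax"
    let ?A = "ctranspose a ** Dvec x ** a"
    obtain u v w where k': "k = diag3 u v w" using k by (rule TmaxE)
    \<comment> \<open>Conjugation by a diagonal matrix acts on each entry separately, so this holds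
      for any A.\<close>
    have Ad: "off_diagonal (ctranspose k ** A ** k) = Ad (ctranspose k) (off_diagonal A)" for A
      by (simp add: k' ctranspose_diag3 Ad_diag3 vec_eq_iff forall_3 mat3_mult_nth)
    have "ctranspose (a ** k) ** Dvec x ** (a ** k) = ctranspose k ** ?A ** k"
      by (simp add: ctranspose_mult matrix_mul_assoc)
    also have "off_diagonal \<dots> = Ad (ctranspose k) (off_diagonal ?A)"
      by (rule Ad)
    finally show "?\<xi> (a ** k) = Ad (ctranspose k) (?\<xi> a)" .
  qed
  moreover have "smooth_SU3 ?\<xi>"
    by (intro smooth_SU3_smooth smooth_linear_compose[OF off_diagonal_bounded_linear]
        smooth_bilinear[OF matrix_mult_bounded_bilinear] smooth_const smooth_linear
        ctranspose_bounded_linear bounded_linear_ident)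
  ultimately show ?thesis
    using vfield_of_vfield coords_vfield_of[OF _ mat_1_SU3, of ?\<xi>] by (intro bexI[of _ "vfield_of ?\<xi>"]) simp_all
qed

text \<open>\<open>f_endo\<close> is linear and independent of the frame, so the derivative terms
  cancel and an algebraic commutator remains. By \<open>exists_vfield\<close> it is tested on all x
  and y at the identity.\<close>

lemma kaehler_iff:
  assumes g: "represents g l1 l2 l3" and f: "represents_f f z1 z2 z3"
  shows "kaehler_f_structure g f \<longleftrightarrow> kaehler_cond l1 l2 l3 z1 z2 z3"
proof -
  have l: "0 < l1" "0 < l2" "0 < l3" using g by (simp_all add: represents_def)
  let ?J = "f_endo z1 z2 z3" and ?L = "nomizu l1 l2 l3" and ?D = "nabla l1 l2 l3"
  have c: "coords (?D X (tapply f Y) - tapply f (?D X Y)) a = ?L (coords X a) (?J (coords Y a)) - ?J (?L (coords X a) (coords Y a))"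
    if V: "X \<in> vfields" "Y \<in> vfields" and a: "a \<in> SU3" for X Y a
  proof -
    have "lderiv (coords (tapply f Y)) a (coords X a) = ?J (lderiv (coords Y) a (coords X a))"
      using lderiv_cong[OF coords_tapply[OF f V(2)] a] lderiv_linear_compose[OF f_endo_bounded_linear smooth_SU3_coords[OF V(2)] a]
      by simp
    then show ?thesis
      by (simp add: coords_minus coords_nabla coords_tapply[OF f] vfield_nabla vfield_tapply[OF f] V a
          linear_add[OF bounded_linear.linear[OF f_endo_bounded_linear]])
  qed
  have z: "0 \<in> vfields" "a \<in> SU3 \<Longrightarrow> coords 0 a = 0" for a
    by (rule vfieldI[where \<xi> = "\<lambda>a. 0"]; simp add: smooth_SU3_const tvec_of_0)
      (rule coords_eqI; simp add: tvec_of_0)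
  show ?thesis
    unfolding nomizu_f_endo_commute_iff[OF l, symmetric]
  proof
    assume "kaehler_f_structure g f"
    then obtain D where D: "levi_civita g D"
      and D0: "\<And>X Y. X \<in> vfields \<Longrightarrow> Y \<in> vfields \<Longrightarrow> D X (tapply f Y) - tapply f (D X Y) = 0"
      by (auto simp: kaehler_f_structure_def)
    \<comment> \<open>Uniqueness of the connection replaces the unspecified D by
      \<open>nabla\<close>.\<close>
    have D0: "?D X (tapply f Y) - tapply f (?D X Y) = 0" if "X \<in> vfields" "Y \<in> vfields" for X Y
      using D0[OF that] levi_civita_unique[OF g D levi_civita_nabla[OF g]] that vfield_tapply[OF f] by simp
    show "\<forall>x y. ?L x (?J y) = ?J (?L x y)"
    proof (intro allI)
      fix x y
      obtain X where X: "X \<in> vfields" "coords X (mat 1) = x" using exists_vfield by blast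
      obtain Y where Y: "Y \<in> vfields" "coords Y (mat 1) = y" using exists_vfield by blast
      show "?L x (?J y) = ?J (?L x y)"
        using c[OF X(1) Y(1) mat_1_SU3] by (simp add: D0 X Y z mat_1_SU3)
    qed
  next
    assume L: "\<forall>x y. ?L x (?J y) = ?J (?L x y)"
    have "?D X (tapply f Y) - tapply f (?D X Y) = 0" if "X \<in> vfields" "Y \<in> vfields" for X Y
      by (rule vfield_eqI) (simp_all add: that z c L vfield_minus vfield_nabla vfield_tapply[OF f])
    then show "kaehler_f_structure g f"
      unfolding kaehler_f_structure_def
      using represents_riemannian_metric[OF g] represents_metric_f_structure[OF g f] levi_civita_nabla[OF g] by blast
  qed
qed

lemma invariant_kaehler_iff:
  assumes "represents g l1 l2 l3" "represents_f f z1 z2 z3"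
  shows "invariant_kaehler g f \<longleftrightarrow> kaehler_cond l1 l2 l3 z1 z2 z3"
  by (simp add: invariant_kaehler_def kaehler_iff[OF assms] represents_invariant_metric[OF assms(1)]
      represents_f_structure[OF assms(2)])

section \<open>Normalisation of scale and sign, and the rank\<close>

lemma represents_homothetic:
  assumes "represents g l1 l2 l3" "t = l2 / l1" "s = l3 / l1"
  shows "homothetic g (flag_metric 1 t s)"
proof -
  have l: "0 < l1" "0 < l2" "0 < l3" using assms by (simp_all add: represents_def)
  have r: "represents (flag_metric 1 t s) 1 t s"
    using l by (intro flag_metric_represents) (simp_all add: assms)
  have "g p v w = l1 * flag_metric 1 t s p v w"
    if p: "p \<in> flagM" and t: "v \<in> tangent p" "w \<in> tangent p" for p v w
  proof -
    obtain a where a: "a \<in> SU3" "p = coset a" using p by (auto simp: flagM_def)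
    obtain x y where "v = tvec_of a x" "w = tvec_of a y" using t by (auto simp: a tangent_coset)
    moreover have "metric_form l1 l2 l3 x y = l1 * metric_form 1 (l2 / l1) (l3 / l1) x y" for x y
      using l by (simp add: metric_form_def field_simps)
    ultimately show ?thesis using assms r a by (simp add: represents_def)
  qed
  then show ?thesis using l by (auto simp: homothetic_def)
qed

lemma represents_f_eq_up_to_sign:
  assumes f: "represents_f f (e * z1) (e * z2) (e * z3)" and e: "e = 1 \<or> e = -1"
    and z: "{z1, z2, z3} \<subseteq> {-1, 0, 1}"
  shows "eq_up_to_sign f (flag_f z1 z2 z3)"
proof -
  have "f p v = scal (of_int e) (flag_f z1 z2 z3 p v)" if p: "p \<in> flagM" and t: "v \<in> tangent p" for p v
  proof -
    obtain a where a: "a \<in> SU3" "p = coset a" using p by (auto simp: flagM_def)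
    obtain x where x: "v = tvec_of a x" using t by (auto simp: a tangent_coset)
    have "f_endo (e * z1) (e * z2) (e * z3) x = of_int e *\<^sub>R f_endo z1 z2 z3 x"
      using e by (auto simp: vec_eq_iff forall_3 f_endo_def)
    then show ?thesis
      by (simp add: a x represents_f_apply[OF f] represents_f_apply[OF flag_f_represents[OF z]] tvec_of_scaleR)
  qed
  moreover have "real_of_int e \<in> {1, -1}" using e by auto
  ultimately show ?thesis unfolding eq_up_to_sign_def by blast
qed

text \<open>When one equation between the metric constants holds, the other two conditions make z1,
  z2, z3 equal up to sign, so they vanish together or not at all.\<close>

lemma kaehler_cond_cases:
  assumes "kaehler_cond l1 l2 l3 z1 z2 z3" "0 < l1" "0 < l2" "0 < l3"
  obtains "z1 = 0" "z2 = 0" "z3 = 0" | "l2 = l1 + l3" "z2 = - z1" "z3 = z1" "z1 \<noteq> 0"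
    | "l3 = l1 + l2" "z2 = z1" "z3 = - z1" "z1 \<noteq> 0" | "l1 = l2 + l3" "z2 = - z1" "z3 = - z1" "z1 \<noteq> 0"
  using assms unfolding kaehler_cond_def by (smt (verit))

text \<open>By \<open>kaehler_cond_cases\<close> these are the two patterns that occur. In the
  second the rank is the real dimension of \<open>complex^3\<close>, carried over by the linear
  injection \<open>tvec_of a\<close>.\<close>

lemma f_rank_eq:
  assumes f: "represents_f f z1 z2 z3" and p: "p \<in> flagM"
  shows "z1 = 0 \<Longrightarrow> z2 = 0 \<Longrightarrow> z3 = 0 \<Longrightarrow> f_rank f p = 0"
    and "z1 \<noteq> 0 \<Longrightarrow> z2 \<noteq> 0 \<Longrightarrow> z3 \<noteq> 0 \<Longrightarrow> f_rank f p = 6"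
proof -
  interpret V: vector_space scal by (rule vector_space_scal)
  \<comment> \<open>Only the source is finite-dimensional: tangent vectors live in the space of all
    functionals.\<close>
  interpret P: finite_dimensional_vector_space_pair_1
    "(*\<^sub>R) :: real \<Rightarrow> complex^3 \<Rightarrow> complex^3" Basis scal by unfold_locales
  obtain a where a: "a \<in> SU3" "p = coset a" using p by (auto simp: flagM_def)
  have im: "f p ` tangent p = tvec_of a ` range (f_endo z1 z2 z3)"
    using represents_f_apply[OF f a(1)] by (simp add: a tangent_coset image_image)
  {
    assume "z1 = 0" "z2 = 0" "z3 = 0"
    then have "range (f_endo z1 z2 z3) = {0}" by (auto simp: f_endo_def vec_eq_iff forall_3)
    then have "f p ` tangent p = {0}" unfolding im by (simp add: tvec_of_0 a(1))
    then show "f_rank f p = 0"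
      using V.dim_eq_card[of "{}" "{0}"] by (simp add: f_rank_def V.span_insert_0 V.independent_empty)
  next
    assume z: "z1 \<noteq> 0" "z2 \<noteq> 0" "z3 \<noteq> 0"
    have "x = f_endo z1 z2 z3 (vector [x$1 / (of_int z1 * \<i>), x$2 / (of_int z2 * \<i>), x$3 / (of_int z3 * \<i>)])" for x
      using z by (simp add: f_endo_def vec_eq_iff forall_3)
    then have "range (f_endo z1 z2 z3) = UNIV" unfolding surj_def by blast
    then have "f_rank f p = V.dim (tvec_of a ` UNIV)" by (simp add: f_rank_def im)
    also have "\<dots> = dim (UNIV :: (complex^3) set)"
    proof -
      have "Vector_Spaces.linear (*\<^sub>R) scal (tvec_of a)"
        by unfold_locales (simp_all add: tvec_of_add tvec_of_scaleR a)
      from P.dim_image_eq[OF this, of UNIV] show ?thesis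
        by (simp add: inj_on_def tvec_of_eq_iff a dim_raw_def)
    qed
    also have "\<dots> = 6" by (simp add: DIM_complex)
    finally show "f_rank f p = 6" .
  }
qed

theorem proposition1:
  shows "(\<forall>t::real. 1 < t \<longrightarrow> invariant_kaehler (flag_metric 1 t (t - 1)) (flag_f 1 (-1) 1)) \<and>
    (\<forall>t::real. 0 < t \<longrightarrow> invariant_kaehler (flag_metric 1 t (t + 1)) (flag_f 1 1 (-1))) \<and>
    (\<forall>t::real. 0 < t \<and> t < 1 \<longrightarrow>
       invariant_kaehler (flag_metric 1 t (1 - t)) (flag_f 1 (-1) (-1))) \<and>
    (\<forall>g f. invariant_kaehler g f \<and> nonzero_f f \<longrightarrow>
       (\<exists>t>1. homothetic g (flag_metric 1 t (t - 1)) \<and> eq_up_to_sign f (flag_f 1 (-1) 1)) \<or>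
       (\<exists>t>0. homothetic g (flag_metric 1 t (t + 1)) \<and> eq_up_to_sign f (flag_f 1 1 (-1))) \<or>
       (\<exists>t. 0 < t \<and> t < 1 \<and>
          homothetic g (flag_metric 1 t (1 - t)) \<and> eq_up_to_sign f (flag_f 1 (-1) (-1)))) \<and>
    (\<forall>g f. invariant_kaehler g f \<longrightarrow> (\<forall>p\<in>flagM. f_rank f p \<noteq> 2 \<and> f_rank f p \<noteq> 4))"
proof -
  have examples: "invariant_kaehler (flag_metric 1 t s) (flag_f z1 z2 z3)"
    if "kaehler_cond 1 t s z1 z2 z3" "0 < t" "0 < s" "{z1, z2, z3} \<subseteq> {-1, 0, 1}" for t s z1 z2 z3
    using that invariant_kaehler_iff[OF flag_metric_represents flag_f_represents] by simp
  have param: "\<exists>l1 l2 l3 z1 z2 z3. represents g l1 l2 l3 \<and> represents_f f z1 z2 z3 \<and>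
      kaehler_cond l1 l2 l3 z1 z2 z3" if "invariant_kaehler g f" for g f
    using that invariant_metric_represents invariant_f_structure_represents invariant_kaehler_iff
    unfolding invariant_kaehler_def by metis
  have rank: "f_rank f p \<noteq> 2 \<and> f_rank f p \<noteq> 4" if k: "invariant_kaehler g f" and p: "p \<in> flagM" for g f p
  proof -
    obtain l1 l2 l3 z1 z2 z3 where r: "represents g l1 l2 l3" "represents_f f z1 z2 z3"
      and c: "kaehler_cond l1 l2 l3 z1 z2 z3" using param[OF k] by blast
    have "0 < l1" "0 < l2" "0 < l3" using r(1) by (simp_all add: represents_def)
    with c have "f_rank f p = 0 \<or> f_rank f p = 6"
      by (rule kaehler_cond_cases) (use f_rank_eq[OF r(2) p] in auto)
    then show ?thesis by auto
  qed
  have classification: "(\<exists>t>1. homothetic g (flag_metric 1 t (t - 1)) \<and> eq_up_to_sign f (flag_f 1 (-1) 1)) \<or>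
       (\<exists>t>0. homothetic g (flag_metric 1 t (t + 1)) \<and> eq_up_to_sign f (flag_f 1 1 (-1))) \<or>
       (\<exists>t. 0 < t \<and> t < 1 \<and>
          homothetic g (flag_metric 1 t (1 - t)) \<and> eq_up_to_sign f (flag_f 1 (-1) (-1)))"
    if k: "invariant_kaehler g f" and n: "nonzero_f f" for g f
  proof -
    obtain l1 l2 l3 z1 z2 z3 where g: "represents g l1 l2 l3" and f: "represents_f f z1 z2 z3"
      and c: "kaehler_cond l1 l2 l3 z1 z2 z3" using param[OF k] by blast
    have l: "0 < l1" "0 < l2" "0 < l3" using g by (simp_all add: represents_def)
    have z1: "z1 = 1 \<or> z1 = -1" if "z1 \<noteq> 0" using f that by (auto simp: represents_f_def)
    show ?thesis
      using c l
    proof (cases rule: kaehler_cond_cases)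
      case 1
      have "f p v = 0" if p: "p \<in> flagM" and t: "v \<in> tangent p" for p v
      proof -
        obtain a where a: "a \<in> SU3" "p = coset a" using p by (auto simp: flagM_def)
        obtain x where x: "v = tvec_of a x" using t by (auto simp: a tangent_coset)
        have "f_endo z1 z2 z3 x = 0" by (simp add: 1 f_endo_def vec_eq_iff forall_3)
        then show ?thesis by (simp add: a x represents_f_apply[OF f] tvec_of_0)
      qed
      then show ?thesis using n by (auto simp: nonzero_f_def)
    next
      case 2
      \<comment> \<open>Dividing by l1 gives t = l2 / l1, and l2 = l1 + l3 becomes l3 / l1 = t -
        1.\<close>
      have "homothetic g (flag_metric 1 (l2 / l1) (l2 / l1 - 1))"
        using 2 l by (intro represents_homothetic[OF g]) (simp_all add: field_simps)
      \<comment> \<open>Here z1 is 1 or -1 and the triple is z1 times (1, -1, 1), so z1 itself is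
        the sign.\<close>
      moreover have "eq_up_to_sign f (flag_f 1 (-1) 1)"
        using f 2 z1 by (intro represents_f_eq_up_to_sign[where e = z1]) simp_all
      moreover have "1 < l2 / l1" using 2 l by simp
      ultimately show ?thesis by blast
    next
      case 3
      have "homothetic g (flag_metric 1 (l2 / l1) (l2 / l1 + 1))"
        using 3 l by (intro represents_homothetic[OF g]) (simp_all add: field_simps)
      moreover have "eq_up_to_sign f (flag_f 1 1 (-1))"
        using f 3 z1 by (intro represents_f_eq_up_to_sign[where e = z1]) simp_all
      moreover have "0 < l2 / l1" using l by simp
      ultimately show ?thesis by blast
    next
      case 4
      have "homothetic g (flag_metric 1 (l2 / l1) (1 - l2 / l1))"
        using 4 l by (intro represents_homothetic[OF g]) (simp_all add: field_simps)
      moreover have "eq_up_to_sign f (flag_f 1 (-1) (-1))"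
        using f 4 z1 by (intro represents_f_eq_up_to_sign[where e = z1]) simp_all
      moreover have "0 < l2 / l1" "l2 / l1 < 1" using 4 l by simp_all
      ultimately show ?thesis by blast
    qed
  qed
  show ?thesis
    using classification rank by (intro conjI allI impI ballI examples) (auto simp: kaehler_cond_def)
qed

end
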